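(* Let $\tau>0$. The operator $\mathsf{T}_\tau=\Pi_h\Pi_\tau\Pi_h\colon H^2(Y)\to H^2(Y)$ is positive, trace class, and $\mathrm{SO}(3)$-equivariant. For each $\ell\in\mathbb{N}_0$, on $V_\ell\otimes\mathbb{C}\widehat u_\ell$ it acts by the scalar $$s_\ell(\tau)=\bigl|\langle\widehat w_\ell(\tau),\widehat u_\ell\rangle\bigr|^2,$$ which has multiplicity $2\ell+1$.
   Context: The Peter--Weyl decomposition is $L^2(\mathrm{SO}(3))\simeq\bigoplus_{\ell\ge0}V_\ell\otimes V_\ell^*$ (normalized Haar measure), with $V_\ell$ the irreducible unitary $\mathrm{SO}(3)$ representation of dimension $2\ell+1$; the left regular action of $\mathrm{SO}(3)$ acts on the first factor, and equivariance refers to this action. Via a fixed equivariant unitary identification, $V_\ell^*\simeq V_\ell\simeq\mathrm{Sym}^{2\ell}\mathbb{C}^2$, the homogeneous polynomials of degree $2\ell$ in $(z_0,z_1)$, with the invariant inner product for which monomials are orthogonal and $\|z_0^{2\ell-k}z_1^k\|^2=\binom{2\ell}{k}^{-1}$. Put $$u_\ell=z_0^{2\ell},\qquad w_\ell(\tau)=(z_0^2+z_1^2+2\coth\tau\,z_0z_1)^\ell,\qquad \widehat v=v/\|v\|.$$ $H^2(Y)$ (the Hardy space of the unit circle bundle $Y$ of $\mathcal{O}(-2)\to\mathbb{CP}^1$) and $H^2(\partial M_\tau)$ (the Hardy space of the boundary of the radius-$\tau$ Grauert tube of the round $\mathbb{S}^2$) are realized in $L^2(\mathrm{SO}(3))$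 as the Hilbert direct sums $$H^2(Y)=\widehat{\bigoplus_{\ell\ge0}}V_\ell\otimes\mathbb{C}u_\ell,\qquad H^2(\partial M_\tau)=\widehat{\bigoplus_{\ell\ge0}}V_\ell\otimes\mathbb{C}w_\ell(\tau).$$ $\Pi_h$ and $\Pi_\tau$ are the orthogonal projectors of $L^2(\mathrm{SO}(3))$ onto $H^2(Y)$ and $H^2(\partial M_\tau)$. *)

theory Defs
  imports "HOL-Probability.Probability_Measure"
begin

section \<open>Square-integrable functions\<close>

text \<open>
  Elements of \<open>L\<^sup>2(M)\<close> are represented by square-integrable functions, and equality in
  \<open>L\<^sup>2(M)\<close> is equality almost everywhere.  Inner products are linear in the first argument.
\<close>

definition L2 :: "'a measure \<Rightarrow> ('a \<Rightarrow> complex) set" where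
  "L2 M = {f. f \<in> borel_measurable M \<and> integrable M (\<lambda>x. (cmod (f x))\<^sup>2)}"

definition l2_inner :: "'a measure \<Rightarrow> ('a \<Rightarrow> complex) \<Rightarrow> ('a \<Rightarrow> complex) \<Rightarrow> complex" where
  "l2_inner M f g = (LINT x|M. f x * cnj (g x))"

definition l2_norm :: "'a measure \<Rightarrow> ('a \<Rightarrow> complex) \<Rightarrow> real" where
  "l2_norm M f = sqrt (LINT x|M. (cmod (f x))\<^sup>2)"

definition l2_eq :: "'a measure \<Rightarrow> ('a \<Rightarrow> complex) \<Rightarrow> ('a \<Rightarrow> complex) \<Rightarrow> bool" where
  "l2_eq M f g \<longleftrightarrow> (AE x in M. f x = g x)"

text \<open>
  The internal Hilbert direct sum of subspaces \<open>F 0, F 1, \<dots>\<close> of \<open>L\<^sup>2(M)\<close>, meant for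
  finite-dimensional, pairwise orthogonal \<open>F l\<close>.
\<close>

definition hilbert_sum :: "'a measure \<Rightarrow> (nat \<Rightarrow> ('a \<Rightarrow> complex) set) \<Rightarrow> ('a \<Rightarrow> complex) set" where
  "hilbert_sum M F = {f \<in> L2 M. \<exists>b. (\<forall>l. b l \<in> F l) \<and>
      (\<lambda>n. l2_norm M (\<lambda>x. f x - (\<Sum>l<n. b l x))) \<longlonglongrightarrow> 0}"

text \<open>
  The value is determined up to a null set, for \<open>f \<in> L2 M\<close> and a closed subspace \<open>S\<close>.
\<close>

definition orth_proj :: "'a measure \<Rightarrow> ('a \<Rightarrow> complex) set \<Rightarrow> ('a \<Rightarrow> complex) \<Rightarrow> ('a \<Rightarrow> complex)" where
  "orth_proj M S f = (SOME h. h \<in> S \<and> (\<forall>k\<in>S. l2_inner M (\<lambda>x. f x - h x) k = 0))"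

definition orthonormal_basis_on :: "'a measure \<Rightarrow> ('a \<Rightarrow> complex) set \<Rightarrow> ('a \<Rightarrow> complex) set \<Rightarrow> bool" where
  "orthonormal_basis_on M S E \<longleftrightarrow> E \<subseteq> S \<and>
     (\<forall>e\<in>E. \<forall>e'\<in>E. l2_inner M e e' = (if e = e' then 1 else 0)) \<and>
     (\<forall>f\<in>S. (\<forall>e\<in>E. l2_inner M f e = 0) \<longrightarrow> l2_eq M f (\<lambda>x. 0))"

definition l2_has_dim :: "'a measure \<Rightarrow> ('a \<Rightarrow> complex) set \<Rightarrow> nat \<Rightarrow> bool" where
  "l2_has_dim M S n \<longleftrightarrow> (\<exists>E. finite E \<and> card E = n \<and> orthonormal_basis_on M S E)"

section \<open>Operators on closed subspaces of \<open>L\<^sup>2(M)\<close>\<close>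

text \<open>
  Linearity is up to null sets.  Together with boundedness it implies that \<open>T\<close> respects equality
  almost everywhere.
\<close>

definition bounded_op_on ::
    "'a measure \<Rightarrow> ('a \<Rightarrow> complex) set \<Rightarrow> (('a \<Rightarrow> complex) \<Rightarrow> ('a \<Rightarrow> complex)) \<Rightarrow> bool" where
  "bounded_op_on M H T \<longleftrightarrow>
     (\<forall>f\<in>H. T f \<in> H) \<and>
     (\<forall>f\<in>H. \<forall>g\<in>H. \<forall>a b. l2_eq M (T (\<lambda>x. a * f x + b * g x)) (\<lambda>x. a * T f x + b * T g x)) \<and>
     (\<exists>C. \<forall>f\<in>H. l2_norm M (T f) \<le> C * l2_norm M f)"

definition positive_op_on ::
    "'a measure \<Rightarrow> ('a \<Rightarrow> complex) set \<Rightarrow> (('a \<Rightarrow> complex) \<Rightarrow> ('a \<Rightarrow> complex)) \<Rightarrow> bool" where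
  "positive_op_on M H T \<longleftrightarrow> bounded_op_on M H T \<and>
     (\<forall>f\<in>H. Im (l2_inner M (T f) f) = 0 \<and> 0 \<le> Re (l2_inner M (T f) f))"

text \<open>
  \<open>P = |T|\<close>, the positive square root of \<open>T\<^sup>* T\<close>: as \<open>P\<close> is self-adjoint, the last condition
  says that \<open>P\<^sup>2 = T\<^sup>* T\<close>.
\<close>

definition abs_op_on ::
    "'a measure \<Rightarrow> ('a \<Rightarrow> complex) set \<Rightarrow> (('a \<Rightarrow> complex) \<Rightarrow> ('a \<Rightarrow> complex))
      \<Rightarrow> (('a \<Rightarrow> complex) \<Rightarrow> ('a \<Rightarrow> complex)) \<Rightarrow> bool" where
  "abs_op_on M H T P \<longleftrightarrow> positive_op_on M H P \<and>
     (\<forall>f\<in>H. \<forall>g\<in>H. l2_inner M (P f) (P g) = l2_inner M (T f) (T g))"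

definition trace_class_on ::
    "'a measure \<Rightarrow> ('a \<Rightarrow> complex) set \<Rightarrow> (('a \<Rightarrow> complex) \<Rightarrow> ('a \<Rightarrow> complex)) \<Rightarrow> bool" where
  "trace_class_on M H T \<longleftrightarrow> bounded_op_on M H T \<and>
     (\<exists>P. abs_op_on M H T P \<and>
        (\<forall>E. orthonormal_basis_on M H E \<longrightarrow> (\<lambda>e. Re (l2_inner M (P e) e)) summable_on E))"

section \<open>The rotation group and its Haar measure\<close>

definition SO3 :: "(real^3^3) set" where
  "SO3 = {R. rotation_matrix R}"

definition haar_prob_SO3 :: "(real^3^3) measure \<Rightarrow> bool" where
  "haar_prob_SO3 \<mu> \<longleftrightarrow> prob_space \<mu> \<and> space \<mu> = SO3 \<and> sets \<mu> = sets (restrict_space borel SO3) \<and>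
     (\<forall>h\<in>SO3. distr \<mu> \<mu> (\<lambda>g. h ** g) = \<mu>)"

definition left_regular :: "real^3^3 \<Rightarrow> (real^3^3 \<Rightarrow> complex) \<Rightarrow> (real^3^3 \<Rightarrow> complex)" where
  "left_regular h f = (\<lambda>g. f (matrix_inv h ** g))"

definition equivariant_on ::
    "(real^3^3) measure \<Rightarrow> (real^3^3 \<Rightarrow> complex) set
      \<Rightarrow> ((real^3^3 \<Rightarrow> complex) \<Rightarrow> (real^3^3 \<Rightarrow> complex)) \<Rightarrow> bool" where
  "equivariant_on \<mu> H T \<longleftrightarrow>
     (\<forall>h\<in>SO3. \<forall>f\<in>H. left_regular h f \<in> H \<and> l2_eq \<mu> (T (left_regular h f)) (left_regular h (T f)))"

section \<open>The representations \<open>V\<^sub>\<ell> = Sym\<^bsup>2\<ell>\<^esup> \<complex>\<^sup>2\<close>\<close>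

text \<open>
  Homogeneous polynomials of degree \<open>2 * l\<close> in \<open>(z\<^sub>0, z\<^sub>1)\<close>, as polynomial functions on \<open>\<complex>\<^sup>2\<close>;
  \<open>z\<^sub>0\<close> is \<open>z $ 1\<close> and \<open>z\<^sub>1\<close> is \<open>z $ 2\<close>.
\<close>

definition monom_fun :: "nat \<Rightarrow> nat \<Rightarrow> complex^2 \<Rightarrow> complex" where
  "monom_fun l k = (\<lambda>z. (z $ 1) ^ (2 * l - k) * (z $ 2) ^ k)"

definition Sym :: "nat \<Rightarrow> (complex^2 \<Rightarrow> complex) set" where
  "Sym l = {p. \<exists>a. p = (\<lambda>z. \<Sum>k\<le>2 * l. a k * monom_fun l k z)}"

definition sym_coeff :: "nat \<Rightarrow> (complex^2 \<Rightarrow> complex) \<Rightarrow> nat \<Rightarrow> complex" where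
  "sym_coeff l p =
     (THE a. (\<forall>k. k > 2 * l \<longrightarrow> a k = 0) \<and> p = (\<lambda>z. \<Sum>k\<le>2 * l. a k * monom_fun l k z))"

definition sym_inner :: "nat \<Rightarrow> (complex^2 \<Rightarrow> complex) \<Rightarrow> (complex^2 \<Rightarrow> complex) \<Rightarrow> complex" where
  "sym_inner l p q = (\<Sum>k\<le>2 * l. sym_coeff l p k * cnj (sym_coeff l q k) / of_nat ((2 * l) choose k))"

definition sym_norm :: "nat \<Rightarrow> (complex^2 \<Rightarrow> complex) \<Rightarrow> real" where
  "sym_norm l p = sqrt (Re (sym_inner l p p))"

definition sym_normalize :: "nat \<Rightarrow> (complex^2 \<Rightarrow> complex) \<Rightarrow> (complex^2 \<Rightarrow> complex)" where
  "sym_normalize l p = (\<lambda>z. p z / of_real (sym_norm l p))"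

definition conj_transpose :: "complex^2^2 \<Rightarrow> complex^2^2" where
  "conj_transpose A = (\<chi> i j. cnj (A $ j $ i))"

definition SU2 :: "(complex^2^2) set" where
  "SU2 = {A. A ** conj_transpose A = mat 1 \<and> det A = 1}"

text \<open>
  \<open>x \<mapsto> x\<^sub>1 \<sigma>\<^sub>1 + x\<^sub>2 \<sigma>\<^sub>2 + x\<^sub>3 \<sigma>\<^sub>3\<close> identifies \<open>\<real>\<^sup>3\<close> with the traceless Hermitian matrices; conjugation
  by \<open>SU(2)\<close> then gives the double cover \<open>SU(2) \<rightarrow> SO(3)\<close>.
\<close>

definition pauli :: "real^3 \<Rightarrow> complex^2^2" where
  "pauli x = vector [vector [Complex (x $ 3) 0, Complex (x $ 1) (- (x $ 2))],
                     vector [Complex (x $ 1) (x $ 2), Complex (- (x $ 3)) 0]]"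

definition covers :: "complex^2^2 \<Rightarrow> real^3^3 \<Rightarrow> bool" where
  "covers A R \<longleftrightarrow> A \<in> SU2 \<and> (\<forall>x. A ** pauli x ** conj_transpose A = pauli (R *v x))"

text \<open>
  The action \<open>(A \<cdot> p)(z) = p (A\<^sup>-\<^sup>1 z)\<close> of \<open>SU(2)\<close>, descended to \<open>SO(3)\<close>.  The two elements
  covering \<open>R\<close> differ by a sign, which does not matter as the polynomials have even degree.
\<close>

definition rot_act :: "real^3^3 \<Rightarrow> (complex^2 \<Rightarrow> complex) \<Rightarrow> (complex^2 \<Rightarrow> complex)" where
  "rot_act R p = (\<lambda>z. p (conj_transpose (SOME A. covers A R) *v z))"

section \<open>The dual representations\<close>

definition sym_dual :: "nat \<Rightarrow> ((complex^2 \<Rightarrow> complex) \<Rightarrow> complex) set" where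
  "sym_dual l = {\<phi>. \<forall>p\<in>Sym l. \<forall>q\<in>Sym l. \<forall>a b. \<phi> (\<lambda>z. a * p z + b * q z) = a * \<phi> p + b * \<phi> q}"

text \<open>
  The dual Hilbert space structure: \<open>\<Sum>\<^sub>e \<phi> e * cnj (\<psi> e)\<close> over the orthonormal basis of
  \<open>Sym l\<close> consisting of the normalized monomials.
\<close>

definition dual_inner ::
    "nat \<Rightarrow> ((complex^2 \<Rightarrow> complex) \<Rightarrow> complex) \<Rightarrow> ((complex^2 \<Rightarrow> complex) \<Rightarrow> complex) \<Rightarrow> complex" where
  "dual_inner l \<phi> \<psi> = (\<Sum>k\<le>2 * l. \<phi> (sym_normalize l (monom_fun l k))
                              * cnj (\<psi> (sym_normalize l (monom_fun l k))))"

text \<open>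
  Functionals are only compared on \<open>Sym l\<close>.
\<close>

definition dual_identification ::
    "nat \<Rightarrow> ((complex^2 \<Rightarrow> complex) \<Rightarrow> ((complex^2 \<Rightarrow> complex) \<Rightarrow> complex)) \<Rightarrow> bool" where
  "dual_identification l D \<longleftrightarrow>
     (\<forall>p\<in>Sym l. D p \<in> sym_dual l) \<and>
     (\<forall>p\<in>Sym l. \<forall>q\<in>Sym l. \<forall>a b. \<forall>v\<in>Sym l. D (\<lambda>z. a * p z + b * q z) v = a * D p v + b * D q v) \<and>
     (\<forall>p\<in>Sym l. \<forall>q\<in>Sym l. dual_inner l (D p) (D q) = sym_inner l p q) \<and>
     (\<forall>\<phi>\<in>sym_dual l. \<exists>p\<in>Sym l. \<forall>v\<in>Sym l. D p v = \<phi> v) \<and>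
     (\<forall>R\<in>SO3. \<forall>p\<in>Sym l. \<forall>v\<in>Sym l. D (rot_act R p) v = D p (rot_act (matrix_inv R) v))"

section \<open>Peter--Weyl decomposition and Hardy spaces\<close>

text \<open>
  The image of \<open>v \<otimes> \<phi> \<in> V\<^sub>l \<otimes> V\<^sub>l\<^sup>*\<close> in \<open>L\<^sup>2(SO(3))\<close> under the Peter--Weyl isomorphism: a
  matrix coefficient, with the factor that makes the embedding isometric.  The left regular
  action corresponds to the action on \<open>v\<close>.
\<close>

definition peter_weyl ::
    "nat \<Rightarrow> (complex^2 \<Rightarrow> complex) \<Rightarrow> ((complex^2 \<Rightarrow> complex) \<Rightarrow> complex) \<Rightarrow> (real^3^3 \<Rightarrow> complex)" where
  "peter_weyl l v \<phi> = (\<lambda>g. of_real (sqrt (real (2 * l + 1))) * \<phi> (rot_act (matrix_inv g) v))"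

text \<open>
  \<open>V\<^sub>l \<otimes> \<complex> p\<close>, where \<open>p \<in> Sym l\<close> is regarded as an element of the dual via \<open>D\<close>; on a line
  every tensor is simple.
\<close>

definition pw_block ::
    "(nat \<Rightarrow> (complex^2 \<Rightarrow> complex) \<Rightarrow> ((complex^2 \<Rightarrow> complex) \<Rightarrow> complex))
      \<Rightarrow> nat \<Rightarrow> (complex^2 \<Rightarrow> complex) \<Rightarrow> (real^3^3 \<Rightarrow> complex) set" where
  "pw_block D l p = {peter_weyl l v (D l (\<lambda>z. c * p z)) | v c. v \<in> Sym l}"

definition u_vec :: "nat \<Rightarrow> complex^2 \<Rightarrow> complex" where
  "u_vec l = (\<lambda>z. (z $ 1) ^ (2 * l))"

definition w_vec :: "real \<Rightarrow> nat \<Rightarrow> complex^2 \<Rightarrow> complex" where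
  "w_vec \<tau> l = (\<lambda>z. ((z $ 1)\<^sup>2 + (z $ 2)\<^sup>2
                       + 2 * of_real (cosh \<tau> / sinh \<tau>) * (z $ 1) * (z $ 2)) ^ l)"

definition hardy_Y ::
    "(real^3^3) measure \<Rightarrow> (nat \<Rightarrow> (complex^2 \<Rightarrow> complex) \<Rightarrow> ((complex^2 \<Rightarrow> complex) \<Rightarrow> complex))
      \<Rightarrow> (real^3^3 \<Rightarrow> complex) set" where
  "hardy_Y \<mu> D = hilbert_sum \<mu> (\<lambda>l. pw_block D l (u_vec l))"

definition hardy_tube ::
    "(real^3^3) measure \<Rightarrow> (nat \<Rightarrow> (complex^2 \<Rightarrow> complex) \<Rightarrow> ((complex^2 \<Rightarrow> complex) \<Rightarrow> complex))
      \<Rightarrow> real \<Rightarrow> (real^3^3 \<Rightarrow> complex) set" where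
  "hardy_tube \<mu> D \<tau> = hilbert_sum \<mu> (\<lambda>l. pw_block D l (w_vec \<tau> l))"

definition toeplitz ::
    "(real^3^3) measure \<Rightarrow> (nat \<Rightarrow> (complex^2 \<Rightarrow> complex) \<Rightarrow> ((complex^2 \<Rightarrow> complex) \<Rightarrow> complex))
      \<Rightarrow> real \<Rightarrow> (real^3^3 \<Rightarrow> complex) \<Rightarrow> (real^3^3 \<Rightarrow> complex)" where
  "toeplitz \<mu> D \<tau> f =
     orth_proj \<mu> (hardy_Y \<mu> D) (orth_proj \<mu> (hardy_tube \<mu> D \<tau>) (orth_proj \<mu> (hardy_Y \<mu> D) f))"

definition s_val :: "nat \<Rightarrow> real \<Rightarrow> real" where
  "s_val l \<tau> =
     (cmod (sym_inner l (sym_normalize l (w_vec \<tau> l)) (sym_normalize l (u_vec l))))\<^sup>2"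

end

theory Submission
  imports Defs
begin

text \<open>
  By Schur orthogonality the matrix coefficients of an orthonormal basis of \<open>V\<^sub>\<ell>\<close> against the
  functionals of the unit vectors \<open>u\<^sub>\<ell>\<close>, respectively \<open>w\<^sub>\<ell>\<close>, are orthonormal bases \<open>e\<^sub>\<ell>\<^sub>k\<close> and
  \<open>f\<^sub>\<ell>\<^sub>k\<close> of the two Hardy spaces, and the only non-zero inner products between them are
  \<open>\<langle>f\<^sub>\<ell>\<^sub>k, e\<^sub>\<ell>\<^sub>k\<rangle> = \<langle>w\<^sub>\<ell>, u\<^sub>\<ell>\<rangle>\<close>.  Hence the composition of projections is diagonal, with eigenvalues
  \<open>s\<^sub>\<ell> = |\<langle>w\<^sub>\<ell>, u\<^sub>\<ell>\<rangle>|\<^sup>2\<close>.  As the coefficient of \<open>z\<^sub>0\<^bsup>2\<ell>\<^esup>\<close> in the unnormalized \<open>w\<^sub>\<ell>\<close> is \<open>1\<close>, the number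
  \<open>1 / s\<^sub>\<ell>\<close> is the squared norm of this vector.  It is at least \<open>4\<^sup>\<ell>\<close>, which gives the trace class
  property, and it is strictly increasing in \<open>\<ell>\<close>, so that the eigenspaces are exactly the blocks.
\<close>

section \<open>Square-integrable functions\<close>

text \<open>The operator is built from \<open>orth_proj\<close>, a choice that says nothing until a
  projection is known to exist. Apart from the trivial projection of a space onto itself, only
  vectors of one Hardy space are projected onto the other. There the overlaps \<open>c l\<close>
  decay like \<open>2^-l\<close> while the sup norms of the basis functions grow like
  \<open>sqrt (2 l + 1)\<close>, so the projected series converges uniformly. Schur orthogonality is
  obtained without irreducibility. Left invariance makes the pairing of matrix coefficients an
  invariant sesquilinear form in \<open>(v, v')\<close>. The diagonal torus kills all pairs of
  monomials of different weight. The real rotations, read as a polynomial identity in the tangent of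
  the half angle, express the surviving pairs through the one with \<open>k = k' = 0\<close>. The
  other obstacle is that \<open>rot_act\<close> selects a lift to \<open>SU(2)\<close> by choice, so
  its dependence on the rotation is not visible. Regularity is proved on \<open>SU(2)\<close>, where
  the action is polynomial, and then descended.\<close>

lemma L2_measurable: "f \<in> L2 M \<Longrightarrow> f \<in> borel_measurable M"
  and L2_integrable: "f \<in> L2 M \<Longrightarrow> integrable M (\<lambda>x. (cmod (f x))\<^sup>2)"
  by (auto simp: L2_def)

lemma L2_mult_integrable:
  assumes "f \<in> L2 M" "g \<in> L2 M"
  shows "integrable M (\<lambda>x. f x * cnj (g x))"
proof (rule Bochner_Integration.integrable_bound)
  show "integrable M (\<lambda>x. (cmod (f x))\<^sup>2 + (cmod (g x))\<^sup>2)"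
    using assms by (auto simp: L2_def)
  show "(\<lambda>x. f x * cnj (g x)) \<in> borel_measurable M"
    using assms by (auto simp: L2_def intro!: borel_measurable_times
        borel_measurable_continuous_on[OF continuous_on_cnj[OF continuous_on_id], of g M, simplified])
  show "AE x in M. norm (f x * cnj (g x)) \<le> norm ((cmod (f x))\<^sup>2 + (cmod (g x))\<^sup>2)"
  proof (rule AE_I2)
    fix x
    have "2 * (cmod (f x) * cmod (g x)) \<le> (cmod (f x))\<^sup>2 + (cmod (g x))\<^sup>2"
      using sum_squares_bound[of "cmod (f x)" "cmod (g x)"] by simp
    moreover have "0 \<le> cmod (f x) * cmod (g x)" by simp
    ultimately have "cmod (f x) * cmod (g x) \<le> (cmod (f x))\<^sup>2 + (cmod (g x))\<^sup>2" by linarith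
    then show "norm (f x * cnj (g x)) \<le> norm ((cmod (f x))\<^sup>2 + (cmod (g x))\<^sup>2)"
      by (simp add: norm_mult)
  qed
qed

lemma L2_lincomb:
  assumes "f \<in> L2 M" "g \<in> L2 M"
  shows "(\<lambda>x. a * f x + b * g x) \<in> L2 M"
proof -
  have m: "f \<in> borel_measurable M" "g \<in> borel_measurable M"
    using assms by (auto simp: L2_def)
  have "integrable M (\<lambda>x. (cmod (a * f x + b * g x))\<^sup>2)"
  proof (rule Bochner_Integration.integrable_bound)
    show "integrable M (\<lambda>x. 2 * (cmod a)\<^sup>2 * (cmod (f x))\<^sup>2 + 2 * (cmod b)\<^sup>2 * (cmod (g x))\<^sup>2)"
      using assms by (auto simp: L2_def)
    show "(\<lambda>x. (cmod (a * f x + b * g x))\<^sup>2) \<in> borel_measurable M" using m by measurable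
    show "AE x in M. norm ((cmod (a * f x + b * g x))\<^sup>2)
            \<le> norm (2 * (cmod a)\<^sup>2 * (cmod (f x))\<^sup>2 + 2 * (cmod b)\<^sup>2 * (cmod (g x))\<^sup>2)"
    proof (rule AE_I2)
      fix x
      have "(cmod (a * f x + b * g x))\<^sup>2 \<le> (cmod (a * f x) + cmod (b * g x))\<^sup>2"
        by (intro power_mono norm_triangle_ineq norm_ge_zero)
      also have "\<dots> \<le> 2 * (cmod (a * f x))\<^sup>2 + 2 * (cmod (b * g x))\<^sup>2"
        using sum_squares_bound[of "cmod (a * f x)" "cmod (b * g x)"] by (simp add: power2_sum)
      finally show "norm ((cmod (a * f x + b * g x))\<^sup>2)
            \<le> norm (2 * (cmod a)\<^sup>2 * (cmod (f x))\<^sup>2 + 2 * (cmod b)\<^sup>2 * (cmod (g x))\<^sup>2)"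
        by (simp add: norm_mult power_mult_distrib)
    qed
  qed
  then show ?thesis using m by (simp add: L2_def)
qed

lemma L2_zero [simp]: "(\<lambda>x. 0) \<in> L2 M"
  by (simp add: L2_def)

lemma L2_scale: "f \<in> L2 M \<Longrightarrow> (\<lambda>x. a * f x) \<in> L2 M"
  using L2_lincomb[of f M f a 0] by simp

lemma L2_diff: "f \<in> L2 M \<Longrightarrow> g \<in> L2 M \<Longrightarrow> (\<lambda>x. f x - g x) \<in> L2 M"
  using L2_lincomb[of f M g 1 "-1"] by simp

lemma L2_add: "f \<in> L2 M \<Longrightarrow> g \<in> L2 M \<Longrightarrow> (\<lambda>x. f x + g x) \<in> L2 M"
  using L2_lincomb[of f M g 1 1] by simp

lemma L2_sum: "(\<And>i. i \<in> I \<Longrightarrow> f i \<in> L2 M) \<Longrightarrow> (\<lambda>x. \<Sum>i\<in>I. f i x) \<in> L2 M"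
  by (induction I rule: infinite_finite_induct) (auto intro: L2_add)

lemma l2_inner_lincomb_left:
  assumes "f \<in> L2 M" "g \<in> L2 M" "h \<in> L2 M"
  shows "l2_inner M (\<lambda>x. a * f x + b * g x) h = a * l2_inner M f h + b * l2_inner M g h"
  using L2_mult_integrable[OF assms(1,3)] L2_mult_integrable[OF assms(2,3)]
  unfolding l2_inner_def by (simp add: ring_distribs mult.assoc)

lemma l2_inner_commute: "l2_inner M f g = cnj (l2_inner M g f)"
  unfolding l2_inner_def
  by (subst Bochner_Integration.integral_cnj[symmetric]) (simp add: mult.commute)

lemma l2_inner_lincomb_right:
  assumes "f \<in> L2 M" "g \<in> L2 M" "h \<in> L2 M"
  shows "l2_inner M h (\<lambda>x. a * f x + b * g x) = cnj a * l2_inner M h f + cnj b * l2_inner M h g"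
  by (subst (1 2 3) l2_inner_commute) (simp add: l2_inner_lincomb_left[OF assms])

lemma l2_inner_diff_left:
  "f \<in> L2 M \<Longrightarrow> g \<in> L2 M \<Longrightarrow> h \<in> L2 M
    \<Longrightarrow> l2_inner M (\<lambda>x. f x - g x) h = l2_inner M f h - l2_inner M g h"
  using l2_inner_lincomb_left[of f M g h 1 "-1"] by simp

lemma l2_inner_diff_right:
  "f \<in> L2 M \<Longrightarrow> g \<in> L2 M \<Longrightarrow> h \<in> L2 M
    \<Longrightarrow> l2_inner M h (\<lambda>x. f x - g x) = l2_inner M h f - l2_inner M h g"
  using l2_inner_lincomb_right[of f M g h 1 "-1"] by simp

lemma l2_inner_scale_left:
  "f \<in> L2 M \<Longrightarrow> h \<in> L2 M \<Longrightarrow> l2_inner M (\<lambda>x. a * f x) h = a * l2_inner M f h"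
  using l2_inner_lincomb_left[of f M f h a 0] by simp

lemma l2_inner_scale_right:
  "f \<in> L2 M \<Longrightarrow> h \<in> L2 M \<Longrightarrow> l2_inner M h (\<lambda>x. a * f x) = cnj a * l2_inner M h f"
  using l2_inner_lincomb_right[of f M f h a 0] by simp

lemma l2_inner_zero_left [simp]: "l2_inner M (\<lambda>x. 0) h = 0"
  by (simp add: l2_inner_def)

lemma l2_inner_zero_right [simp]: "l2_inner M h (\<lambda>x. 0) = 0"
  by (simp add: l2_inner_def)

lemma l2_inner_sum_left:
  assumes "\<And>i. i \<in> I \<Longrightarrow> f i \<in> L2 M" "h \<in> L2 M"
  shows "l2_inner M (\<lambda>x. \<Sum>i\<in>I. a i * f i x) h = (\<Sum>i\<in>I. a i * l2_inner M (f i) h)"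
  using assms(1)
proof (induction I rule: infinite_finite_induct)
  case (insert i I)
  have "(\<lambda>x. \<Sum>i\<in>I. a i * f i x) \<in> L2 M"
    using insert by (intro L2_sum L2_scale) auto
  then show ?case
    using insert l2_inner_lincomb_left[of "f i" M "\<lambda>x. \<Sum>i\<in>I. a i * f i x" h "a i" 1] assms(2)
    by simp
qed auto

lemma l2_inner_sum_right:
  assumes "\<And>i. i \<in> I \<Longrightarrow> f i \<in> L2 M" "h \<in> L2 M"
  shows "l2_inner M h (\<lambda>x. \<Sum>i\<in>I. a i * f i x) = (\<Sum>i\<in>I. cnj (a i) * l2_inner M h (f i))"
  by (subst l2_inner_commute, subst l2_inner_sum_left[OF assms])
    (auto intro!: sum.cong simp: l2_inner_commute[of M h])

lemma l2_inner_self: "l2_inner M f f = of_real ((l2_norm M f)\<^sup>2)"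
proof -
  have "l2_inner M f f = (LINT x|M. of_real ((cmod (f x))\<^sup>2))"
    unfolding l2_inner_def by (simp add: complex_norm_square[symmetric])
  also have "\<dots> = of_real (LINT x|M. (cmod (f x))\<^sup>2)"
    by (rule integral_complex_of_real)
  also have "(LINT x|M. (cmod (f x))\<^sup>2) = (l2_norm M f)\<^sup>2"
    unfolding l2_norm_def by (simp add: Bochner_Integration.integral_nonneg)
  finally show ?thesis .
qed

lemma l2_norm_nonneg [simp]: "0 \<le> l2_norm M f"
  by (simp add: l2_norm_def Bochner_Integration.integral_nonneg)

lemma l2_norm_power2_eq: "(l2_norm M f)\<^sup>2 = Re (l2_inner M f f)"
  by (simp only: l2_inner_self Re_complex_of_real)

lemma l2_eq_iff_norm:
  assumes "f \<in> L2 M" "g \<in> L2 M"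
  shows "l2_eq M f g \<longleftrightarrow> l2_norm M (\<lambda>x. f x - g x) = 0"
proof -
  have "l2_norm M (\<lambda>x. f x - g x) = 0 \<longleftrightarrow> (LINT x|M. (cmod (f x - g x))\<^sup>2) = 0"
    by (simp add: l2_norm_def Bochner_Integration.integral_nonneg)
  also have "\<dots> \<longleftrightarrow> (AE x in M. (cmod (f x - g x))\<^sup>2 = 0)"
    by (intro integral_nonneg_eq_0_iff_AE L2_integrable L2_diff assms) auto
  finally show ?thesis by (simp add: l2_eq_def)
qed

lemma l2_eq_iff_inner:
  assumes "f \<in> L2 M" "g \<in> L2 M"
  shows "l2_eq M f g \<longleftrightarrow> l2_inner M (\<lambda>x. f x - g x) (\<lambda>x. f x - g x) = 0"
  using l2_eq_iff_norm[OF assms] by (simp add: l2_inner_self)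

lemma borel_measurable_cnj:
  "f \<in> borel_measurable M \<Longrightarrow> (\<lambda>x. cnj (f x)) \<in> borel_measurable M"
  by (rule borel_measurable_continuous_on[OF continuous_on_cnj[OF continuous_on_id], simplified])

lemma l2_inner_cong:
  assumes "f \<in> L2 M" "f' \<in> L2 M" "g \<in> L2 M" "g' \<in> L2 M" "l2_eq M f f'" "l2_eq M g g'"
  shows "l2_inner M f g = l2_inner M f' g'"
  using assms unfolding l2_inner_def l2_eq_def
  by (intro integral_cong_AE borel_measurable_times borel_measurable_cnj L2_measurable) auto

lemma l2_norm_cong_space:
  "(\<And>x. x \<in> space M \<Longrightarrow> f x = g x) \<Longrightarrow> l2_norm M f = l2_norm M g"
  unfolding l2_norm_def by (simp cong: Bochner_Integration.integral_cong)

lemma l2_inner_cong_space: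
  "(\<And>x. x \<in> space M \<Longrightarrow> f x = f' x) \<Longrightarrow> (\<And>x. x \<in> space M \<Longrightarrow> g x = g' x)
    \<Longrightarrow> l2_inner M f g = l2_inner M f' g'"
  unfolding l2_inner_def by (simp cong: Bochner_Integration.integral_cong)

text \<open>This expansion carries Cauchy-Schwarz, with the optimal \<open>a\<close>, and with
  \<open>a = 1\<close> the triangle inequality, Bessel's inequality and the contraction property of
  projections.\<close>

lemma l2_norm_power2_sub:
  assumes "f \<in> L2 M" "g \<in> L2 M"
  shows "(l2_norm M (\<lambda>x. f x - a * g x))\<^sup>2
       = (l2_norm M f)\<^sup>2 - 2 * Re (cnj a * l2_inner M f g) + (cmod a)\<^sup>2 * (l2_norm M g)\<^sup>2"
proof -
  let ?h = "\<lambda>x. f x - a * g x"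
  have h: "?h \<in> L2 M" "(\<lambda>x. a * g x) \<in> L2 M" by (intro L2_diff L2_scale assms)+
  have "l2_inner M ?h ?h = l2_inner M f f - cnj a * l2_inner M f g
      - (a * cnj (l2_inner M f g) - of_real ((cmod a)\<^sup>2) * l2_inner M g g)"
    using h assms
    by (simp add: l2_inner_diff_left l2_inner_diff_right l2_inner_scale_left l2_inner_scale_right
        l2_inner_commute[of M g f] complex_norm_square algebra_simps del: of_real_power)
  then have "Re (l2_inner M ?h ?h) = Re (l2_inner M f f - cnj a * l2_inner M f g
      - (a * cnj (l2_inner M f g) - (cmod a)\<^sup>2 * l2_inner M g g))" by simp
  then show ?thesis
    by (simp add: l2_inner_self)
qed

lemma l2_cauchy_schwarz:
  assumes "f \<in> L2 M" "g \<in> L2 M"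
  shows "cmod (l2_inner M f g) \<le> l2_norm M f * l2_norm M g"
proof (cases "l2_norm M g = 0")
  case True
  then have "l2_eq M g (\<lambda>x. 0)"
    using l2_eq_iff_norm[OF assms(2) L2_zero] by simp
  then have "l2_inner M f g = l2_inner M f (\<lambda>x. 0)"
    by (intro l2_inner_cong assms L2_zero) (auto simp: l2_eq_def)
  then show ?thesis by simp
next
  case False
  define n where "n = (l2_norm M g)\<^sup>2"
  have n: "n > 0" using False by (simp add: n_def)
  \<comment> \<open>The minimizer of the distance from \<open>f\<close> to the line spanned by
    \<open>g\<close>.\<close>
  define a where "a = l2_inner M f g / of_real n"
  have "0 \<le> (l2_norm M (\<lambda>x. f x - a * g x))\<^sup>2" by simp
  also have "\<dots> = (l2_norm M f)\<^sup>2 - 2 * Re (cnj a * l2_inner M f g) + (cmod a)\<^sup>2 * n"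
    unfolding n_def by (rule l2_norm_power2_sub[OF assms])
  also have "cnj a * l2_inner M f g = of_real ((cmod (l2_inner M f g))\<^sup>2 / n)"
    by (simp add: a_def complex_norm_square mult.commute del: of_real_power)
  also have "(cmod a)\<^sup>2 * n = (cmod (l2_inner M f g))\<^sup>2 / n"
    using n by (simp add: a_def norm_divide power_divide power2_eq_square)
  finally have "(cmod (l2_inner M f g))\<^sup>2 \<le> (l2_norm M f)\<^sup>2 * n"
    using n by (simp add: field_simps)
  then have "(cmod (l2_inner M f g))\<^sup>2 \<le> (l2_norm M f * l2_norm M g)\<^sup>2"
    by (simp add: n_def power_mult_distrib)
  then show ?thesis by (rule power2_le_imp_le) simp
qed

lemma l2_norm_scale: "l2_norm M (\<lambda>x. a * f x) = cmod a * l2_norm M f"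
  unfolding l2_norm_def by (simp add: norm_mult power_mult_distrib real_sqrt_mult)

lemma l2_norm_triangle_diff:
  assumes "f \<in> L2 M" "g \<in> L2 M"
  shows "l2_norm M (\<lambda>x. f x - g x) \<le> l2_norm M f + l2_norm M g"
proof (rule power2_le_imp_le)
  have "(l2_norm M (\<lambda>x. f x - g x))\<^sup>2
      = (l2_norm M f)\<^sup>2 - 2 * Re (l2_inner M f g) + (l2_norm M g)\<^sup>2"
    using l2_norm_power2_sub[OF assms, of 1] by simp
  moreover have "- Re (l2_inner M f g) \<le> l2_norm M f * l2_norm M g"
    using l2_cauchy_schwarz[OF assms] abs_Re_le_cmod[of "l2_inner M f g"] by linarith
  ultimately show "(l2_norm M (\<lambda>x. f x - g x))\<^sup>2 \<le> (l2_norm M f + l2_norm M g)\<^sup>2"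
    by (simp add: power2_sum)
qed simp

lemma l2_norm_triangle:
  assumes "f \<in> L2 M" "g \<in> L2 M"
  shows "l2_norm M (\<lambda>x. f x + g x) \<le> l2_norm M f + l2_norm M g"
  using l2_norm_triangle_diff[OF assms(1) L2_scale[OF assms(2)], of "-1"]
  by (simp add: l2_norm_scale[of M "-1" g, simplified])

lemma l2_inner_tendsto_left:
  assumes "\<And>n. f n \<in> L2 M" "g \<in> L2 M" "h \<in> L2 M"
    and "(\<lambda>n. l2_norm M (\<lambda>x. g x - f n x)) \<longlonglongrightarrow> 0"
  shows "(\<lambda>n. l2_inner M (f n) h) \<longlonglongrightarrow> l2_inner M g h"
proof (rule Lim_transform)
  show "(\<lambda>n. l2_inner M g h) \<longlonglongrightarrow> l2_inner M g h" by simp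
  have "(\<lambda>n. l2_norm M (\<lambda>x. g x - f n x) * l2_norm M h) \<longlonglongrightarrow> 0 * l2_norm M h"
    by (intro tendsto_mult assms tendsto_const)
  then have lim: "(\<lambda>n. l2_norm M (\<lambda>x. g x - f n x) * l2_norm M h) \<longlonglongrightarrow> 0" by simp
  have "norm (l2_inner M g h - l2_inner M (f n) h)
      \<le> l2_norm M (\<lambda>x. g x - f n x) * l2_norm M h" for n
  proof -
    have "norm (l2_inner M g h - l2_inner M (f n) h) = norm (l2_inner M (\<lambda>x. g x - f n x) h)"
      using assms by (simp add: l2_inner_diff_left)
    also have "\<dots> \<le> l2_norm M (\<lambda>x. g x - f n x) * l2_norm M h"
      by (intro l2_cauchy_schwarz L2_diff assms)
    finally show ?thesis .
  qed
  then have "\<forall>\<^sub>F n in sequentially. norm (l2_inner M (f n) h - l2_inner M g h)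
      \<le> l2_norm M (\<lambda>x. g x - f n x) * l2_norm M h"
    by (simp add: always_eventually norm_minus_commute)
  then show "(\<lambda>n. l2_inner M (f n) h - l2_inner M g h) \<longlonglongrightarrow> 0"
    by (rule Lim_null_comparison[OF _ lim])
qed

text \<open>The squared distance from \<open>f\<close> to its projection \<open>p\<close> on the
  span is non-negative. In the trace estimate \<open>F\<close> is a finite part of an arbitrary
  orthonormal basis and \<open>f\<close> is one fixed \<open>e l k\<close>.\<close>

lemma l2_bessel:
  assumes "finite F" "F \<subseteq> L2 M" "f \<in> L2 M"
    and "\<And>e e'. e \<in> F \<Longrightarrow> e' \<in> F \<Longrightarrow> l2_inner M e e' = (if e = e' then 1 else 0)"
  shows "(\<Sum>e\<in>F. (cmod (l2_inner M e f))\<^sup>2) \<le> (l2_norm M f)\<^sup>2"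
proof -
  define p where "p = (\<lambda>x. \<Sum>e\<in>F. l2_inner M f e * e x)"
  define S where "S = (\<Sum>e\<in>F. (cmod (l2_inner M e f))\<^sup>2)"
  have p: "p \<in> L2 M" unfolding p_def using assms by (intro L2_sum L2_scale) auto
  have fp: "l2_inner M f p = of_real S"
    unfolding p_def S_def using assms(2,3)
    by (subst l2_inner_sum_right)
      (auto simp: l2_inner_commute[of M f] complex_norm_square subset_iff mult.commute
        simp del: of_real_power)
  have "l2_inner M p p = (\<Sum>e\<in>F. l2_inner M f e * l2_inner M e p)"
    unfolding p_def using assms(2) p[unfolded p_def] by (subst l2_inner_sum_left) auto
  also have "\<dots> = (\<Sum>e\<in>F. l2_inner M f e * cnj (l2_inner M f e))"
  proof (rule sum.cong)
    fix e assume e: "e \<in> F"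
    have "l2_inner M e p = (\<Sum>e'\<in>F. cnj (l2_inner M f e') * l2_inner M e e')"
      unfolding p_def using assms(2) e by (subst l2_inner_sum_right) auto
    also have "\<dots> = (\<Sum>e'\<in>F. if e = e' then cnj (l2_inner M f e') else 0)"
      using e assms(4) by (intro sum.cong) auto
    also have "\<dots> = cnj (l2_inner M f e)" using e assms(1) by simp
    finally show "l2_inner M f e * l2_inner M e p = l2_inner M f e * cnj (l2_inner M f e)" by simp
  qed simp
  also have "\<dots> = of_real S"
    unfolding S_def
    by (auto simp: l2_inner_commute[of M f] complex_norm_square mult.commute simp del: of_real_power)
  finally have pp: "(l2_norm M p)\<^sup>2 = S" by (simp add: l2_norm_power2_eq)
  have "0 \<le> (l2_norm M (\<lambda>x. f x - p x))\<^sup>2" by simp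
  also have "\<dots> = (l2_norm M f)\<^sup>2 - S"
    using l2_norm_power2_sub[OF assms(3) p, of 1] pp fp by simp
  finally show ?thesis by (simp add: S_def)
qed

section \<open>Orthogonal projections as a relation\<close>

definition is_l2_proj ::
    "'a measure \<Rightarrow> ('a \<Rightarrow> complex) set \<Rightarrow> ('a \<Rightarrow> complex) \<Rightarrow> ('a \<Rightarrow> complex) \<Rightarrow> bool" where
  "is_l2_proj M S f h \<longleftrightarrow> h \<in> S \<and> (\<forall>k\<in>S. l2_inner M (\<lambda>x. f x - h x) k = 0)"

text \<open>\<open>orth_proj\<close> takes an arbitrary witness, so it is a projection only once
  some witness \<open>h\<close> has been exhibited. All later arguments go through the
  relation.\<close>

lemma is_l2_proj_orth_proj: "is_l2_proj M S f h \<Longrightarrow> is_l2_proj M S f (orth_proj M S f)"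
  unfolding is_l2_proj_def orth_proj_def
  by (rule someI[where P="\<lambda>h. h \<in> S \<and> (\<forall>k\<in>S. l2_inner M (\<lambda>x. f x - h x) k = 0)"])

definition l2_subspace :: "'a measure \<Rightarrow> ('a \<Rightarrow> complex) set \<Rightarrow> bool" where
  "l2_subspace M S \<longleftrightarrow> S \<subseteq> L2 M \<and> (\<forall>f\<in>S. \<forall>g\<in>S. \<forall>a b. (\<lambda>x. a * f x + b * g x) \<in> S)"

text \<open>The difference of the two projections lies in \<open>S\<close> and is orthogonal to
  \<open>S\<close>, hence to itself. Letting \<open>f\<close> and \<open>f'\<close> differ on a null
  set carries the ambiguity of each projection through a composition of several.\<close>

lemma is_l2_proj_unique:
  assumes "l2_subspace M S" "f \<in> L2 M" "f' \<in> L2 M" "l2_eq M f f'"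
    "is_l2_proj M S f h" "is_l2_proj M S f' h'"
  shows "l2_eq M h h'"
proof -
  have m: "h \<in> S" "h' \<in> S" "h \<in> L2 M" "h' \<in> L2 M"
    using assms by (auto simp: is_l2_proj_def l2_subspace_def)
  define d where "d = (\<lambda>x. h x - h' x)"
  have "(\<lambda>x. 1 * h x + (-1) * h' x) \<in> S"
    using assms(1) m unfolding l2_subspace_def by blast
  then have d: "d \<in> S" by (simp add: d_def)
  then have dL: "d \<in> L2 M" using assms(1) by (auto simp: l2_subspace_def)
  have "l2_inner M f d = l2_inner M h d" "l2_inner M f' d = l2_inner M h' d"
    using assms d dL m unfolding is_l2_proj_def by (auto simp: l2_inner_diff_left)
  moreover have "l2_inner M f d = l2_inner M f' d"
    using assms dL by (intro l2_inner_cong) (auto simp: l2_eq_def)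
  ultimately have "l2_inner M d d = 0"
    using m dL l2_inner_diff_left[of h M h' d] by (simp add: d_def)
  then show ?thesis using m by (simp add: l2_eq_iff_inner d_def)
qed

lemma is_l2_proj_inner:
  assumes "l2_subspace M S" "f \<in> L2 M" "is_l2_proj M S f h" "k \<in> S"
  shows "l2_inner M h k = l2_inner M f k"
proof -
  have "h \<in> L2 M" "k \<in> L2 M" using assms by (auto simp: is_l2_proj_def l2_subspace_def)
  then show ?thesis using assms by (auto simp: is_l2_proj_def l2_inner_diff_left)
qed

lemma is_l2_proj_norm_le:
  assumes "l2_subspace M S" "f \<in> L2 M" "is_l2_proj M S f h"
  shows "l2_norm M h \<le> l2_norm M f"
proof (rule power2_le_imp_le)
  have h: "h \<in> S" "h \<in> L2 M" using assms by (auto simp: is_l2_proj_def l2_subspace_def)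
  have "l2_inner M f h = l2_inner M h h" using is_l2_proj_inner[OF assms h(1)] by simp
  then have "0 \<le> (l2_norm M f)\<^sup>2 - (l2_norm M h)\<^sup>2"
    using l2_norm_power2_sub[OF assms(2) h(2), of 1] 
      zero_le_power2[of "l2_norm M (\<lambda>x. f x - 1 * h x)"]
    by (simp add: l2_norm_power2_eq)
  then show "(l2_norm M h)\<^sup>2 \<le> (l2_norm M f)\<^sup>2" by simp
qed simp

section \<open>Projections onto orthogonal sums of finite-dimensional blocks\<close>

context prob_space
begin

lemma bounded_L2:
  assumes "f \<in> borel_measurable M" "\<And>x. x \<in> space M \<Longrightarrow> cmod (f x) \<le> B"
  shows "f \<in> L2 M" "l2_norm M f \<le> B"
proof -
  have B: "B \<ge> 0" using assms(2) not_empty by (meson ex_in_conv norm_ge_zero order_trans)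
  have le: "(cmod (f x))\<^sup>2 \<le> B\<^sup>2" if "x \<in> space M" for x
    using assms(2)[OF that] by (intro power_mono) auto
  have int: "integrable M (\<lambda>x. (cmod (f x))\<^sup>2)"
    using assms(1) le by (intro integrable_const_bound[of _ "B\<^sup>2"]) auto
  then show "f \<in> L2 M" using assms(1) by (simp add: L2_def)
  have "(LINT x|M. (cmod (f x))\<^sup>2) \<le> B\<^sup>2"
    using int le by (intro integral_le_const) auto
  then show "l2_norm M f \<le> B"
    unfolding l2_norm_def using B real_sqrt_le_iff[of _ "B\<^sup>2"] by simp
qed

end

text \<open>Abstracts one Hardy space: \<open>N l\<close> is the dimension of a block and
  \<open>\<beta> l\<close> a sup bound for its basis. Pointwise bounds are recorded because they
  turn decay of coefficients into uniform convergence.\<close>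

locale ortho_blocks = prob_space M for M :: "'a measure" +
  fixes N :: "nat \<Rightarrow> nat" and \<beta> :: "nat \<Rightarrow> real" and e :: "nat \<Rightarrow> nat \<Rightarrow> 'a \<Rightarrow> complex"
  assumes e_measurable: "k < N l \<Longrightarrow> e l k \<in> borel_measurable M"
    and e_bound: "k < N l \<Longrightarrow> x \<in> space M \<Longrightarrow> cmod (e l k x) \<le> \<beta> l"
    and e_inner: "k < N l \<Longrightarrow> k' < N l' \<Longrightarrow>
      l2_inner M (e l k) (e l' k') = (if l = l' \<and> k = k' then 1 else 0)"
begin

definition block :: "nat \<Rightarrow> ('a \<Rightarrow> complex) set" where
  "block l = {\<lambda>x. \<Sum>k<N l. a k * e l k x | a. True}"

definition hsum :: "('a \<Rightarrow> complex) set" where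
  "hsum = hilbert_sum M block"

definition partial :: "(nat \<Rightarrow> nat \<Rightarrow> complex) \<Rightarrow> nat \<Rightarrow> 'a \<Rightarrow> complex" where
  "partial a n = (\<lambda>x. \<Sum>l<n. \<Sum>k<N l. a l k * e l k x)"

lemma e_L2: "k < N l \<Longrightarrow> e l k \<in> L2 M"
  by (rule bounded_L2(1)[OF e_measurable e_bound])

lemma partial_L2: "partial a n \<in> L2 M"
  unfolding partial_def by (intro L2_sum L2_scale e_L2) simp

lemma partial_inner_left:
  assumes "f \<in> L2 M"
  shows "l2_inner M (partial a n) f = (\<Sum>l<n. \<Sum>k<N l. a l k * l2_inner M (e l k) f)"
proof -
  have "partial a n = (\<lambda>x. \<Sum>l<n. 1 * (\<Sum>k<N l. a l k * e l k x))"
    by (simp add: partial_def)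
  then have "l2_inner M (partial a n) f = l2_inner M (\<lambda>x. \<Sum>l<n. 1 * (\<Sum>k<N l. a l k * e l k x)) f"
    by simp
  also have "\<dots> = (\<Sum>l<n. 1 * l2_inner M (\<lambda>x. \<Sum>k<N l. a l k * e l k x) f)"
    by (intro l2_inner_sum_left L2_sum L2_scale e_L2 assms) simp
  also have "\<dots> = (\<Sum>l<n. \<Sum>k<N l. a l k * l2_inner M (e l k) f)"
    unfolding mult_1 by (intro sum.cong refl l2_inner_sum_left e_L2 assms) simp
  finally show ?thesis .
qed

lemma partial_coeff:
  assumes "k < N l"
  shows "l2_inner M (partial a n) (e l k) = (if l < n then a l k else 0)"
proof -
  have "l2_inner M (partial a n) (e l k) = (\<Sum>l'<n. if l' = l then a l k else 0)"
    unfolding partial_inner_left[OF e_L2[OF assms]]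
  proof (intro sum.cong refl)
    fix l'
    have "(\<Sum>k'<N l'. a l' k' * l2_inner M (e l' k') (e l k))
        = (\<Sum>k'<N l'. if k' = k then (if l' = l then a l k else 0) else 0)"
      using assms by (intro sum.cong refl) (auto simp: e_inner)
    then show "(\<Sum>k'<N l'. a l' k' * l2_inner M (e l' k') (e l k)) = (if l' = l then a l k else 0)"
      using assms by auto
  qed
  then show ?thesis by simp
qed

lemma coeff_limit:
  assumes "f \<in> L2 M" "(\<lambda>n. l2_norm M (\<lambda>x. f x - partial a n x)) \<longlonglongrightarrow> 0" "k < N l"
  shows "l2_inner M f (e l k) = a l k"
proof -
  have "(\<lambda>n. l2_inner M (partial a n) (e l k)) \<longlonglongrightarrow> l2_inner M f (e l k)"
    by (intro l2_inner_tendsto_left partial_L2 e_L2 assms)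
  \<comment> \<open>This sequence is constant from \<open>n = Suc l\<close> on, as
    \<open>partial a n\<close> contains the levels strictly below \<open>n\<close>.\<close>
  moreover have "(\<lambda>n. l2_inner M (partial a n) (e l k)) \<longlonglongrightarrow> a l k"
    using assms(3)
    by (intro tendsto_eventually eventually_sequentiallyI[of "Suc l"]) (simp add: partial_coeff)
  ultimately show ?thesis by (rule LIMSEQ_unique)
qed

lemma partial_cong: "(\<And>l k. k < N l \<Longrightarrow> a l k = a' l k) \<Longrightarrow> partial a n = partial a' n"
  unfolding partial_def by simp

lemma hsumI:
  assumes "f \<in> L2 M" "(\<lambda>n. l2_norm M (\<lambda>x. f x - partial a n x)) \<longlonglongrightarrow> 0"
  shows "f \<in> hsum"
  unfolding hsum_def hilbert_sum_def
proof (intro CollectI conjI exI[of _ "\<lambda>l x. \<Sum>k<N l. a l k * e l k x"])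
  show "\<forall>l. (\<lambda>x. \<Sum>k<N l. a l k * e l k x) \<in> block l" by (auto simp: block_def)
qed (use assms in \<open>auto simp: partial_def\<close>)

lemma hsum_L2: "f \<in> hsum \<Longrightarrow> f \<in> L2 M"
  by (simp add: hsum_def hilbert_sum_def)

text \<open>By \<open>coeff_limit\<close> the witness in \<open>hilbert_sum\<close> can only be the
  Fourier expansion, so from here on an element is handled through its coefficients.\<close>

lemma hsum_expansion:
  assumes "f \<in> hsum"
  shows "(\<lambda>n. l2_norm M (\<lambda>x. f x - partial (\<lambda>l k. l2_inner M f (e l k)) n x)) \<longlonglongrightarrow> 0"
proof -
  obtain b where b: "\<And>l. b l \<in> block l"
      "(\<lambda>n. l2_norm M (\<lambda>x. f x - (\<Sum>l<n. b l x))) \<longlonglongrightarrow> 0"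
    using assms by (auto simp: hsum_def hilbert_sum_def)
  have "\<forall>l. \<exists>a. b l = (\<lambda>x. \<Sum>k<N l. a k * e l k x)"
    using b(1) by (auto simp: block_def)
  then obtain a where a: "\<And>l. b l = (\<lambda>x. \<Sum>k<N l. a l k * e l k x)" by metis
  then have lim: "(\<lambda>n. l2_norm M (\<lambda>x. f x - partial a n x)) \<longlonglongrightarrow> 0"
    using b(2) by (simp add: partial_def)
  moreover have "partial (\<lambda>l k. l2_inner M f (e l k)) n = partial a n" for n
    by (rule partial_cong) (rule coeff_limit[OF hsum_L2[OF assms] lim])
  ultimately show ?thesis by simp
qed

lemma hsum_inner:
  assumes "f \<in> hsum" "g \<in> L2 M"
  shows "(\<lambda>n. \<Sum>l<n. \<Sum>k<N l. l2_inner M f (e l k) * l2_inner M (e l k) g) \<longlonglongrightarrow> l2_inner M f g"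
  using l2_inner_tendsto_left[OF partial_L2 hsum_L2[OF assms(1)] assms(2) hsum_expansion[OF assms(1)]]
  by (simp add: partial_inner_left assms(2))

lemma hsum_inner_eq_0:
  assumes "f \<in> hsum" "g \<in> L2 M" "\<And>l k. k < N l \<Longrightarrow> l2_inner M g (e l k) = 0"
  shows "l2_inner M g f = 0"
proof -
  have "l2_inner M (e l k) g = 0" if "k < N l" for l k
    using assms(3)[OF that] l2_inner_commute[of M "e l k" g] by simp
  then have "(\<lambda>n. 0) \<longlonglongrightarrow> l2_inner M f g"
    using hsum_inner[OF assms(1,2)] by simp
  then have "l2_inner M f g = 0" using LIMSEQ_unique tendsto_const by blast
  then show ?thesis using l2_inner_commute[of M g f] by simp
qed

lemma hsum_lincomb:
  assumes "f \<in> hsum" "g \<in> hsum"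
  shows "(\<lambda>x. a * f x + b * g x) \<in> hsum"
proof (rule hsumI)
  let ?p = "\<lambda>f. partial (\<lambda>l k. l2_inner M f (e l k))"
  let ?c = "\<lambda>l k. a * l2_inner M f (e l k) + b * l2_inner M g (e l k)"
  show "(\<lambda>x. a * f x + b * g x) \<in> L2 M" by (intro L2_lincomb hsum_L2 assms)
  have L: "(\<lambda>x. f x - ?p f n x) \<in> L2 M" "(\<lambda>x. g x - ?p g n x) \<in> L2 M" for n
    by (intro L2_diff hsum_L2 assms partial_L2)+
  have "(\<lambda>n. cmod a * l2_norm M (\<lambda>x. f x - ?p f n x) + cmod b * l2_norm M (\<lambda>x. g x - ?p g n x))
      \<longlonglongrightarrow> cmod a * 0 + cmod b * 0"
    by (intro tendsto_intros hsum_expansion assms)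
  then have lim: "(\<lambda>n. cmod a * l2_norm M (\<lambda>x. f x - ?p f n x)
      + cmod b * l2_norm M (\<lambda>x. g x - ?p g n x)) \<longlonglongrightarrow> 0" by simp
  have "norm (l2_norm M (\<lambda>x. a * f x + b * g x - partial ?c n x))
      \<le> cmod a * l2_norm M (\<lambda>x. f x - ?p f n x) + cmod b * l2_norm M (\<lambda>x. g x - ?p g n x)" for n
  proof -
    have "(\<lambda>x. a * f x + b * g x - partial ?c n x)
        = (\<lambda>x. a * (f x - ?p f n x) + b * (g x - ?p g n x))"
      by (rule ext)
        (simp add: partial_def sum.distrib sum_distrib_left ring_distribs mult.assoc)
    then show ?thesis
      using l2_norm_triangle[OF L2_scale[OF L(1)] L2_scale[OF L(2)], of a n b n]
      by (simp add: l2_norm_scale)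
  qed
  then show "(\<lambda>n. l2_norm M (\<lambda>x. a * f x + b * g x - partial ?c n x)) \<longlonglongrightarrow> 0"
    by (intro Lim_null_comparison[OF always_eventually lim] allI)
qed

lemma hsum_subspace: "l2_subspace M hsum"
  using hsum_L2 hsum_lincomb by (auto simp: l2_subspace_def)

lemma l2_eq_hsum:
  assumes "f \<in> hsum" "g \<in> hsum" "\<And>l k. k < N l \<Longrightarrow> l2_inner M f (e l k) = l2_inner M g (e l k)"
  shows "l2_eq M f g"
proof -
  have d: "(\<lambda>x. f x - g x) \<in> hsum" using hsum_lincomb[OF assms(1,2), of 1 "-1"] by simp
  have "l2_inner M (\<lambda>x. f x - g x) (\<lambda>x. f x - g x) = 0"
    using assms by (intro hsum_inner_eq_0[OF d hsum_L2[OF d]]) (simp add: l2_inner_diff_left hsum_L2 e_L2)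
  then show ?thesis by (simp add: l2_eq_iff_inner hsum_L2 assms)
qed

lemma block_subset_hsum: "block l \<subseteq> hsum"
proof
  fix f assume "f \<in> block l"
  then obtain a where f: "f = (\<lambda>x. \<Sum>k<N l. a k * e l k x)" by (auto simp: block_def)
  let ?a = "\<lambda>l' k. if l' = l then a k else 0"
  have p: "partial ?a n x = f x" if "l < n" for n x
  proof -
    have "partial ?a n x = (\<Sum>l'<n. if l' = l then f x else 0)"
      unfolding partial_def f by (intro sum.cong) auto
    then show ?thesis using that by simp
  qed
  then have "(\<lambda>n. l2_norm M (\<lambda>x. f x - partial ?a n x)) \<longlonglongrightarrow> 0"
    by (intro tendsto_eventually eventually_sequentiallyI[of "Suc l"])
      (simp add: l2_norm_def p)
  moreover have "f \<in> L2 M" unfolding f by (intro L2_sum L2_scale e_L2) simp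
  ultimately show "f \<in> hsum" by (rule hsumI[rotated])
qed

lemma e_in_block:
  assumes "k < N l"
  shows "e l k \<in> block l"
proof -
  have "(\<Sum>j<N l. (if j = k then 1 else 0) * e l j x) = (\<Sum>j<N l. if j = k then e l k x else 0)" for x
    by (intro sum.cong) auto
  then have "e l k = (\<lambda>x. \<Sum>j<N l. (if j = k then 1 else 0) * e l j x)"
    using assms by simp
  then show ?thesis unfolding block_def
    by (intro CollectI exI[of _ "\<lambda>j. if j = k then 1 else 0"]) simp
qed

lemma block_coeff:
  assumes "f \<in> block l" "k < N l'" "l' \<noteq> l"
  shows "l2_inner M f (e l' k) = 0"
proof -
  obtain a where f: "f = (\<lambda>x. \<Sum>k<N l. a k * e l k x)" using assms by (auto simp: block_def)
  show ?thesis unfolding f using assms(2,3) by (subst l2_inner_sum_left) (auto simp: e_L2 e_inner)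
qed

lemma block_inner_eq_0:
  assumes "f \<in> block l" "g \<in> L2 M" "\<And>k. k < N l \<Longrightarrow> l2_inner M g (e l k) = 0"
  shows "l2_inner M g f = 0"
proof -
  obtain a where f: "f = (\<lambda>x. \<Sum>k<N l. a k * e l k x)" using assms by (auto simp: block_def)
  show ?thesis unfolding f using assms by (subst l2_inner_sum_right) (auto simp: e_L2)
qed

text \<open>
  Because the basis functions are bounded, a series with rapidly decreasing coefficients converges
  uniformly; this makes the completeness of \<open>L\<^sup>2\<close> unnecessary.
\<close>

lemma hsum_series:
  assumes "\<And>l k. k < N l \<Longrightarrow> cmod (a l k) \<le> B l"
    and summ: "summable (\<lambda>l. real (N l) * B l * \<beta> l)"
  obtains g where "g \<in> hsum" "\<And>l k. k < N l \<Longrightarrow> l2_inner M g (e l k) = a l k"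
proof -
  define t where "t = (\<lambda>l x. \<Sum>k<N l. a l k * e l k x)"
  \<comment> \<open>The Weierstrass majorant: \<open>N l\<close> terms, each bounded by
    \<open>B l * \<beta> l\<close>.\<close>
  define m where "m = (\<lambda>l. real (N l) * B l * \<beta> l)"
  define g where "g = (\<lambda>x. \<Sum>l. t l x)"
  have m: "summable m" using summ by (simp add: m_def)
  have t_le: "cmod (t l x) \<le> m l" if "x \<in> space M" for l x
  proof -
    have "cmod (t l x) \<le> (\<Sum>k<N l. B l * \<beta> l)"
      unfolding t_def using assms(1) e_bound[OF _ that]
      by (intro order_trans[OF norm_sum] sum_mono)
        (auto simp: norm_mult intro!: mult_mono' assms(1))
    then show ?thesis by (simp add: m_def mult.assoc)
  qed
  have t_meas: "t l \<in> borel_measurable M" for l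
    unfolding t_def using e_measurable by (intro borel_measurable_sum borel_measurable_times) auto
  have t_abs: "summable (\<lambda>l. cmod (t l x))" if "x \<in> space M" for x
    by (rule summable_comparison_test'[OF m, of 0]) (simp add: t_le[OF that])
  have tail: "cmod (g x - partial a n x) \<le> (\<Sum>l. m (l + n))" if x: "x \<in> space M" for x n
  proof -
    have "g x - partial a n x = (\<Sum>l. t (l + n) x)"
      unfolding g_def using summable_norm_cancel[OF t_abs[OF x]]
      by (subst suminf_minus_initial_segment) (simp_all add: partial_def t_def)
    also have "cmod \<dots> \<le> (\<Sum>l. cmod (t (l + n) x))"
      by (intro summable_norm summable_ignore_initial_segment t_abs[OF x])
    also have "\<dots> \<le> (\<Sum>l. m (l + n))"
      by (intro suminf_le t_le[OF x] summable_ignore_initial_segment t_abs[OF x] m)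
    finally show ?thesis .
  qed
  have g_meas: "g \<in> borel_measurable M"
    unfolding g_def by (intro borel_measurable_suminf t_meas)
  \<comment> \<open>For \<open>n = 0\<close> the tail estimate is a sup bound for \<open>g\<close>
    itself.\<close>
  have gL: "g \<in> L2 M"
    by (rule bounded_L2(1)[OF g_meas, of "\<Sum>l. m l"]) (use tail[of _ 0] in \<open>simp add: partial_def\<close>)
  have lim0: "(\<lambda>n. \<Sum>l. m (l + n)) \<longlonglongrightarrow> 0"
    by (rule suminf_exist_split2[OF m])
  have "l2_norm M (\<lambda>x. g x - partial a n x) \<le> (\<Sum>l. m (l + n))" for n
    using tail g_meas L2_measurable[OF partial_L2] by (intro bounded_L2(2)) auto
  then have lim: "(\<lambda>n. l2_norm M (\<lambda>x. g x - partial a n x)) \<longlonglongrightarrow> 0"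
    by (intro Lim_null_comparison[OF always_eventually lim0] allI) simp
  show ?thesis
    by (rule that[OF hsumI[OF gL lim]]) (rule coeff_limit[OF gL lim])
qed

lemma is_l2_proj_hsumI:
  assumes "f \<in> L2 M" "h \<in> hsum" "\<And>l k. k < N l \<Longrightarrow> l2_inner M h (e l k) = l2_inner M f (e l k)"
  shows "is_l2_proj M hsum f h"
  unfolding is_l2_proj_def
proof (intro conjI ballI)
  fix g assume g: "g \<in> hsum"
  show "l2_inner M (\<lambda>x. f x - h x) g = 0"
    by (rule hsum_inner_eq_0[OF g L2_diff[OF assms(1) hsum_L2[OF assms(2)]]])
      (simp add: l2_inner_diff_left assms hsum_L2 e_L2)
qed (rule assms(2))

lemma orthonormal_basis_block: "orthonormal_basis_on M (block l) (e l ` {..<N l})"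
  unfolding orthonormal_basis_on_def
proof (intro conjI ballI impI)
  fix f g assume "f \<in> e l ` {..<N l}" "g \<in> e l ` {..<N l}"
  then obtain k k' where "f = e l k" "g = e l k'" "k < N l" "k' < N l" by auto
  then show "l2_inner M f g = (if f = g then 1 else 0)"
    using e_inner[of k l k' l] e_inner[of k l k l] by (cases "k = k'") auto
next
  fix f assume f: "f \<in> block l" and 0: "\<forall>g\<in>e l ` {..<N l}. l2_inner M f g = 0"
  have fL: "f \<in> L2 M" using f block_subset_hsum hsum_L2 by blast
  have "l2_inner M f f = 0"
    using 0 by (intro block_inner_eq_0[OF f fL]) simp
  then show "l2_eq M f (\<lambda>x. 0)" using fL by (simp add: l2_eq_iff_inner)
qed (use e_in_block in auto)

lemma card_block: "card (e l ` {..<N l}) = N l"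
proof -
  have "inj_on (e l) {..<N l}"
    using e_inner by (intro inj_onI) (metis lessThan_iff zero_neq_one)
  then show ?thesis by (simp add: card_image)
qed

text \<open>Removing its only component from \<open>g\<close> leaves a vector orthogonal to all
  \<open>e l' k'\<close>, hence to \<open>h\<close>. In use \<open>g\<close> is a basis vector of
  the other Hardy space and so need not belong to \<open>hsum\<close>.\<close>

lemma hsum_inner_single:
  assumes "h \<in> hsum" "g \<in> L2 M" "k < N l"
    and "\<And>l' k'. k' < N l' \<Longrightarrow> l2_inner M (e l' k') g = (if l' = l \<and> k' = k then c else 0)"
  shows "l2_inner M h g = c * l2_inner M h (e l k)"
proof -
  have h: "h \<in> L2 M" and e: "e l k \<in> L2 M" using assms by (auto simp: hsum_L2 e_L2)
  have ge: "l2_inner M g (e l' k') = (if l' = l \<and> k' = k then cnj c else 0)" if "k' < N l'" for l' k'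
    using assms(4)[OF that] l2_inner_commute[of M g "e l' k'"] by auto
  have "l2_inner M (\<lambda>x. g x - cnj c * e l k x) h = 0"
  proof (rule hsum_inner_eq_0[OF assms(1) L2_diff[OF assms(2) L2_scale[OF e]]])
    fix l' k' assume k': "k' < N l'"
    then show "l2_inner M (\<lambda>x. g x - cnj c * e l k x) (e l' k') = 0"
      using assms(2,3) by (auto simp: l2_inner_diff_left L2_scale e_L2 l2_inner_scale_left ge e_inner)
  qed
  then have "l2_inner M g h = cnj c * l2_inner M (e l k) h"
    using assms(2) h e by (simp add: l2_inner_diff_left L2_scale l2_inner_scale_left)
  then have "cnj (l2_inner M g h) = c * cnj (l2_inner M (e l k) h)" by simp
  then show ?thesis using l2_inner_commute[of M h g] l2_inner_commute[of M h "e l k"] by simp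
qed

lemma e_norm: "k < N l \<Longrightarrow> l2_norm M (e l k) = 1"
  using l2_norm_power2_eq[of M "e l k"] e_inner[of k l k l] l2_norm_nonneg[of M "e l k"]
  by (simp add: power2_eq_1_iff)

end

section \<open>Two orthonormal systems with diagonal cross products\<close>

locale crossed_blocks = E: ortho_blocks M N \<beta> e + F: ortho_blocks M N \<beta> f
  for M :: "'a measure" and N \<beta> e f +
  fixes c :: "nat \<Rightarrow> complex"
  assumes cross: "k < N l \<Longrightarrow> k' < N l' \<Longrightarrow>
      l2_inner M (f l k) (e l' k') = (if l = l' \<and> k = k' then c l else 0)"
    and summable_c: "summable (\<lambda>l. real (N l) * cmod (c l) * \<beta> l)"
begin

text \<open>By this symmetry, what is proved for projecting from \<open>F\<close> to
  \<open>E\<close> also holds from \<open>E\<close> to \<open>F\<close>.\<close>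

lemma cross_swap: "crossed_blocks M N \<beta> f e (\<lambda>l. cnj (c l))"
proof unfold_locales
  show "l2_inner M (e l k) (f l' k') = (if l = l' \<and> k = k' then cnj (c l) else 0)"
    if "k < N l" "k' < N l'" for k l k' l'
    using cross[OF that(2,1)] l2_inner_commute[of M "e l k" "f l' k'"] by auto
  show "summable (\<lambda>l. real (N l) * cmod (cnj (c l)) * \<beta> l)" using summable_c by simp
qed

lemma cross_coeff:
  assumes "h \<in> F.hsum" "k < N l"
  shows "l2_inner M h (e l k) = c l * l2_inner M h (f l k)"
  using assms cross by (intro F.hsum_inner_single E.e_L2) auto

text \<open>The coefficients of \<open>h\<close> against \<open>e l k\<close> are bounded by
  \<open>cmod (c l) * l2_norm M h\<close>. Condition \<open>summable_c\<close> is made so that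
  \<open>hsum_series\<close> then produces the projection.\<close>

lemma hsum_proj_exists:
  assumes "h \<in> F.hsum"
  shows "\<exists>g. is_l2_proj M E.hsum h g"
proof -
  have h: "h \<in> L2 M" by (rule F.hsum_L2[OF assms])
  have "cmod (l2_inner M h (e l k)) \<le> cmod (c l) * l2_norm M h" if "k < N l" for l k
    using l2_cauchy_schwarz[OF h F.e_L2[OF that]] F.e_norm[OF that]
    by (simp add: cross_coeff[OF assms that] norm_mult mult_left_mono)
  moreover have "summable (\<lambda>l. real (N l) * (cmod (c l) * l2_norm M h) * \<beta> l)"
    using summable_mult2[OF summable_c, of "l2_norm M h"] by (simp add: ac_simps)
  ultimately obtain g where "g \<in> E.hsum"
      "\<And>l k. k < N l \<Longrightarrow> l2_inner M g (e l k) = l2_inner M h (e l k)"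
    using E.hsum_series[of "\<lambda>l k. l2_inner M h (e l k)" "\<lambda>l. cmod (c l) * l2_norm M h"] by metis
  then show ?thesis using E.is_l2_proj_hsumI[OF h] by blast
qed

definition T :: "('a \<Rightarrow> complex) \<Rightarrow> 'a \<Rightarrow> complex" where
  "T g = orth_proj M E.hsum (orth_proj M F.hsum (orth_proj M E.hsum g))"

text \<open>Licenses the three nested choices in \<open>T\<close>: \<open>g\<close> is its own
  projection, and the overlaps provide the other two. The chosen \<open>h1\<close> is only known to
  equal \<open>g\<close> almost everywhere.\<close>

lemma T_steps:
  assumes "g \<in> E.hsum"
  obtains h1 h2 where "is_l2_proj M E.hsum g h1" "is_l2_proj M F.hsum h1 h2"
    "is_l2_proj M E.hsum h2 (T g)" "l2_eq M g h1"
    "h1 \<in> E.hsum" "h2 \<in> F.hsum" "T g \<in> E.hsum"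
proof -
  interpret swap: crossed_blocks M N \<beta> f e "\<lambda>l. cnj (c l)" by (rule cross_swap)
  let ?h1 = "orth_proj M E.hsum g"
  let ?h2 = "orth_proj M F.hsum ?h1"
  have g: "is_l2_proj M E.hsum g g" using assms by (simp add: is_l2_proj_def)
  have 1: "is_l2_proj M E.hsum g ?h1" by (rule is_l2_proj_orth_proj[OF g])
  then have h1: "?h1 \<in> E.hsum" by (simp add: is_l2_proj_def)
  have 2: "is_l2_proj M F.hsum ?h1 ?h2"
    using swap.hsum_proj_exists[OF h1] is_l2_proj_orth_proj by blast
  then have h2: "?h2 \<in> F.hsum" by (simp add: is_l2_proj_def)
  have 3: "is_l2_proj M E.hsum ?h2 (T g)"
    unfolding T_def using hsum_proj_exists[OF h2] is_l2_proj_orth_proj by blast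
  then have Tg: "T g \<in> E.hsum" by (simp add: is_l2_proj_def)
  have "l2_eq M g g" by (simp add: l2_eq_def)
  then have "l2_eq M g ?h1"
    by (rule is_l2_proj_unique[OF E.hsum_subspace E.hsum_L2[OF assms] E.hsum_L2[OF assms] _ g 1])
  then show ?thesis using 1 2 3 h1 h2 Tg that by blast
qed

lemma T_mem: "g \<in> E.hsum \<Longrightarrow> T g \<in> E.hsum"
  by (erule T_steps)

text \<open>Tested against a vector of its own range, a projection may be dropped. Doing this from
  the outside in, the change from \<open>e\<close> to \<open>f\<close> contributes
  \<open>c l\<close> and the change back contributes \<open>cnj (c l)\<close>.\<close>

lemma T_coeff:
  assumes g: "g \<in> E.hsum" and k: "k < N l"
  shows "l2_inner M (T g) (e l k) = of_real ((cmod (c l))\<^sup>2) * l2_inner M g (e l k)"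
proof -
  interpret swap: crossed_blocks M N \<beta> f e "\<lambda>l. cnj (c l)" by (rule cross_swap)
  obtain h1 h2 where h: "is_l2_proj M E.hsum g h1" "is_l2_proj M F.hsum h1 h2"
    "is_l2_proj M E.hsum h2 (T g)" "h1 \<in> E.hsum" "h2 \<in> F.hsum"
    using T_steps[OF g] by metis
  have e: "e l k \<in> E.hsum" "f l k \<in> F.hsum"
    using E.e_in_block[OF k] E.block_subset_hsum F.e_in_block[OF k] F.block_subset_hsum by auto
  have "l2_inner M (T g) (e l k) = l2_inner M h2 (e l k)"
    by (rule is_l2_proj_inner[OF E.hsum_subspace F.hsum_L2[OF h(5)] h(3) e(1)])
  also have "\<dots> = c l * l2_inner M h2 (f l k)" by (rule cross_coeff[OF h(5) k])
  also have "l2_inner M h2 (f l k) = l2_inner M h1 (f l k)"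
    by (rule is_l2_proj_inner[OF F.hsum_subspace E.hsum_L2[OF h(4)] h(2) e(2)])
  also have "\<dots> = cnj (c l) * l2_inner M h1 (e l k)" by (rule swap.cross_coeff[OF h(4) k])
  also have "l2_inner M h1 (e l k) = l2_inner M g (e l k)"
    by (rule is_l2_proj_inner[OF E.hsum_subspace E.hsum_L2[OF g] h(1) e(1)])
  finally show ?thesis by (simp add: complex_norm_square del: of_real_power)
qed

lemma T_bounded: "bounded_op_on M E.hsum T"
  unfolding bounded_op_on_def
proof (intro conjI ballI allI)
  fix g h a b assume gh: "g \<in> E.hsum" "h \<in> E.hsum"
  show "l2_eq M (T (\<lambda>x. a * g x + b * h x)) (\<lambda>x. a * T g x + b * T h x)"
    by (rule E.l2_eq_hsum)
      (simp_all add: T_mem E.hsum_lincomb gh T_coeff l2_inner_lincomb_left E.hsum_L2 E.e_L2 ring_distribs)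
next
  have "l2_norm M (T g) \<le> 1 * l2_norm M g" if g: "g \<in> E.hsum" for g
  proof -
    obtain h1 h2 where h: "is_l2_proj M E.hsum g h1" "is_l2_proj M F.hsum h1 h2"
      "is_l2_proj M E.hsum h2 (T g)" "h1 \<in> E.hsum" "h2 \<in> F.hsum"
      using T_steps[OF g] by metis
    show ?thesis
      using is_l2_proj_norm_le[OF E.hsum_subspace E.hsum_L2[OF g] h(1)]
        is_l2_proj_norm_le[OF F.hsum_subspace E.hsum_L2[OF h(4)] h(2)]
        is_l2_proj_norm_le[OF E.hsum_subspace F.hsum_L2[OF h(5)] h(3)] by linarith
  qed
  then show "\<exists>C. \<forall>g\<in>E.hsum. l2_norm M (T g) \<le> C * l2_norm M g" by blast
qed (rule T_mem)

text \<open>The quadratic form of \<open>T\<close> at \<open>g\<close> is the squared norm of the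
  middle projection \<open>h2\<close>.\<close>

lemma T_positive: "positive_op_on M E.hsum T"
  unfolding positive_op_on_def
proof (intro conjI ballI T_bounded)
  fix g assume g: "g \<in> E.hsum"
  obtain h1 h2 where h: "is_l2_proj M E.hsum g h1" "is_l2_proj M F.hsum h1 h2"
    "is_l2_proj M E.hsum h2 (T g)" "h1 \<in> E.hsum" "h2 \<in> F.hsum" "l2_eq M g h1"
    using T_steps[OF g] by metis
  have L: "g \<in> L2 M" "h1 \<in> L2 M" "h2 \<in> L2 M" using g h E.hsum_L2 F.hsum_L2 by auto
  have "l2_inner M (T g) g = l2_inner M h2 g"
    by (rule is_l2_proj_inner[OF E.hsum_subspace L(3) h(3) g])
  also have "\<dots> = l2_inner M h2 h1"
    using L h(6) by (intro l2_inner_cong) (auto simp: l2_eq_def)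
  also have "\<dots> = cnj (l2_inner M h1 h2)" by (rule l2_inner_commute)
  also have "l2_inner M h1 h2 = l2_inner M h2 h2"
    by (rule is_l2_proj_inner[OF F.hsum_subspace L(2) h(2) h(5), symmetric])
  finally have *: "l2_inner M (T g) g = of_real ((l2_norm M h2)\<^sup>2)" by (simp add: l2_inner_self)
  show "Im (l2_inner M (T g) g) = 0" "0 \<le> Re (l2_inner M (T g) g)"
    unfolding * by (simp_all only: Im_complex_of_real Re_complex_of_real zero_le_power2)
qed

lemma T_trace_class:
  assumes "summable (\<lambda>l. real (N l) * (cmod (c l))\<^sup>2)"
  shows "trace_class_on M E.hsum T"
  unfolding trace_class_on_def
proof (intro conjI T_bounded exI[of _ T] allI impI)
  \<comment> \<open>A positive operator is its own absolute value.\<close>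
  show "abs_op_on M E.hsum T T" by (simp add: abs_op_on_def T_positive)
  fix B assume B: "orthonormal_basis_on M E.hsum B"
  define S where "S = (\<Sum>l. real (N l) * (cmod (c l))\<^sup>2)"
  have pos: "0 \<le> Re (l2_inner M (T x) x)" if "x \<in> B" for x
    using that B T_positive by (auto simp: orthonormal_basis_on_def positive_op_on_def)
  \<comment> \<open>Each diagonal entry is the limit of its expansion in the basis \<open>e\<close>,
    so a bound on the truncated expansions, uniform in \<open>n\<close> and \<open>G\<close>, is
    enough.\<close>
  have "sum (\<lambda>x. Re (l2_inner M (T x) x)) G \<le> S" if G: "G \<subseteq> B" "finite G" for G
  proof (rule LIMSEQ_le_const2)
    have GH: "x \<in> E.hsum" if "x \<in> G" for x
      using that G B by (auto simp: orthonormal_basis_on_def)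
    let ?t = "\<lambda>n x. \<Sum>l<n. \<Sum>k<N l. l2_inner M (T x) (e l k) * l2_inner M (e l k) x"
    show "(\<lambda>n. \<Sum>x\<in>G. Re (?t n x)) \<longlonglongrightarrow> (\<Sum>x\<in>G. Re (l2_inner M (T x) x))"
      using GH by (intro tendsto_sum tendsto_Re E.hsum_inner T_mem E.hsum_L2) auto
    have "(\<Sum>x\<in>G. Re (?t n x)) \<le> S" for n
    proof -
      have "Re (l2_inner M (T x) (e l k) * l2_inner M (e l k) x)
          = (cmod (c l))\<^sup>2 * (cmod (l2_inner M x (e l k)))\<^sup>2" if "x \<in> G" "k < N l" for x l k
      proof -
        have "l2_inner M (T x) (e l k) * l2_inner M (e l k) x
            = of_real ((cmod (c l))\<^sup>2 * (cmod (l2_inner M x (e l k)))\<^sup>2)"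
          unfolding of_real_mult T_coeff[OF GH[OF that(1)] that(2)]
            complex_norm_square[of "l2_inner M x (e l k)"]
          by (simp add: l2_inner_commute[of M "e l k" x] mult.assoc)
        then show ?thesis by (simp only: Re_complex_of_real)
      qed
      then have "(\<Sum>x\<in>G. Re (?t n x))
          = (\<Sum>x\<in>G. \<Sum>l<n. \<Sum>k<N l. (cmod (c l))\<^sup>2 * (cmod (l2_inner M x (e l k)))\<^sup>2)"
        unfolding Re_sum by (intro sum.cong refl) auto
      \<comment> \<open>With the sums exchanged, the part over \<open>G\<close> is innermost, and
        Bessel for the unit vector \<open>e l k\<close> bounds it by \<open>1\<close>.\<close>
      also have "\<dots> = (\<Sum>l<n. (cmod (c l))\<^sup>2 * (\<Sum>k<N l. \<Sum>x\<in>G. (cmod (l2_inner M x (e l k)))\<^sup>2))"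
        by (subst sum.swap, subst sum.swap[of _ G]) (simp add: sum_distrib_left)
      also have "\<dots> \<le> (\<Sum>l<n. (cmod (c l))\<^sup>2 * (\<Sum>k<N l. 1))"
      proof (intro sum_mono mult_left_mono)
        fix l k assume "k \<in> {..<N l}"
        then have k: "k < N l" by simp
        show "(\<Sum>x\<in>G. (cmod (l2_inner M x (e l k)))\<^sup>2) \<le> 1"
          using l2_bessel[OF G(2) _ E.e_L2[OF k]] E.e_norm[OF k] G B GH E.hsum_L2
          by (auto simp: orthonormal_basis_on_def subset_iff)
      qed simp
      also have "\<dots> \<le> S"
        unfolding S_def using assms
        by (intro order_trans[OF _ sum_le_suminf[of _ "{..<n}"]]) (auto simp: mult.commute)
      finally show ?thesis .
    qed
    then show "\<exists>n0. \<forall>n\<ge>n0. (\<Sum>x\<in>G. Re (?t n x)) \<le> S" by blast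
  qed
  then have "bdd_above (sum (\<lambda>x. Re (l2_inner M (T x) x)) ` {G. G \<subseteq> B \<and> finite G})"
    by (intro bdd_aboveI[of _ S]) auto
  then show "(\<lambda>x. Re (l2_inner M (T x) x)) summable_on B"
    using pos by (intro nonneg_bdd_above_summable_on) auto
qed

lemma T_block:
  assumes "g \<in> E.block l"
  shows "l2_eq M (T g) (\<lambda>x. of_real ((cmod (c l))\<^sup>2) * g x)"
proof -
  have g: "g \<in> E.hsum" using assms E.block_subset_hsum by blast
  show ?thesis
  proof (rule E.l2_eq_hsum)
    show "(\<lambda>x. of_real ((cmod (c l))\<^sup>2) * g x) \<in> E.hsum"
      using E.hsum_lincomb[OF g g, of _ 0] by simp
    fix l' k assume k: "k < N l'"
    show "l2_inner M (T g) (e l' k) = l2_inner M (\<lambda>x. of_real ((cmod (c l))\<^sup>2) * g x) (e l' k)"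
      unfolding T_coeff[OF g k] l2_inner_scale_left[OF E.hsum_L2[OF g] E.e_L2[OF k]]
      using E.block_coeff[OF assms k] by (cases "l' = l") simp_all
  qed (rule T_mem[OF g])
qed

text \<open>On an eigenvector, a coefficient at another level \<open>l'\<close> is multiplied both
  by the eigenvalue of \<open>l'\<close> and by that of \<open>l\<close>. As these differ, the
  coefficient is zero.\<close>

lemma T_eigenspace:
  assumes inj: "inj (\<lambda>l. (cmod (c l))\<^sup>2)"
  shows "orthonormal_basis_on M {g \<in> E.hsum. l2_eq M (T g) (\<lambda>x. of_real ((cmod (c l))\<^sup>2) * g x)}
           (e l ` {..<N l})"
  unfolding orthonormal_basis_on_def
proof (intro conjI ballI impI)
  show "e l ` {..<N l} \<subseteq> {g \<in> E.hsum. l2_eq M (T g) (\<lambda>x. of_real ((cmod (c l))\<^sup>2) * g x)}"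
    using T_block[OF E.e_in_block] E.e_in_block E.block_subset_hsum by blast
next
  fix g h assume "g \<in> e l ` {..<N l}" "h \<in> e l ` {..<N l}"
  then show "l2_inner M g h = (if g = h then 1 else 0)"
    using E.orthonormal_basis_block[of l] unfolding orthonormal_basis_on_def by blast
next
  fix g assume "g \<in> {g \<in> E.hsum. l2_eq M (T g) (\<lambda>x. of_real ((cmod (c l))\<^sup>2) * g x)}"
    and 0: "\<forall>h\<in>e l ` {..<N l}. l2_inner M g h = 0"
  then have g: "g \<in> E.hsum" and Tg: "l2_eq M (T g) (\<lambda>x. of_real ((cmod (c l))\<^sup>2) * g x)" by auto
  have gL: "g \<in> L2 M" by (rule E.hsum_L2[OF g])
  have "l2_inner M g (e l' k) = 0" if k: "k < N l'" for l' k
  proof (cases "l' = l")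
    case False
    have "l2_inner M (T g) (e l' k) = l2_inner M (\<lambda>x. of_real ((cmod (c l))\<^sup>2) * g x) (e l' k)"
      by (intro l2_inner_cong Tg E.hsum_L2[OF T_mem[OF g]] L2_scale gL E.e_L2[OF k])
        (simp add: l2_eq_def)
    then have "of_real ((cmod (c l'))\<^sup>2) * l2_inner M g (e l' k)
        = of_real ((cmod (c l))\<^sup>2) * l2_inner M g (e l' k)"
      by (simp only: T_coeff[OF g k] l2_inner_scale_left[OF gL E.e_L2[OF k]])
    moreover have "(cmod (c l'))\<^sup>2 \<noteq> (cmod (c l))\<^sup>2" using False injD[OF inj, of l' l] by auto
    ultimately show ?thesis by (metis mult_right_cancel of_real_eq_iff)
  qed (use 0 k in auto)
  then have "l2_inner M g g = 0" by (intro E.hsum_inner_eq_0[OF g gL])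
  then show "l2_eq M g (\<lambda>x. 0)" using gL by (simp add: l2_eq_iff_inner)
qed

text \<open>An isometry that maps a subspace onto itself carries orthogonal projections to
  orthogonal projections. Surjectivity enters because orthogonality must be tested against every
  element of the subspace, so every element must be an image under \<open>U\<close>.\<close>

lemma T_commute:
  assumes U_L2: "\<And>g. g \<in> L2 M \<Longrightarrow> U g \<in> L2 M"
    and U_inner: "\<And>g h. g \<in> L2 M \<Longrightarrow> h \<in> L2 M \<Longrightarrow> l2_inner M (U g) (U h) = l2_inner M g h"
    and U_diff: "\<And>g h. U (\<lambda>x. g x - h x) = (\<lambda>x. U g x - U h x)"
    and U_E: "\<And>g. g \<in> E.hsum \<Longrightarrow> U g \<in> E.hsum" "\<And>g. g \<in> E.hsum \<Longrightarrow> \<exists>h\<in>E.hsum. U h = g"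
    and U_F: "\<And>g. g \<in> F.hsum \<Longrightarrow> U g \<in> F.hsum" "\<And>g. g \<in> F.hsum \<Longrightarrow> \<exists>h\<in>F.hsum. U h = g"
    and g: "g \<in> E.hsum"
  shows "l2_eq M (T (U g)) (U (T g))"
proof -
  have U_proj: "is_l2_proj M S (U g) (U h)"
    if S: "l2_subspace M S" "\<And>g. g \<in> S \<Longrightarrow> U g \<in> S" "\<And>g. g \<in> S \<Longrightarrow> \<exists>h\<in>S. U h = g"
      and gh: "is_l2_proj M S g h" "g \<in> L2 M" for S g h
    unfolding is_l2_proj_def
  proof (intro conjI ballI)
    have SL: "S \<subseteq> L2 M" using S(1) by (simp add: l2_subspace_def)
    have h: "h \<in> S" using gh by (simp add: is_l2_proj_def)
    then show "U h \<in> S" by (rule S(2))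
    fix k assume "k \<in> S"
    then obtain k' where k': "k' \<in> S" "U k' = k" using S(3) by blast
    have "l2_inner M (U (\<lambda>x. g x - h x)) (U k') = l2_inner M (\<lambda>x. g x - h x) k'"
      using gh h k' SL by (intro U_inner L2_diff) auto
    then show "l2_inner M (\<lambda>x. U g x - U h x) k = 0"
      using gh k' by (simp add: U_diff is_l2_proj_def)
  qed
  obtain h1 h2 where h: "is_l2_proj M E.hsum g h1" "is_l2_proj M F.hsum h1 h2"
    "is_l2_proj M E.hsum h2 (T g)" "h1 \<in> E.hsum" "h2 \<in> F.hsum"
    using T_steps[OF g] by metis
  obtain h1' h2' where h': "is_l2_proj M E.hsum (U g) h1'" "is_l2_proj M F.hsum h1' h2'"
    "is_l2_proj M E.hsum h2' (T (U g))" "h1' \<in> E.hsum" "h2' \<in> F.hsum"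
    using T_steps[OF U_E(1)[OF g]] by metis
  have L: "g \<in> L2 M" "h1 \<in> L2 M" "h2 \<in> L2 M" "h1' \<in> L2 M" "h2' \<in> L2 M"
    using g h h' E.hsum_L2 F.hsum_L2 by auto
  have "l2_eq M (U g) (U g)" by (simp add: l2_eq_def)
  then have "l2_eq M h1' (U h1)"
    by (rule is_l2_proj_unique[OF E.hsum_subspace U_L2[OF L(1)] U_L2[OF L(1)] _ h'(1)
          U_proj[OF E.hsum_subspace U_E h(1) L(1)]])
  then have "l2_eq M h2' (U h2)"
    by (rule is_l2_proj_unique[OF F.hsum_subspace L(4) U_L2[OF L(2)] _ h'(2)
          U_proj[OF F.hsum_subspace U_F h(2) L(2)]])
  then show ?thesis
    by (rule is_l2_proj_unique[OF E.hsum_subspace L(5) U_L2[OF L(3)] _ h'(3)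
          U_proj[OF E.hsum_subspace U_E h(3) L(3)]])
qed

end

section \<open>Binary forms\<close>

lemma hom_coeff_unique:
  fixes a b :: "nat \<Rightarrow> complex"
  assumes "\<And>z :: complex^2. (\<Sum>k\<le>n. a k * (z $ 1 ^ (n - k) * z $ 2 ^ k))
                       = (\<Sum>k\<le>n. b k * (z $ 1 ^ (n - k) * z $ 2 ^ k))"
    and "k \<le> n"
  shows "a k = b k"
proof -
  \<comment> \<open>Dehomogenize: with the first variable equal to \<open>1\<close> this is a
    polynomial in one variable.\<close>
  have "(\<Sum>k\<le>n. a k * t ^ k) = (\<Sum>k\<le>n. b k * t ^ k)" for t
    using assms(1)[of "vector [1, t]"] by simp
  then show ?thesis using polyfun_eq_coeffs[where c=a and d=b and n=n] assms(2) by auto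
qed

text \<open>The cut-off reflects the clause of \<open>sym_coeff\<close> that forces coefficients
  beyond \<open>2 * l\<close> to vanish and so makes the description unique.\<close>

lemma sym_coeff_eq:
  "sym_coeff l (\<lambda>z. \<Sum>k\<le>2 * l. a k * monom_fun l k z) = (\<lambda>k. if k \<le> 2 * l then a k else 0)"
  unfolding sym_coeff_def
proof (rule the_equality)
  fix b assume b: "(\<forall>k. k > 2 * l \<longrightarrow> b k = 0) \<and>
    (\<lambda>z. \<Sum>k\<le>2 * l. a k * monom_fun l k z) = (\<lambda>z. \<Sum>k\<le>2 * l. b k * monom_fun l k z)"
  then have "a k = b k" if "k \<le> 2 * l" for k
    using hom_coeff_unique[where n="2 * l" and a=a and b=b and k=k] that by (auto simp: monom_fun_def fun_eq_iff)
  then show "b = (\<lambda>k. if k \<le> 2 * l then a k else 0)"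
    using b by (auto simp: fun_eq_iff)
qed (auto intro!: ext sum.cong)

lemma SymI: "p = (\<lambda>z. \<Sum>k\<le>2 * l. a k * monom_fun l k z) \<Longrightarrow> p \<in> Sym l"
  by (auto simp: Sym_def)

lemma Sym_expand:
  assumes "p \<in> Sym l"
  shows "p = (\<lambda>z. \<Sum>k\<le>2 * l. sym_coeff l p k * monom_fun l k z)"
proof -
  obtain a where a: "p = (\<lambda>z. \<Sum>k\<le>2 * l. a k * monom_fun l k z)"
    using assms by (auto simp: Sym_def)
  show ?thesis unfolding a sym_coeff_eq by auto
qed

lemma Sym_lincomb:
  assumes "p \<in> Sym l" "q \<in> Sym l"
  shows "(\<lambda>z. a * p z + b * q z) \<in> Sym l"
    and "sym_coeff l (\<lambda>z. a * p z + b * q z) = (\<lambda>k. a * sym_coeff l p k + b * sym_coeff l q k)"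
proof -
  obtain c d where cd: "p = (\<lambda>z. \<Sum>k\<le>2 * l. c k * monom_fun l k z)"
      "q = (\<lambda>z. \<Sum>k\<le>2 * l. d k * monom_fun l k z)"
    using assms by (auto simp: Sym_def)
  have eq: "(\<lambda>z. a * p z + b * q z) = (\<lambda>z. \<Sum>k\<le>2 * l. (a * c k + b * d k) * monom_fun l k z)"
    unfolding cd by (simp add: sum.distrib sum_distrib_left ring_distribs mult.assoc)
  show "(\<lambda>z. a * p z + b * q z) \<in> Sym l" unfolding eq by (rule SymI) simp
  show "sym_coeff l (\<lambda>z. a * p z + b * q z) = (\<lambda>k. a * sym_coeff l p k + b * sym_coeff l q k)"
    unfolding eq sym_coeff_eq unfolding cd sym_coeff_eq by auto
qed

lemma Sym_zero: "(\<lambda>z. 0) \<in> Sym l"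
  by (rule SymI[where a="\<lambda>k. 0"]) simp

lemma Sym_scale:
  assumes "p \<in> Sym l"
  shows "(\<lambda>z. a * p z) \<in> Sym l" "sym_coeff l (\<lambda>z. a * p z) = (\<lambda>k. a * sym_coeff l p k)"
  using Sym_lincomb[OF assms assms, of a 0] by simp_all

lemma Sym_sum: "(\<And>i. i \<in> I \<Longrightarrow> p i \<in> Sym l) \<Longrightarrow> (\<lambda>z. \<Sum>i\<in>I. a i * p i z) \<in> Sym l"
proof (induction I rule: infinite_finite_induct)
  case (insert i I)
  then show ?case using Sym_lincomb(1)[of "p i" l "\<lambda>z. \<Sum>i\<in>I. a i * p i z" "a i" 1] by simp
qed (auto intro: Sym_zero)

lemma monom_Sym:
  assumes "k \<le> 2 * l"
  shows "monom_fun l k \<in> Sym l" "sym_coeff l (monom_fun l k) = (\<lambda>j. if j = k then 1 else 0)"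
proof -
  have "(\<Sum>j\<le>2 * l. (if j = k then 1 else 0) * monom_fun l j z)
      = (\<Sum>j\<le>2 * l. if j = k then monom_fun l j z else 0)" for z
    by (intro sum.cong) auto
  then have eq: "monom_fun l k = (\<lambda>z. \<Sum>j\<le>2 * l. (if j = k then 1 else 0) * monom_fun l j z)"
    using assms by simp
  show "monom_fun l k \<in> Sym l" by (rule SymI[OF eq])
  show "sym_coeff l (monom_fun l k) = (\<lambda>j. if j = k then 1 else 0)"
    by (subst eq, subst sym_coeff_eq) (use assms in auto)
qed

lemma sym_dual_sum:
  assumes "\<phi> \<in> sym_dual l" "\<And>i. i \<in> I \<Longrightarrow> p i \<in> Sym l"
  shows "\<phi> (\<lambda>z. \<Sum>i\<in>I. a i * p i z) = (\<Sum>i\<in>I. a i * \<phi> (p i))"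
proof -
  have lin: "\<phi> (\<lambda>z. a * p z + b * q z) = a * \<phi> p + b * \<phi> q" if "p \<in> Sym l" "q \<in> Sym l" for p q a b
    using assms(1) that by (auto simp: sym_dual_def)
  have 0: "\<phi> (\<lambda>z. 0) = 0" using lin[OF Sym_zero Sym_zero, of 0 0] by simp
  show ?thesis
    using assms(2)
  proof (induction I rule: infinite_finite_induct)
    case (insert i I)
    then have "\<phi> (\<lambda>z. a i * p i z + 1 * (\<Sum>i\<in>I. a i * p i z))
        = a i * \<phi> (p i) + 1 * \<phi> (\<lambda>z. \<Sum>i\<in>I. a i * p i z)"
      by (intro lin Sym_sum) auto
    with insert show ?case by simp
  qed (simp_all add: 0)
qed

lemma sym_dual_expand:
  assumes "\<phi> \<in> sym_dual l"
  shows "\<phi> (\<lambda>z. \<Sum>k\<le>2 * l. a k * monom_fun l k z) = (\<Sum>k\<le>2 * l. a k * \<phi> (monom_fun l k))"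
  by (rule sym_dual_sum[OF assms]) (simp add: monom_Sym)

lemma sym_inner_lincomb_left:
  assumes "p \<in> Sym l" "q \<in> Sym l"
  shows "sym_inner l (\<lambda>z. a * p z + b * q z) r = a * sym_inner l p r + b * sym_inner l q r"
  unfolding sym_inner_def Sym_lincomb(2)[OF assms]
  by (simp add: ring_distribs add_divide_distrib sum.distrib sum_distrib_left mult.assoc)

lemma sym_inner_commute: "sym_inner l p q = cnj (sym_inner l q p)"
  unfolding sym_inner_def by (simp add: mult.commute)

lemma sym_inner_scale_left:
  "p \<in> Sym l \<Longrightarrow> sym_inner l (\<lambda>z. a * p z) q = a * sym_inner l p q"
  using sym_inner_lincomb_left[of p l p a 0] by simp

lemma sym_inner_scale_right:
  "p \<in> Sym l \<Longrightarrow> sym_inner l q (\<lambda>z. a * p z) = cnj a * sym_inner l q p"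
  using sym_inner_commute[of l q "\<lambda>z. a * p z"] sym_inner_commute[of l q p]
  by (simp add: sym_inner_scale_left)

lemma sym_inner_self: "sym_inner l p p = of_real (\<Sum>k\<le>2 * l. (cmod (sym_coeff l p k))\<^sup>2 / real ((2 * l) choose k))"
  unfolding sym_inner_def of_real_sum of_real_divide complex_norm_square by simp

lemma sym_norm_power2: "sym_inner l p p = of_real ((sym_norm l p)\<^sup>2)"
  unfolding sym_norm_def sym_inner_self Re_complex_of_real
  by (simp add: sum_nonneg)

lemma sym_norm_power2_eq:
  "(sym_norm l p)\<^sup>2 = (\<Sum>k\<le>2 * l. (cmod (sym_coeff l p k))\<^sup>2 / real ((2 * l) choose k))"
  using sym_norm_power2[of l p] sym_inner_self[of l p] by (metis of_real_eq_iff)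

lemma sym_norm_nonneg: "0 \<le> sym_norm l p"
  unfolding sym_norm_def sym_inner_self Re_complex_of_real by (simp add: sum_nonneg)

lemma sym_inner_monom_right:
  assumes "k \<le> 2 * l"
  shows "sym_inner l p (monom_fun l k) = sym_coeff l p k / of_nat ((2 * l) choose k)"
proof -
  have "sym_inner l p (monom_fun l k)
      = (\<Sum>j\<le>2 * l. if j = k then sym_coeff l p k / of_nat ((2 * l) choose k) else 0)"
    unfolding sym_inner_def monom_Sym(2)[OF assms] by (intro sum.cong) auto
  then show ?thesis using assms by simp
qed

lemma sym_norm_monom:
  assumes "k \<le> 2 * l"
  shows "(sym_norm l (monom_fun l k))\<^sup>2 = 1 / real ((2 * l) choose k)"
proof -
  have "of_real ((sym_norm l (monom_fun l k))\<^sup>2) = (of_real (1 / real ((2 * l) choose k)) :: complex)"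
    using sym_inner_monom_right[OF assms, of "monom_fun l k"]
    unfolding sym_norm_power2 by (simp add: monom_Sym(2)[OF assms])
  then show ?thesis by (simp only: of_real_eq_iff)
qed

lemma sym_normalize_Sym: "p \<in> Sym l \<Longrightarrow> sym_normalize l p \<in> Sym l"
  unfolding sym_normalize_def using Sym_scale(1)[of p l "1 / of_real (sym_norm l p)"] by simp

lemma sym_inner_normalize:
  assumes "p \<in> Sym l" "q \<in> Sym l"
  shows "sym_inner l (sym_normalize l p) (sym_normalize l q)
    = sym_inner l p q / of_real (sym_norm l p * sym_norm l q)"
proof -
  have n: "sym_normalize l r = (\<lambda>z. inverse (of_real (sym_norm l r)) * r z)" for r
    unfolding sym_normalize_def by (simp add: divide_inverse mult.commute)
  show ?thesis unfolding n
    by (simp add: sym_inner_scale_left sym_inner_scale_right Sym_scale(1) assms divide_inverse)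
qed

text \<open>
  The parameter will be a matrix \<open>A\<close> acting on the variables: continuity of the coefficients of
  \<open>p \<circ> A\<close> is what makes the matrix coefficients of the representation continuous.
\<close>

definition hom_family :: "nat \<Rightarrow> ('a::topological_space \<Rightarrow> complex^2 \<Rightarrow> complex) set" where
  "hom_family n = {P. \<exists>a. (\<forall>k. continuous_on UNIV (a k)) \<and>
      P = (\<lambda>x z. \<Sum>k\<le>n. a k x * (z $ 1 ^ (n - k) * z $ 2 ^ k))}"

lemma hom_familyI:
  "(\<And>k. continuous_on UNIV (a k)) \<Longrightarrow> P = (\<lambda>x z. \<Sum>k\<le>n. a k x * (z $ 1 ^ (n - k) * z $ 2 ^ k))
    \<Longrightarrow> P \<in> hom_family n"
  by (auto simp: hom_family_def)

lemma hom_family_add: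
  assumes "P \<in> hom_family n" "Q \<in> hom_family n" "continuous_on UNIV f" "continuous_on UNIV g"
  shows "(\<lambda>x z. f x * P x z + g x * Q x z) \<in> hom_family n"
proof -
  obtain a b where ab: "\<And>k. continuous_on UNIV (a k)" "\<And>k. continuous_on UNIV (b k)"
    "P = (\<lambda>x z. \<Sum>k\<le>n. a k x * (z $ 1 ^ (n - k) * z $ 2 ^ k))"
    "Q = (\<lambda>x z. \<Sum>k\<le>n. b k x * (z $ 1 ^ (n - k) * z $ 2 ^ k))"
    using assms(1,2) unfolding hom_family_def by blast
  show ?thesis
  proof (rule hom_familyI)
    show "continuous_on UNIV (\<lambda>x. f x * a k x + g x * b k x)" for k
      by (intro continuous_intros ab assms)
    show "(\<lambda>x z. f x * P x z + g x * Q x z)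
        = (\<lambda>x z. \<Sum>k\<le>n. (f x * a k x + g x * b k x) * (z $ 1 ^ (n - k) * z $ 2 ^ k))"
      unfolding ab(3,4) by (simp add: sum.distrib sum_distrib_left ring_distribs mult.assoc)
  qed
qed

lemma hom_family_mult_1:
  assumes "P \<in> hom_family n"
  shows "(\<lambda>x z. z $ 1 * P x z) \<in> hom_family (Suc n)"
proof -
  obtain a where a: "\<And>k. continuous_on UNIV (a k)"
    "P = (\<lambda>x z. \<Sum>k\<le>n. a k x * (z $ 1 ^ (n - k) * z $ 2 ^ k))"
    using assms unfolding hom_family_def by blast
  show ?thesis
  proof (rule hom_familyI)
    show "continuous_on UNIV (\<lambda>x. if k \<le> n then a k x else 0)" for k
      using a(1)[of k] by (cases "k \<le> n") auto
    show "(\<lambda>x z. z $ 1 * P x z) = (\<lambda>x z. \<Sum>k\<le>Suc n. (if k \<le> n then a k x else 0)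
        * (z $ 1 ^ (Suc n - k) * z $ 2 ^ k))"
      unfolding a(2) by (auto simp: fun_eq_iff sum_distrib_left Suc_diff_le intro!: sum.cong)
  qed
qed

lemma hom_family_mult_2:
  assumes "P \<in> hom_family n"
  shows "(\<lambda>x z. z $ 2 * P x z) \<in> hom_family (Suc n)"
proof -
  obtain a where a: "\<And>k. continuous_on UNIV (a k)"
    "P = (\<lambda>x z. \<Sum>k\<le>n. a k x * (z $ 1 ^ (n - k) * z $ 2 ^ k))"
    using assms unfolding hom_family_def by blast
  show ?thesis
  proof (rule hom_familyI)
    show "continuous_on UNIV (\<lambda>x. case k of 0 \<Rightarrow> 0 | Suc j \<Rightarrow> a j x)" for k
      using a(1) by (cases k) auto
    show "(\<lambda>x z. z $ 2 * P x z) = (\<lambda>x z. \<Sum>k\<le>Suc n. (case k of 0 \<Rightarrow> 0 | Suc j \<Rightarrow> a j x)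
        * (z $ 1 ^ (Suc n - k) * z $ 2 ^ k))"
      unfolding a(2) sum.atMost_Suc_shift
      by (auto simp: fun_eq_iff sum_distrib_left intro!: sum.cong)
  qed
qed

lemma hom_family_mult_linear:
  assumes "P \<in> hom_family n" "continuous_on UNIV f" "continuous_on UNIV g"
  shows "(\<lambda>x z. (f x * z $ 1 + g x * z $ 2) * P x z) \<in> hom_family (Suc n)"
  using hom_family_add[OF hom_family_mult_1[OF assms(1)] hom_family_mult_2[OF assms(1)] assms(2,3)]
  by (simp add: ring_distribs mult.assoc)

text \<open>The shape of a monomial composed with a matrix: powers of two linear forms whose
  coefficients are the matrix entries.\<close>

lemma hom_family_linear_powers:
  assumes "continuous_on UNIV f" "continuous_on UNIV g" "continuous_on UNIV f'" "continuous_on UNIV g'"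
  shows "(\<lambda>x z. (f x * z $ 1 + g x * z $ 2) ^ i * (f' x * z $ 1 + g' x * z $ 2) ^ j) \<in> hom_family (i + j)"
proof (induction i)
  case 0
  show ?case
  proof (induction j)
    case 0
    show ?case by (rule hom_familyI[of "\<lambda>k x. 1"]) auto
  next
    case (Suc j)
    then show ?case using hom_family_mult_linear[OF Suc assms(3,4)] by simp
  qed
next
  case (Suc i)
  then show ?case using hom_family_mult_linear[OF Suc assms(1,2)] by (simp add: mult.assoc)
qed

lemma hom_family_sum:
  assumes "\<And>i. i \<in> I \<Longrightarrow> P i \<in> hom_family n"
  shows "(\<lambda>x z. \<Sum>i\<in>I. c i * P i x z) \<in> hom_family n"
  using assms
proof (induction I rule: infinite_finite_induct)
  case (insert i I)
  then show ?case
    using hom_family_add[of "P i" n "\<lambda>x z. \<Sum>i\<in>I. c i * P i x z" "\<lambda>x. c i" "\<lambda>x. 1"] by simp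
qed (auto intro!: hom_familyI[of "\<lambda>k x. 0"])

lemma matrix_vector_mult_2:
  fixes A :: "'a::comm_semiring_1^2^2"
  shows "(A *v z) $ 1 = A $ 1 $ 1 * z $ 1 + A $ 1 $ 2 * z $ 2"
    "(A *v z) $ 2 = A $ 2 $ 1 * z $ 1 + A $ 2 $ 2 * z $ 2"
  by (simp_all add: matrix_vector_mult_def sum_2)

lemma hom_family_matrix:
  assumes "p \<in> Sym l"
  shows "(\<lambda>(A::complex^2^2) z. p (A *v z)) \<in> hom_family (2 * l)"
proof -
  have "(\<lambda>(A::complex^2^2) z. \<Sum>k\<le>2 * l. sym_coeff l p k *
      ((A $ 1 $ 1 * z $ 1 + A $ 1 $ 2 * z $ 2) ^ (2 * l - k)
        * (A $ 2 $ 1 * z $ 1 + A $ 2 $ 2 * z $ 2) ^ k)) \<in> hom_family (2 * l)"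
  proof (rule hom_family_sum)
    fix k assume "k \<in> {..2 * l}"
    then have "2 * l - k + k = 2 * l" by simp
    moreover have "(\<lambda>(A::complex^2^2) z. (A $ 1 $ 1 * z $ 1 + A $ 1 $ 2 * z $ 2) ^ (2 * l - k)
        * (A $ 2 $ 1 * z $ 1 + A $ 2 $ 2 * z $ 2) ^ k) \<in> hom_family (2 * l - k + k)"
      by (intro hom_family_linear_powers continuous_intros)
    ultimately show "(\<lambda>(A::complex^2^2) z. (A $ 1 $ 1 * z $ 1 + A $ 1 $ 2 * z $ 2) ^ (2 * l - k)
        * (A $ 2 $ 1 * z $ 1 + A $ 2 $ 2 * z $ 2) ^ k) \<in> hom_family (2 * l)"
      by simp
  qed
  also have "(\<lambda>(A::complex^2^2) z. \<Sum>k\<le>2 * l. sym_coeff l p k *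
      ((A $ 1 $ 1 * z $ 1 + A $ 1 $ 2 * z $ 2) ^ (2 * l - k)
        * (A $ 2 $ 1 * z $ 1 + A $ 2 $ 2 * z $ 2) ^ k)) = (\<lambda>A z. p (A *v z))"
    by (subst Sym_expand[OF assms]) (simp add: monom_fun_def matrix_vector_mult_2)
  finally show ?thesis .
qed

lemma hom_family_Sym:
  assumes "P \<in> hom_family (2 * l)"
  shows "P x \<in> Sym l"
proof -
  obtain a where "P = (\<lambda>x z. \<Sum>k\<le>2 * l. a k x * (z $ 1 ^ (2 * l - k) * z $ 2 ^ k))"
    using assms unfolding hom_family_def by blast
  then show ?thesis by (intro SymI[where a="\<lambda>k. a k x"]) (simp add: monom_fun_def)
qed

lemma Sym_matrix: "p \<in> Sym l \<Longrightarrow> (\<lambda>z. p (A *v z)) \<in> Sym l"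
  using hom_family_Sym[OF hom_family_matrix] .

text \<open>Linearity of \<open>\<phi>\<close> on the finite-dimensional \<open>Sym l\<close> is
  enough: the dependence on \<open>x\<close> sits in the coefficients, and the values of
  \<open>\<phi>\<close> on monomials are constants.\<close>

lemma continuous_on_dual_hom_family:
  assumes "P \<in> hom_family (2 * l)" "\<phi> \<in> sym_dual l"
  shows "continuous_on UNIV (\<lambda>x. \<phi> (P x))"
proof -
  obtain a where a: "\<And>k. continuous_on UNIV (a k)"
    and P: "P = (\<lambda>x z. \<Sum>k\<le>2 * l. a k x * (z $ 1 ^ (2 * l - k) * z $ 2 ^ k))"
    using assms(1) unfolding hom_family_def by blast
  have "\<phi> (P x) = (\<Sum>k\<le>2 * l. a k x * \<phi> (monom_fun l k))" for x
    unfolding P using sym_dual_expand[OF assms(2), of "\<lambda>k. a k x"] by (simp add: monom_fun_def)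
  then show ?thesis by (simp add: continuous_intros a)
qed

section \<open>Coherent vectors and unitarity of the action\<close>

definition coherent :: "nat \<Rightarrow> complex^2 \<Rightarrow> complex^2 \<Rightarrow> complex" where
  "coherent l b = (\<lambda>z. (b $ 1 * z $ 1 + b $ 2 * z $ 2) ^ (2 * l))"

lemma coherent_expand:
  "coherent l b = (\<lambda>z. \<Sum>k\<le>2 * l. of_nat ((2 * l) choose k) * monom_fun l k b * monom_fun l k z)"
proof
  fix z
  have "coherent l b z = (b $ 2 * z $ 2 + b $ 1 * z $ 1) ^ (2 * l)"
    by (simp add: coherent_def add.commute)
  also have "\<dots> = (\<Sum>k\<le>2 * l. of_nat ((2 * l) choose k) * monom_fun l k b * monom_fun l k z)"
    by (subst binomial_ring) (simp add: monom_fun_def power_mult_distrib ac_simps)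
  finally show "coherent l b z = \<dots>" .
qed

definition cnj_vec :: "complex^2 \<Rightarrow> complex^2" where
  "cnj_vec b = (\<chi> i. cnj (b $ i))"

text \<open>The binomial weights of the inner product cancel those in the expansion of the power.
  Thus coherent vectors are reproducing kernels, with a conjugate because the second argument is
  antilinear.\<close>

lemma sym_inner_coherent:
  assumes "p \<in> Sym l"
  shows "sym_inner l p (coherent l b) = p (cnj_vec b)"
proof -
  have "sym_inner l p (coherent l b) = (\<Sum>k\<le>2 * l. sym_coeff l p k * monom_fun l k (cnj_vec b))"
    unfolding sym_inner_def coherent_expand sym_coeff_eq
    by (intro sum.cong) (auto simp: monom_fun_def cnj_vec_def)
  also have "\<dots> = p (cnj_vec b)" using fun_cong[OF Sym_expand[OF assms], of "cnj_vec b"] by simp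
  finally show ?thesis .
qed

lemma sym_inner_sum_right:
  assumes "\<And>i. i \<in> I \<Longrightarrow> q i \<in> Sym l"
  shows "sym_inner l p (\<lambda>z. \<Sum>i\<in>I. a i * q i z) = (\<Sum>i\<in>I. cnj (a i) * sym_inner l p (q i))"
  using assms
proof (induction I rule: infinite_finite_induct)
  case (insert i I)
  have "sym_inner l (\<lambda>z. a i * q i z + 1 * (\<Sum>i\<in>I. a i * q i z)) p
      = a i * sym_inner l (q i) p + 1 * sym_inner l (\<lambda>z. \<Sum>i\<in>I. a i * q i z) p"
    using insert by (intro sym_inner_lincomb_left Sym_sum) auto
  then have "cnj (sym_inner l (\<lambda>z. a i * q i z + 1 * (\<Sum>i\<in>I. a i * q i z)) p)
      = cnj (a i) * sym_inner l p (q i) + sym_inner l p (\<lambda>z. \<Sum>i\<in>I. a i * q i z)"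
    by (simp add: sym_inner_commute[of l p])
  then show ?case using insert by (simp add: sym_inner_commute[of l p "\<lambda>z. a i * q i z + _ z"])
qed (use Sym_scale(2)[OF Sym_zero, of l 0] in \<open>auto simp: sym_inner_def\<close>)

text \<open>A linear form composed with \<open>A\<close> is a linear form, so coherent vectors go to
  coherent vectors, and against these the claim is the reproducing property. Comparing coefficients
  in their parameter extends it to monomials, hence to all \<open>q\<close>.\<close>

lemma sym_inner_unitary:
  assumes A: "A ** conj_transpose A = mat 1" and p: "p \<in> Sym l" and q: "q \<in> Sym l"
  shows "sym_inner l (\<lambda>z. p (A *v z)) (\<lambda>z. q (A *v z)) = sym_inner l p q"
proof -
  let ?g = "\<lambda>p z. p (A *v z)"
  have key: "sym_inner l (?g p) (?g (coherent l b)) = sym_inner l p (coherent l b)" for b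
  proof -
    have c: "?g (coherent l b) = coherent l (transpose A *v b)"
      by (rule ext)
        (simp add: coherent_def matrix_vector_mult_2 transpose_def algebra_simps)
    have "cnj_vec (transpose A *v b) = conj_transpose A *v cnj_vec b"
      by (simp add: cnj_vec_def vec_eq_iff forall_2 matrix_vector_mult_2 transpose_def conj_transpose_def)
    then have "sym_inner l (?g p) (?g (coherent l b)) = p (A *v (conj_transpose A *v cnj_vec b))"
      unfolding c by (simp add: sym_inner_coherent Sym_matrix p)
    also have "\<dots> = p (cnj_vec b)" by (simp add: matrix_vector_mul_assoc A)
    finally show ?thesis by (simp add: sym_inner_coherent p)
  qed
  have mono: "sym_inner l (?g p) (?g (monom_fun l k)) = sym_inner l p (monom_fun l k)"
    if k: "k \<le> 2 * l" for k
  proof -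
    have "of_nat ((2 * l) choose k) * sym_inner l (?g p) (?g (monom_fun l k))
        = of_nat ((2 * l) choose k) * sym_inner l p (monom_fun l k)"
    proof (rule hom_coeff_unique[OF _ k])
      \<comment> \<open>The antilinear argument would produce conjugates. The parameter
        \<open>cnj_vec z\<close> makes both sides polynomials in \<open>z\<close>, with the
        binomials coming from the coherent expansion.\<close>
      fix z :: "complex^2"
      have c: "cnj (monom_fun l k (cnj_vec z)) = z $ 1 ^ (2 * l - k) * z $ 2 ^ k" for k
        by (simp add: monom_fun_def cnj_vec_def)
      have "?g (coherent l (cnj_vec z)) = (\<lambda>w. \<Sum>k\<le>2 * l.
          (of_nat ((2 * l) choose k) * monom_fun l k (cnj_vec z)) * ?g (monom_fun l k) w)"
        by (simp add: coherent_expand)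
      then have "sym_inner l (?g p) (?g (coherent l (cnj_vec z))) = (\<Sum>k\<le>2 * l.
          cnj (of_nat ((2 * l) choose k) * monom_fun l k (cnj_vec z)) * sym_inner l (?g p) (?g (monom_fun l k)))"
        by (simp only:) (intro sym_inner_sum_right Sym_matrix monom_Sym, simp)
      then have 1: "sym_inner l (?g p) (?g (coherent l (cnj_vec z))) = (\<Sum>k\<le>2 * l.
          of_nat ((2 * l) choose k) * sym_inner l (?g p) (?g (monom_fun l k)) * (z $ 1 ^ (2 * l - k) * z $ 2 ^ k))"
        by (simp add: c mult_ac)
      have 2: "sym_inner l p (coherent l (cnj_vec z)) = (\<Sum>k\<le>2 * l.
          of_nat ((2 * l) choose k) * sym_inner l p (monom_fun l k) * (z $ 1 ^ (2 * l - k) * z $ 2 ^ k))"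
        unfolding coherent_expand
        by (subst sym_inner_sum_right) (simp_all add: monom_Sym c mult_ac)
      show "(\<Sum>k\<le>2 * l.
          of_nat ((2 * l) choose k) * sym_inner l (?g p) (?g (monom_fun l k)) * (z $ 1 ^ (2 * l - k) * z $ 2 ^ k))
        = (\<Sum>k\<le>2 * l.
          of_nat ((2 * l) choose k) * sym_inner l p (monom_fun l k) * (z $ 1 ^ (2 * l - k) * z $ 2 ^ k))"
        using key[of "cnj_vec z"] unfolding 1 2 .
    qed
    then show ?thesis using k by simp
  qed
  have "?g q = (\<lambda>z. \<Sum>k\<le>2 * l. sym_coeff l q k * ?g (monom_fun l k) z)"
    by (subst Sym_expand[OF q]) simp
  then have "sym_inner l (?g p) (?g q)
      = (\<Sum>k\<le>2 * l. cnj (sym_coeff l q k) * sym_inner l (?g p) (?g (monom_fun l k)))"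
    by (simp only:) (intro sym_inner_sum_right Sym_matrix monom_Sym, simp)
  also have "\<dots> = (\<Sum>k\<le>2 * l. cnj (sym_coeff l q k) * sym_inner l p (monom_fun l k))"
    by (simp add: mono)
  also have "\<dots> = sym_inner l p (\<lambda>z. \<Sum>k\<le>2 * l. sym_coeff l q k * monom_fun l k z)"
    by (rule sym_inner_sum_right[symmetric]) (simp add: monom_Sym)
  also have "(\<lambda>z. \<Sum>k\<le>2 * l. sym_coeff l q k * monom_fun l k z) = q"
    using Sym_expand[OF q] by simp
  finally show ?thesis .
qed

section \<open>The double cover of the rotation group\<close>

lemma matrix_mult_2:
  fixes A B :: "'a::comm_semiring_1^2^2"
  shows "(A ** B) $ i $ j = A $ i $ 1 * B $ 1 $ j + A $ i $ 2 * B $ 2 $ j"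
  by (simp add: matrix_matrix_mult_def sum_2)

lemma matrix_eq_2_iff:
  fixes A B :: "'a^2^2"
  shows "A = B \<longleftrightarrow> A $ 1 $ 1 = B $ 1 $ 1 \<and> A $ 1 $ 2 = B $ 1 $ 2 \<and> A $ 2 $ 1 = B $ 2 $ 1 \<and> A $ 2 $ 2 = B $ 2 $ 2"
  by (auto simp: vec_eq_iff forall_2)

lemma conj_transpose_nth [simp]: "conj_transpose A $ i $ j = cnj (A $ j $ i)"
  by (simp add: conj_transpose_def)

lemma conj_transpose_mult: "conj_transpose (A ** B) = conj_transpose B ** conj_transpose A"
  by (simp add: matrix_eq_2_iff matrix_mult_2 mult.commute)

lemma conj_transpose_conj_transpose [simp]: "conj_transpose (conj_transpose A) = A"
  by (simp add: matrix_eq_2_iff)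

lemma det_conj_transpose: "det (conj_transpose A) = cnj (det A)"
  by (simp add: det_2 mult.commute)

lemma SU2_left_inverse: "A \<in> SU2 \<Longrightarrow> conj_transpose A ** A = mat 1"
  by (auto simp: SU2_def matrix_left_right_inverse)

lemma SU2_mult:
  assumes "A \<in> SU2" "B \<in> SU2"
  shows "A ** B \<in> SU2"
proof -
  have "(A ** B) ** conj_transpose (A ** B) = A ** (B ** conj_transpose B) ** conj_transpose A"
    by (simp add: conj_transpose_mult matrix_mul_assoc)
  then show ?thesis using assms by (simp add: SU2_def det_mul)
qed

lemma SU2_conj_transpose: "A \<in> SU2 \<Longrightarrow> conj_transpose A \<in> SU2"
  using SU2_left_inverse[of A] by (simp add: SU2_def det_conj_transpose)

lemma SU2_entries:
  assumes "A \<in> SU2"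
  shows "A $ 2 $ 2 = cnj (A $ 1 $ 1)" "A $ 2 $ 1 = - cnj (A $ 1 $ 2)"
    "A $ 1 $ 1 * cnj (A $ 1 $ 1) + A $ 1 $ 2 * cnj (A $ 1 $ 2) = 1"
proof -
  define a b c d where "a = A $ 1 $ 1" and "b = A $ 1 $ 2" and "c = A $ 2 $ 1" and "d = A $ 2 $ 2"
  have 1: "a * cnj a + b * cnj b = 1" "c * cnj a + d * cnj b = 0" "a * d - b * c = 1"
    using assms by (auto simp: SU2_def matrix_eq_2_iff matrix_mult_2 det_2 mat_def a_def b_def c_def d_def)
  \<comment> \<open>Inserting the determinant, which is \<open>1\<close>, lets the unitarity
    relations be solved for \<open>cnj a\<close>, and below for \<open>cnj b\<close>.\<close>
  have "cnj a = cnj a * (a * d - b * c)" using 1 by simp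
  also have "\<dots> = d * (a * cnj a + b * cnj b) - b * (c * cnj a + d * cnj b)" by algebra
  finally have "cnj a = d" using 1 by simp
  moreover have "cnj b = cnj b * (a * d - b * c)" using 1 by simp
  then have "cnj b = a * (c * cnj a + d * cnj b) - c * (a * cnj a + b * cnj b)" by algebra
  then have "cnj b = - c" using 1 by simp
  ultimately show "A $ 2 $ 2 = cnj (A $ 1 $ 1)" "A $ 2 $ 1 = - cnj (A $ 1 $ 2)"
    "A $ 1 $ 1 * cnj (A $ 1 $ 1) + A $ 1 $ 2 * cnj (A $ 1 $ 2) = 1"
    using 1 by (auto simp: a_def b_def c_def d_def)
qed

lemma SO3_mult: "R \<in> SO3 \<Longrightarrow> S \<in> SO3 \<Longrightarrow> R ** S \<in> SO3"
  by (auto simp: SO3_def rotation_matrix_def orthogonal_matrix_mul det_mul)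

lemma SO3_matrix_inv:
  assumes "R \<in> SO3"
  shows "matrix_inv R = transpose R"
proof -
  have R: "R ** transpose R = mat 1" "transpose R ** R = mat 1"
    using assms by (auto simp: SO3_def rotation_matrix_def orthogonal_matrix_def)
  then have "R ** matrix_inv R = mat 1"
    unfolding matrix_inv_def by (rule_tac someI2[of _ "transpose R"]) auto
  then have "transpose R ** (R ** matrix_inv R) = transpose R" by simp
  then show ?thesis by (simp add: matrix_mul_assoc R)
qed

lemma SO3_inv: "R \<in> SO3 \<Longrightarrow> matrix_inv R \<in> SO3"
  by (simp add: SO3_matrix_inv) (auto simp: SO3_def rotation_matrix_def orthogonal_matrix_def)

lemma SO3_inv_inv: "R \<in> SO3 \<Longrightarrow> matrix_inv (matrix_inv R) = R"
  using SO3_matrix_inv[OF SO3_inv[of R]] by (simp add: SO3_matrix_inv)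

lemma SO3_inv_mult:
  "R \<in> SO3 \<Longrightarrow> S \<in> SO3 \<Longrightarrow> matrix_inv (R ** S) = matrix_inv S ** matrix_inv R"
  by (simp add: SO3_matrix_inv SO3_mult matrix_transpose_mul)

lemma SO3_cancel:
  assumes "R \<in> SO3"
  shows "R ** matrix_inv R = mat 1" "matrix_inv R ** R = mat 1"
  using assms by (auto simp: SO3_matrix_inv, auto simp: SO3_def rotation_matrix_def orthogonal_matrix_def)

lemma covers_mult:
  assumes "covers A R" "covers B S"
  shows "covers (A ** B) (R ** S)"
  unfolding covers_def
proof (intro conjI allI)
  show "A ** B \<in> SU2" using assms by (auto simp: covers_def SU2_mult)
  fix x
  have "A ** B ** pauli x ** conj_transpose (A ** B)
      = A ** (B ** pauli x ** conj_transpose B) ** conj_transpose A"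
    by (simp add: conj_transpose_mult matrix_mul_assoc)
  also have "\<dots> = pauli (R *v (S *v x))" using assms by (simp add: covers_def)
  finally show "A ** B ** pauli x ** conj_transpose (A ** B) = pauli ((R ** S) *v x)"
    by (simp add: matrix_vector_mul_assoc)
qed

lemma covers_inv:
  assumes "covers A R" "R \<in> SO3"
  shows "covers (conj_transpose A) (matrix_inv R)"
  unfolding covers_def
proof (intro conjI allI)
  have A: "A \<in> SU2" using assms by (simp add: covers_def)
  then show "conj_transpose A \<in> SU2" by (rule SU2_conj_transpose)
  fix x
  have "pauli x = pauli (R *v (matrix_inv R *v x))"
    by (simp add: matrix_vector_mul_assoc SO3_cancel assms)
  also have "\<dots> = A ** pauli (matrix_inv R *v x) ** conj_transpose A"
    using assms by (simp add: covers_def)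
  finally have "conj_transpose A ** pauli x ** A
      = (conj_transpose A ** A) ** pauli (matrix_inv R *v x) ** (conj_transpose A ** A)"
    by (simp add: matrix_mul_assoc)
  then show "conj_transpose A ** pauli x ** conj_transpose (conj_transpose A) = pauli (matrix_inv R *v x)"
    by (simp add: SU2_left_inverse A)
qed

lemma pauli_nth [simp]:
  "pauli x $ 1 $ 1 = Complex (x $ 3) 0" "pauli x $ 1 $ 2 = Complex (x $ 1) (- (x $ 2))"
  "pauli x $ 2 $ 1 = Complex (x $ 1) (x $ 2)" "pauli x $ 2 $ 2 = Complex (- (x $ 3)) 0"
  by (simp_all add: pauli_def)

text \<open>The upper right entries of the images of the three coordinate vectors are, up to
  constants, \<open>a^2 - b^2\<close>, \<open>a^2 + b^2\<close> and \<open>a b\<close>. They fix the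
  first row \<open>(a, b)\<close> up to a common sign, and the first row determines the
  matrix.\<close>

lemma covers_unique:
  assumes "covers A R" "covers B R"
  shows "B = A \<or> B = - A"
proof -
  have SU: "A \<in> SU2" "B \<in> SU2" using assms by (auto simp: covers_def)
  define a b p q where "a = A $ 1 $ 1" and "b = A $ 1 $ 2" and "p = B $ 1 $ 1" and "q = B $ 1 $ 2"
  note A = SU2_entries[OF SU(1), folded a_def b_def]
  note B = SU2_entries[OF SU(2), folded p_def q_def]
  have eq: "(A ** pauli x ** conj_transpose A) $ 1 $ 2 = (B ** pauli x ** conj_transpose B) $ 1 $ 2" for x
    using assms by (simp add: covers_def)
  have C: "Complex 0 1 = \<i>" "Complex 0 (- 1) = - \<i>" "Complex 1 0 = 1" "Complex (-1) 0 = -1" "Complex 0 0 = 0"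
    by (simp_all add: complex_eq_iff)
  have "a * a - b * b = p * p - q * q"
    using eq[of "vector [1, 0, 0]"] A B
    by (simp add: matrix_mult_2 C a_def[symmetric] b_def[symmetric] p_def[symmetric] q_def[symmetric])
  moreover have "\<i> * (p * p) + \<i> * (q * q) = \<i> * (a * a) + \<i> * (b * b)"
    using eq[of "vector [0, 1, 0]"] A B
    by (simp add: matrix_mult_2 C a_def[symmetric] b_def[symmetric] p_def[symmetric] q_def[symmetric])
      (simp add: algebra_simps)
  then have "\<i> * (p * p + q * q) = \<i> * (a * a + b * b)" by (simp only: distrib_left)
  then have "p * p + q * q = a * a + b * b" by simp
  ultimately have sq: "a * a = p * p" "b * b = q * q" by algebra+
  have ab: "a * b = p * q"
    using eq[of "vector [0, 0, 1]"] A B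
    by (simp add: matrix_mult_2 C a_def[symmetric] b_def[symmetric] p_def[symmetric] q_def[symmetric])
  have "(p = a \<and> q = b) \<or> (p = - a \<and> q = - b)"
    using sq ab by (auto simp: square_eq_iff)
  then show ?thesis
    using A B by (auto simp: matrix_eq_2_iff a_def b_def p_def q_def)
qed

lemma Sym_even:
  assumes "p \<in> Sym l"
  shows "p (- z) = p z"
proof -
  have "monom_fun l k (- z) = monom_fun l k z" if "k \<le> 2 * l" for k
  proof -
    have "monom_fun l k (- z) = (-1) ^ (2 * l - k + k) * monom_fun l k z"
      unfolding power_add by (simp add: monom_fun_def power_minus[of "z $ _"])
    then show ?thesis using that by simp
  qed
  then show ?thesis
    using fun_cong[OF Sym_expand[OF assms], of "- z"] fun_cong[OF Sym_expand[OF assms], of z] by simp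
qed

text \<open>The chosen lift is \<open>A\<close> or \<open>- A\<close>, and elements of
  \<open>Sym l\<close> are even, so the choice in \<open>rot_act\<close> can be replaced by any
  convenient lift.\<close>

lemma rot_act_eq:
  assumes "covers A R" "p \<in> Sym l"
  shows "rot_act R p = (\<lambda>z. p (conj_transpose A *v z))"
proof
  fix z
  define B where "B = (SOME B. covers B R)"
  have "covers B R" unfolding B_def using assms(1) by (rule someI)
  then have "B = A \<or> B = - A" using covers_unique assms(1) by blast
  moreover have "conj_transpose (- A) *v z = - (conj_transpose A *v z)"
    by (simp add: vec_eq_iff forall_2 matrix_vector_mult_2)
  ultimately show "rot_act R p z = p (conj_transpose A *v z)"
    unfolding rot_act_def B_def[symmetric] using Sym_even[OF assms(2)] by auto
qed

lemma rot_act_Sym: "p \<in> Sym l \<Longrightarrow> rot_act R p \<in> Sym l"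
  unfolding rot_act_def by (rule Sym_matrix)

section \<open>Existence of lifts to SU(2)\<close>

definition rot_z :: "real \<Rightarrow> real \<Rightarrow> real^3^3" where
  "rot_z c s = vector [vector [c, s, 0], vector [- s, c, 0], vector [0, 0, 1]]"

definition rot_y :: "real \<Rightarrow> real \<Rightarrow> real^3^3" where
  "rot_y c s = vector [vector [c, 0, s], vector [0, 1, 0], vector [- s, 0, c]]"

lemma rot_SO3:
  assumes "c\<^sup>2 + s\<^sup>2 = 1"
  shows "rot_z c s \<in> SO3" "rot_y c s \<in> SO3"
  using assms unfolding SO3_def rotation_matrix_def orthogonal_matrix
  by (simp_all add: rot_z_def rot_y_def det_3 vec_eq_iff forall_3 matrix_matrix_mult_def
      transpose_def sum_3 mat_def power2_eq_square algebra_simps)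

definition torus_SU2 :: "complex \<Rightarrow> complex^2^2" where
  "torus_SU2 \<eta> = vector [vector [\<eta>, 0], vector [0, cnj \<eta>]]"

definition real_SU2 :: "real \<Rightarrow> real \<Rightarrow> complex^2^2" where
  "real_SU2 c s = vector [vector [of_real c, - of_real s], vector [of_real s, of_real c]]"

text \<open>Conjugation multiplies the upper right entry of \<open>pauli x\<close> by
  \<open>\<eta>\<^sup>2\<close>. This is the origin of the doubled angle and of the sign of
  \<open>s\<close> in \<open>rot_z\<close>.\<close>

lemma covers_rot_z:
  assumes "cmod \<eta> = 1"
  shows "covers (torus_SU2 \<eta>) (rot_z (Re (\<eta>\<^sup>2)) (Im (\<eta>\<^sup>2)))"
proof -
  have n: "(Re \<eta>)\<^sup>2 + (Im \<eta>)\<^sup>2 = 1" using assms by (simp add: cmod_def)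
  then have 1: "\<eta> * cnj \<eta> = 1" by (simp add: complex_mult_cnj)
  show ?thesis
    unfolding covers_def SU2_def
  proof (intro conjI allI CollectI)
    show "torus_SU2 \<eta> ** conj_transpose (torus_SU2 \<eta>) = mat 1" "det (torus_SU2 \<eta>) = 1"
      using 1 by (simp_all add: matrix_eq_2_iff matrix_mult_2 torus_SU2_def det_2 mat_def mult.commute)
    show "torus_SU2 \<eta> ** pauli x ** conj_transpose (torus_SU2 \<eta>) = pauli (rot_z (Re (\<eta>\<^sup>2)) (Im (\<eta>\<^sup>2)) *v x)" for x
      using n
      by (simp add: matrix_eq_2_iff matrix_mult_2 torus_SU2_def rot_z_def matrix_vector_mult_def sum_3
          complex_eq_iff power2_eq_square) algebra
  qed
qed

lemma covers_rot_y:
  assumes "c\<^sup>2 + s\<^sup>2 = 1"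
  shows "covers (real_SU2 c s) (rot_y (c\<^sup>2 - s\<^sup>2) (2 * c * s))"
  unfolding covers_def SU2_def
proof (intro conjI allI CollectI)
  show "real_SU2 c s ** conj_transpose (real_SU2 c s) = mat 1" "det (real_SU2 c s) = 1"
    using assms by (simp_all add: matrix_eq_2_iff matrix_mult_2 real_SU2_def det_2 mat_def
        complex_eq_iff power2_eq_square add.commute)
  show "real_SU2 c s ** pauli x ** conj_transpose (real_SU2 c s) = pauli (rot_y (c\<^sup>2 - s\<^sup>2) (2 * c * s) *v x)" for x
    using assms
    by (simp add: matrix_eq_2_iff matrix_mult_2 real_SU2_def rot_y_def matrix_vector_mult_def sum_3
        complex_eq_iff power2_eq_square) algebra
qed

text \<open>Half angles: the covering doubles angles, so a lift of a rotation needs a square root on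
  the unit circle.\<close>

lemma unit_square_root:
  assumes "c\<^sup>2 + s\<^sup>2 = (1::real)"
  obtains \<eta> where "cmod \<eta> = 1" "Re (\<eta>\<^sup>2) = c" "Im (\<eta>\<^sup>2) = s"
proof -
  let ?z = "Complex c s"
  have "(cmod (csqrt ?z))\<^sup>2 = cmod ((csqrt ?z)\<^sup>2)" by (simp only: norm_power)
  also have "\<dots> = 1" using assms by (simp add: cmod_def)
  finally have "cmod (csqrt ?z) = 1" by (simp add: power2_eq_1_iff)
  then show ?thesis using that[of "csqrt ?z"] by simp
qed

lemma ex_covers_rot_z: "c\<^sup>2 + s\<^sup>2 = 1 \<Longrightarrow> \<exists>A. covers A (rot_z c s)"
  using unit_square_root[of c s] covers_rot_z by metis

lemma ex_covers_rot_y: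
  assumes "c\<^sup>2 + s\<^sup>2 = 1"
  shows "\<exists>A. covers A (rot_y c s)"
proof -
  obtain \<eta> where \<eta>: "cmod \<eta> = 1" "Re (\<eta>\<^sup>2) = c" "Im (\<eta>\<^sup>2) = s" by (rule unit_square_root[OF assms])
  have "(Re \<eta>)\<^sup>2 + (Im \<eta>)\<^sup>2 = 1" using \<eta>(1) by (simp add: cmod_def)
  from covers_rot_y[OF this] show ?thesis
    using \<eta>(2,3) by (auto simp: power2_eq_square mult.commute mult.left_commute)
qed

text \<open>By Euler angles: a rotation about \<open>e\<^sub>3\<close> remains after moving \<open>R e\<^sub>3\<close> back to \<open>e\<^sub>3\<close>.\<close>

lemma ex_covers:
  assumes R: "R \<in> SO3"
  shows "\<exists>A. covers A R"
proof -
  define n where "n = column 3 R"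
  have RR: "transpose R ** R = mat 1" "R ** transpose R = mat 1"
    using R by (auto simp: SO3_def rotation_matrix_def orthogonal_matrix_def)
  have "(transpose R ** R) $ 3 $ 3 = 1" by (simp add: RR mat_def)
  then have n: "(n $ 1)\<^sup>2 + (n $ 2)\<^sup>2 + (n $ 3)\<^sup>2 = 1"
    by (simp add: matrix_matrix_mult_def transpose_def sum_3 n_def column_def power2_eq_square)
  define r where "r = sqrt ((n $ 1)\<^sup>2 + (n $ 2)\<^sup>2)"
  have r: "r\<^sup>2 = (n $ 1)\<^sup>2 + (n $ 2)\<^sup>2" by (simp add: r_def)
  \<comment> \<open>Polar coordinates of the horizontal part of \<open>n\<close>, with the sign of
    \<open>s\<close> dictated by \<open>rot_z\<close>. If \<open>n\<close> lies on the vertical axis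
    every direction will do, and \<open>(1, 0)\<close> is taken.\<close>
  obtain c s where cs: "c\<^sup>2 + s\<^sup>2 = 1" "n $ 1 = r * c" "n $ 2 = - r * s"
  proof (cases "r = 0")
    case True
    then have "n $ 1 = 0" "n $ 2 = 0" using r by (auto simp: sum_power2_eq_zero_iff)
    then show ?thesis using that[of 1 0] True by simp
  next
    case False
    have "(n $ 1 / r)\<^sup>2 + (- n $ 2 / r)\<^sup>2 = r\<^sup>2 / r\<^sup>2"
      by (simp only: power_divide add_divide_distrib[symmetric] power2_minus) (simp only: r)
    then show ?thesis using that[of "n $ 1 / r" "- n $ 2 / r"] False by simp
  qed
  define P where "P = rot_z c s ** rot_y (n $ 3) r"
  have nr: "(n $ 3)\<^sup>2 + r\<^sup>2 = 1" using n r by simp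
  have P: "P \<in> SO3" unfolding P_def by (intro SO3_mult rot_SO3 cs nr)
  obtain A B where AB: "covers A (rot_z c s)" "covers B (rot_y (n $ 3) r)"
    using ex_covers_rot_z[OF cs(1)] ex_covers_rot_y[OF nr] by blast
  then have cP: "covers (A ** B) P" unfolding P_def by (rule covers_mult)
  have col: "column 3 P = n"
    unfolding P_def using cs
    by (simp add: vec_eq_iff forall_3 column_def matrix_matrix_mult_def sum_3 rot_z_def rot_y_def)
  define S where "S = matrix_inv P ** R"
  have S: "S \<in> SO3" unfolding S_def by (intro SO3_mult SO3_inv P R)
  have PS: "R = P ** S" by (simp add: S_def matrix_mul_assoc SO3_cancel P)
  \<comment> \<open>\<open>P\<close> and \<open>R\<close> agree on the third basis vector, so
    \<open>S\<close> fixes it.\<close>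
  have c3: "S $ i $ 3 = (if i = 3 then 1 else 0)" for i
  proof -
    have "column 3 S = matrix_inv P *v column 3 P"
      unfolding S_def col n_def
      by (simp add: vec_eq_iff column_def matrix_matrix_mult_def matrix_vector_mult_def)
    also have "column 3 P = P *v axis 3 1" by (simp add: matrix_vector_mult_basis)
    also have "matrix_inv P *v (P *v axis 3 1) = axis 3 1"
      by (simp add: matrix_vector_mul_assoc SO3_cancel P)
    finally show ?thesis by (auto simp: vec_eq_iff column_def axis_def)
  qed
  have SS: "transpose S ** S = mat 1" "S ** transpose S = mat 1" "det S = 1"
    using S by (auto simp: SO3_def rotation_matrix_def orthogonal_matrix_def)
  have r33: "(S ** transpose S) $ 3 $ 3 = 1" by (simp add: SS mat_def)
  then have "(S $ 3 $ 1)\<^sup>2 + (S $ 3 $ 2)\<^sup>2 = 0"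
    by (simp add: matrix_matrix_mult_def transpose_def sum_3 c3 power2_eq_square)
  then have r3: "S $ 3 $ 1 = 0" "S $ 3 $ 2 = 0" by (auto simp: sum_power2_eq_zero_iff)
  define p q u v where "p = S $ 1 $ 1" and "q = S $ 1 $ 2" and "u = S $ 2 $ 1" and "v = S $ 2 $ 2"
  have "(S ** transpose S) $ 1 $ 1 = 1" "(S ** transpose S) $ 1 $ 2 = 0" by (simp_all add: SS mat_def)
  then have pq: "p * p + q * q = 1" "p * u + q * v = 0"
    by (simp_all add: matrix_matrix_mult_def transpose_def sum_3 c3 p_def q_def u_def v_def)
  have "p * v - q * u = 1" using SS(3) by (simp add: det_3 c3 r3 p_def q_def u_def v_def)
  then have "v = p" "u = - q" using pq by algebra+
  then have "S = rot_z p q"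
    by (simp add: vec_eq_iff forall_3 rot_z_def c3 r3 p_def[symmetric] q_def[symmetric] u_def[symmetric] v_def[symmetric])
  moreover have "p\<^sup>2 + q\<^sup>2 = 1" using pq by (simp add: power2_eq_square)
  ultimately obtain C where "covers C S" using ex_covers_rot_z by blast
  then have "covers (A ** B ** C) R" unfolding PS by (rule covers_mult[OF cP])
  then show ?thesis by blast
qed

lemma rot_act_mult:
  assumes "R \<in> SO3" "S \<in> SO3" "p \<in> Sym l"
  shows "rot_act (R ** S) p = rot_act R (rot_act S p)"
proof -
  obtain A B where A: "covers A R" and B: "covers B S" using ex_covers assms by metis
  show ?thesis
    unfolding rot_act_eq[OF covers_mult[OF A B] assms(3)] rot_act_eq[OF B assms(3)]
      rot_act_eq[OF A Sym_matrix[OF assms(3)]]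
    by (simp add: conj_transpose_mult matrix_vector_mul_assoc)
qed

lemma sym_inner_rot_act:
  assumes "R \<in> SO3" "p \<in> Sym l" "q \<in> Sym l"
  shows "sym_inner l (rot_act R p) (rot_act R q) = sym_inner l p q"
proof -
  obtain A where A: "covers A R" using ex_covers assms by metis
  have "conj_transpose A ** conj_transpose (conj_transpose A) = mat 1"
    using A by (simp add: covers_def SU2_left_inverse)
  then show ?thesis
    unfolding rot_act_eq[OF A assms(2)] rot_act_eq[OF A assms(3)] by (intro sym_inner_unitary assms)
qed

section \<open>Compactness of the covering and continuity of matrix coefficients\<close>

lemma norm_matrix_le:
  fixes A :: "'a::real_normed_vector^'n^'m"
  assumes "\<And>i j. norm (A $ i $ j) \<le> 1"
  shows "norm A \<le> real (CARD('m) * CARD('n))"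
proof -
  have "norm A \<le> (\<Sum>i\<in>UNIV. norm (A $ i))" unfolding norm_vec_def[of A] by (rule L2_set_le_sum) simp
  also have "\<dots> \<le> (\<Sum>i\<in>UNIV. \<Sum>j\<in>UNIV. norm (A $ i $ j))"
    by (intro sum_mono) (simp add: norm_vec_def[of "A $ _"] L2_set_le_sum)
  also have "\<dots> \<le> (\<Sum>i\<in>(UNIV::'m set). \<Sum>j\<in>(UNIV::'n set). 1)" by (intro sum_mono assms)
  finally show ?thesis by simp
qed

lemma continuous_on_matrix_mult [continuous_intros]:
  fixes f :: "'a::topological_space \<Rightarrow> 'b::{real_normed_algebra,semiring_1}^'n^'m"
  assumes "continuous_on X f" "continuous_on X g"
  shows "continuous_on X (\<lambda>x. f x ** g x)"
  unfolding matrix_matrix_mult_def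
  by (intro continuous_on_vec_lambda continuous_on_sum continuous_on_mult continuous_on_component assms)

lemma continuous_on_conj_transpose [continuous_intros]:
  assumes "continuous_on X f"
  shows "continuous_on X (\<lambda>x. conj_transpose (f x))"
  unfolding conj_transpose_def
  by (intro continuous_on_vec_lambda continuous_on_cnj continuous_on_component assms)

lemma continuous_on_transpose [continuous_intros]:
  assumes "continuous_on X f"
  shows "continuous_on X (\<lambda>x. transpose (f x))"
  unfolding transpose_def by (intro continuous_on_vec_lambda continuous_on_component assms)

text \<open>All conditions are closed and all entries have modulus at most \<open>1\<close>; the
  radii \<open>4\<close> and \<open>9\<close> are the numbers of entries. Compactness of the graph
  is what allows closed sets to be projected to \<open>SO3\<close>.\<close>

lemma compact_covers: "compact {(A, R). covers A R \<and> R \<in> SO3}"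
  unfolding compact_eq_bounded_closed
proof
  have A_le: "norm A \<le> 4" if "A \<in> SU2" for A
  proof -
    have "of_real ((cmod (A $ 1 $ 1))\<^sup>2 + (cmod (A $ 1 $ 2))\<^sup>2) = (1::complex)"
      using SU2_entries(3)[OF that] by (simp add: complex_norm_square del: of_real_power)
    then have s: "(cmod (A $ 1 $ 1))\<^sup>2 + (cmod (A $ 1 $ 2))\<^sup>2 = 1" by (simp only: of_real_eq_1_iff)
    have "(cmod (A $ 1 $ 1))\<^sup>2 \<le> 1\<^sup>2" "(cmod (A $ 1 $ 2))\<^sup>2 \<le> 1\<^sup>2"
      unfolding power_one
      using s zero_le_power2[of "cmod (A $ 1 $ 1)"] zero_le_power2[of "cmod (A $ 1 $ 2)"] by linarith+
    then have "cmod (A $ 1 $ 1) \<le> 1" "cmod (A $ 1 $ 2) \<le> 1" by (auto intro: power2_le_imp_le)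
    then have "norm (A $ i $ j) \<le> 1" for i j
      using SU2_entries(1,2)[OF that] exhaust_2[of i] exhaust_2[of j] by auto
    from norm_matrix_le[OF this] show ?thesis by simp
  qed
  have R_le: "norm R \<le> 9" if "R \<in> SO3" for R
  proof -
    have "norm (R $ i $ j) \<le> 1" for i j
    proof -
      have "(R ** transpose R) $ i $ i = 1"
        using that by (auto simp: SO3_def rotation_matrix_def orthogonal_matrix_def mat_def)
      then have s: "(\<Sum>j\<in>UNIV. (R $ i $ j)\<^sup>2) = 1"
        by (simp add: matrix_matrix_mult_def transpose_def power2_eq_square)
      have "(R $ i $ j)\<^sup>2 \<le> 1" unfolding s[symmetric] by (rule member_le_sum) auto
      then show ?thesis by (simp add: abs_square_le_1)
    qed
    from norm_matrix_le[OF this] show ?thesis by simp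
  qed
  show "bounded {(A, R). covers A R \<and> R \<in> SO3}"
  proof (rule bounded_subset)
    show "bounded (cball (0::complex^2^2) 4 \<times> cball (0::real^3^3) 9)"
      by (intro bounded_Times bounded_cball)
    show "{(A, R). covers A R \<and> R \<in> SO3} \<subseteq> cball (0::complex^2^2) 4 \<times> cball (0::real^3^3) 9"
      using A_le R_le by (auto simp: covers_def)
  qed
  have cont: "continuous_on UNIV (\<lambda>p::(complex^2^2) \<times> (real^3^3). pauli (snd p *v x))" for x
  proof -
    have "continuous_on UNIV (\<lambda>p::(complex^2^2) \<times> (real^3^3). pauli (snd p *v x) $ i $ j)" for i j
      using exhaust_2[of i] exhaust_2[of j]
      by (elim disjE; simp add: matrix_vector_mult_def; intro continuous_intros)
    then have "continuous_on UNIV (\<lambda>p::(complex^2^2) \<times> (real^3^3). \<chi> i j. pauli (snd p *v x) $ i $ j)"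
      by (intro continuous_on_vec_lambda)
    then show ?thesis by simp
  qed
  have "closed {p::(complex^2^2) \<times> (real^3^3).
      fst p ** conj_transpose (fst p) = mat 1 \<and> det (fst p) = 1 \<and>
      (\<forall>x. fst p ** pauli x ** conj_transpose (fst p) = pauli (snd p *v x)) \<and>
      transpose (snd p) ** snd p = mat 1 \<and> det (snd p) = 1}"
    unfolding det_2 det_3
    by (intro closed_Collect_conj closed_Collect_all closed_Collect_eq cont continuous_intros)
  also have "{p::(complex^2^2) \<times> (real^3^3).
      fst p ** conj_transpose (fst p) = mat 1 \<and> det (fst p) = 1 \<and>
      (\<forall>x. fst p ** pauli x ** conj_transpose (fst p) = pauli (snd p *v x)) \<and>
      transpose (snd p) ** snd p = mat 1 \<and> det (snd p) = 1} = {(A, R). covers A R \<and> R \<in> SO3}"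
    by (auto simp: covers_def SU2_def SO3_def rotation_matrix_def orthogonal_matrix)
  finally show "closed {(A, R). covers A R \<and> R \<in> SO3}" .
qed

text \<open>
  The section \<open>SO(3) \<rightarrow> SU(2)\<close> chosen in \<open>rot_act\<close> is discontinuous; the matrix
  coefficients are nevertheless continuous because \<open>SO(3)\<close> is a compact quotient of \<open>SU(2)\<close>.
\<close>

lemma continuous_on_matrix_coeff:
  assumes p: "p \<in> Sym l" and \<phi>: "\<phi> \<in> sym_dual l"
  shows "continuous_on SO3 (\<lambda>R. \<phi> (rot_act (matrix_inv R) p))"
proof -
  define F where "F = (\<lambda>A. \<phi> (\<lambda>z. p (A *v z)))"
  let ?f = "\<lambda>R. \<phi> (rot_act (matrix_inv R) p)"
  let ?K = "{(A, R). covers A R \<and> R \<in> SO3}"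
  have F: "continuous_on UNIV F"
    unfolding F_def by (rule continuous_on_dual_hom_family[OF hom_family_matrix[OF p] \<phi>])
  have f: "?f R = F A" if "covers A R" "R \<in> SO3" for A R
    unfolding F_def rot_act_eq[OF covers_inv[OF that] p] by simp
  show ?thesis
    unfolding continuous_on_closed_invariant
  proof (intro allI impI)
    fix B :: "complex set" assume "closed B"
    then have "closed (F -` B)" using F by (simp add: closed_vimage)
    then have "closed (F -` B \<times> (UNIV :: (real^3^3) set))" by (intro closed_Times closed_UNIV)
    then have "compact (?K \<inter> (F -` B \<times> UNIV))" using compact_covers by (rule compact_Int_closed[rotated])
    then have "compact (snd ` (?K \<inter> (F -` B \<times> UNIV)))"
      by (intro compact_continuous_image continuous_on_snd continuous_on_id)
    moreover have "snd ` (?K \<inter> (F -` B \<times> UNIV)) \<inter> SO3 = ?f -` B \<inter> SO3"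
    proof
      show "?f -` B \<inter> SO3 \<subseteq> snd ` (?K \<inter> (F -` B \<times> UNIV)) \<inter> SO3"
      proof
        fix R assume R: "R \<in> ?f -` B \<inter> SO3"
        then obtain A where "covers A R" using ex_covers by blast
        then have "(A, R) \<in> ?K \<inter> (F -` B \<times> UNIV)" using R f by auto
        then show "R \<in> snd ` (?K \<inter> (F -` B \<times> UNIV)) \<inter> SO3" using R by force
      qed
    qed (auto simp: f)
    ultimately show "\<exists>C. closed C \<and> C \<inter> SO3 = ?f -` B \<inter> SO3"
      using compact_imp_closed by blast
  qed
qed

section \<open>Schur orthogonality\<close>

text \<open>The difference would have infinitely many roots. Positive reals are the right test set
  because \<open>x\<close> will be the square of a positive \<open>t\<close> whose power is divided
  out.\<close>

lemma complex_polynomial_unique: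
  fixes a b :: "nat \<Rightarrow> complex"
  assumes "\<And>x::real. x > 0 \<Longrightarrow> (\<Sum>k\<le>n. a k * of_real x ^ k) = (\<Sum>k\<le>n. b k * of_real x ^ k)"
    and "k \<le> n"
  shows "a k = b k"
proof (rule ccontr)
  assume "a k \<noteq> b k"
  then have "finite {z. (\<Sum>k\<le>n. (a k - b k) * z ^ k) = 0}"
    using assms(2) polyfun_roots_finite[of "\<lambda>k. a k - b k" k n] by simp
  moreover have "complex_of_real ` {0<..} \<subseteq> {z. (\<Sum>k\<le>n. (a k - b k) * z ^ k) = 0}"
    using assms(1) by (auto simp: left_diff_distrib sum_subtractf)
  ultimately have "finite (complex_of_real ` {0<..})" by (rule finite_subset[rotated])
  then have "finite {(0::real)<..}" by (rule finite_imageD) (simp add: inj_on_def)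
  then show False by (simp add: infinite_Ioi)
qed

definition matrix_coeff ::
    "((complex^2 \<Rightarrow> complex) \<Rightarrow> complex) \<Rightarrow> (complex^2 \<Rightarrow> complex) \<Rightarrow> real^3^3 \<Rightarrow> complex" where
  "matrix_coeff \<phi> v = (\<lambda>g. \<phi> (rot_act (matrix_inv g) v))"

lemma compact_SO3: "compact SO3"
proof -
  have "compact (snd ` {(A, R). covers A R \<and> R \<in> SO3})"
    by (intro compact_continuous_image compact_covers continuous_on_snd continuous_on_id)
  also have "snd ` {(A, R). covers A R \<and> R \<in> SO3} = SO3"
    using ex_covers by (force simp: image_iff)
  finally show ?thesis .
qed

lemma matrix_coeff_sum:
  assumes "\<phi> \<in> sym_dual l" "\<And>i. i \<in> I \<Longrightarrow> p i \<in> Sym l"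
  shows "matrix_coeff \<phi> (\<lambda>z. \<Sum>i\<in>I. a i * p i z) = (\<lambda>g. \<Sum>i\<in>I. a i * matrix_coeff \<phi> (p i) g)"
proof
  fix g
  have "rot_act (matrix_inv g) (\<lambda>z. \<Sum>i\<in>I. a i * p i z) = (\<lambda>z. \<Sum>i\<in>I. a i * rot_act (matrix_inv g) (p i) z)"
    by (simp add: rot_act_def)
  then show "matrix_coeff \<phi> (\<lambda>z. \<Sum>i\<in>I. a i * p i z) g = (\<Sum>i\<in>I. a i * matrix_coeff \<phi> (p i) g)"
    unfolding matrix_coeff_def using assms
    by (simp add: sym_dual_sum[OF assms(1), of I "\<lambda>i. rot_act (matrix_inv g) (p i)" a] rot_act_Sym)
qed

lemma matrix_coeff_scale:
  assumes "\<phi> \<in> sym_dual l" "p \<in> Sym l"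
  shows "matrix_coeff \<phi> (\<lambda>z. a * p z) = (\<lambda>g. a * matrix_coeff \<phi> p g)"
  using matrix_coeff_sum[OF assms(1), of "{()}" "\<lambda>_. p" "\<lambda>_. a"] assms(2) by simp

lemma matrix_coeff_rot_act:
  assumes "h \<in> SO3" "g \<in> SO3" "v \<in> Sym l"
  shows "matrix_coeff \<phi> (rot_act h v) g = matrix_coeff \<phi> v (matrix_inv h ** g)"
  using assms by (simp add: matrix_coeff_def SO3_inv_mult SO3_inv SO3_inv_inv rot_act_mult)

section \<open>Invariance of the pairing of matrix coefficients\<close>

locale haar_SO3 =
  fixes \<mu> :: "(real^3^3) measure"
  assumes haar: "haar_prob_SO3 \<mu>"
begin

sublocale prob_space \<mu> using haar by (simp add: haar_prob_SO3_def)

lemma space_haar: "space \<mu> = SO3" and sets_haar: "sets \<mu> = sets (restrict_space borel SO3)"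
  using haar by (auto simp: haar_prob_SO3_def)

lemma continuous_on_measurable:
  fixes f :: "real^3^3 \<Rightarrow> complex"
  assumes "continuous_on SO3 f"
  shows "f \<in> borel_measurable \<mu>"
  using borel_measurable_continuous_on_restrict[OF assms] measurable_cong_sets[OF sets_haar refl] by auto

lemma left_mult_measurable:
  assumes "h \<in> SO3"
  shows "(\<lambda>g. h ** g) \<in> measurable \<mu> \<mu>"
proof -
  have "(\<lambda>g. h ** g) \<in> borel_measurable (restrict_space borel SO3)"
    by (intro borel_measurable_continuous_on_restrict continuous_intros continuous_on_id continuous_on_const)
  then have "(\<lambda>g. h ** g) \<in> measurable (restrict_space borel SO3) (restrict_space borel SO3)"
    using assms by (intro measurable_restrict_space2) (auto simp: space_restrict_space SO3_mult)
  then show ?thesis using measurable_cong_sets[OF sets_haar sets_haar] by simp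
qed

lemma integral_left_mult:
  fixes f :: "real^3^3 \<Rightarrow> 'b::{banach, second_countable_topology}"
  assumes "h \<in> SO3" "f \<in> borel_measurable \<mu>"
  shows "(LINT g|\<mu>. f (h ** g)) = (LINT g|\<mu>. f g)"
proof -
  have "distr \<mu> \<mu> (\<lambda>g. h ** g) = \<mu>" using haar assms by (simp add: haar_prob_SO3_def)
  then show ?thesis using integral_distr[OF left_mult_measurable[OF assms(1)] assms(2)] by simp
qed

lemma left_regular_L2:
  assumes h: "h \<in> SO3" and f: "f \<in> L2 \<mu>"
  shows "left_regular h f \<in> L2 \<mu>"
proof -
  have h': "matrix_inv h \<in> SO3" by (rule SO3_inv[OF h])
  have "integrable \<mu> (\<lambda>g. (cmod (f (matrix_inv h ** g)))\<^sup>2)"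
    using integrable_distr[OF left_mult_measurable[OF h'], of "\<lambda>g. (cmod (f g))\<^sup>2"] haar h' L2_integrable[OF f]
    by (simp add: haar_prob_SO3_def)
  moreover have "(\<lambda>g. f (matrix_inv h ** g)) \<in> borel_measurable \<mu>"
    by (rule measurable_compose[OF left_mult_measurable[OF h'] L2_measurable[OF f]])
  ultimately show ?thesis by (simp add: L2_def left_regular_def)
qed

lemma left_regular_inner:
  assumes h: "h \<in> SO3" and fg: "f \<in> L2 \<mu>" "g \<in> L2 \<mu>"
  shows "l2_inner \<mu> (left_regular h f) (left_regular h g) = l2_inner \<mu> f g"
  unfolding l2_inner_def left_regular_def
  by (rule integral_left_mult[OF SO3_inv[OF h], of "\<lambda>x. f x * cnj (g x)"])
    (intro borel_measurable_times borel_measurable_cnj L2_measurable fg)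

lemma matrix_coeff_L2:
  assumes "\<phi> \<in> sym_dual l" "v \<in> Sym l"
  shows "matrix_coeff \<phi> v \<in> L2 \<mu>"
proof -
  have c: "continuous_on SO3 (matrix_coeff \<phi> v)"
    unfolding matrix_coeff_def by (rule continuous_on_matrix_coeff[OF assms(2,1)])
  have "bounded (matrix_coeff \<phi> v ` SO3)"
    by (intro compact_imp_bounded compact_continuous_image c compact_SO3)
  then obtain B where "\<And>x. x \<in> SO3 \<Longrightarrow> cmod (matrix_coeff \<phi> v x) \<le> B" by (auto simp: bounded_iff)
  then show ?thesis
    by (intro bounded_L2(1)[of _ B] continuous_on_measurable[OF c]) (simp_all add: space_haar)
qed

text \<open>Left translation of a matrix coefficient moves its vector, so invariance of the measure
  becomes invariance of a sesquilinear form in \<open>(v, v')\<close>. Two levels \<open>l\<close>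
  and \<open>l'\<close> occur because orthogonality between levels comes from the same
  identity.\<close>

lemma matrix_coeff_invariant:
  assumes "h \<in> SO3" "\<phi> \<in> sym_dual l" "v \<in> Sym l" "\<phi>' \<in> sym_dual l'" "v' \<in> Sym l'"
  shows "l2_inner \<mu> (matrix_coeff \<phi> (rot_act h v)) (matrix_coeff \<phi>' (rot_act h v'))
    = l2_inner \<mu> (matrix_coeff \<phi> v) (matrix_coeff \<phi>' v')"
proof -
  have "l2_inner \<mu> (matrix_coeff \<phi> (rot_act h v)) (matrix_coeff \<phi>' (rot_act h v'))
      = l2_inner \<mu> (left_regular h (matrix_coeff \<phi> v)) (left_regular h (matrix_coeff \<phi>' v'))"
    using assms by (intro l2_inner_cong_space) (simp_all add: left_regular_def space_haar matrix_coeff_rot_act)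
  also have "\<dots> = l2_inner \<mu> (matrix_coeff \<phi> v) (matrix_coeff \<phi>' v')"
    by (rule left_regular_inner[OF assms(1) matrix_coeff_L2[OF assms(2,3)] matrix_coeff_L2[OF assms(4,5)]])
  finally show ?thesis .
qed

lemma matrix_coeff_expand:
  assumes "\<phi> \<in> sym_dual l" "\<phi>' \<in> sym_dual l'"
  shows "l2_inner \<mu> (matrix_coeff \<phi> (\<lambda>z. \<Sum>k\<le>2 * l. a k * monom_fun l k z))
      (matrix_coeff \<phi>' (\<lambda>z. \<Sum>k\<le>2 * l'. a' k * monom_fun l' k z))
    = (\<Sum>k\<le>2 * l. \<Sum>k'\<le>2 * l'. a k * cnj (a' k')
        * l2_inner \<mu> (matrix_coeff \<phi> (monom_fun l k)) (matrix_coeff \<phi>' (monom_fun l' k')))"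
proof -
  have L: "matrix_coeff \<phi> (monom_fun l k) \<in> L2 \<mu>" "matrix_coeff \<phi>' (monom_fun l' k') \<in> L2 \<mu>"
    if "k \<le> 2 * l" "k' \<le> 2 * l'" for k k'
    using that assms by (auto intro: matrix_coeff_L2 monom_Sym)
  have e: "matrix_coeff \<phi> (\<lambda>z. \<Sum>k\<le>2 * l. a k * monom_fun l k z)
        = (\<lambda>g. \<Sum>k\<le>2 * l. a k * matrix_coeff \<phi> (monom_fun l k) g)"
      "matrix_coeff \<phi>' (\<lambda>z. \<Sum>k\<le>2 * l'. a' k * monom_fun l' k z)
        = (\<lambda>g. \<Sum>k\<le>2 * l'. a' k * matrix_coeff \<phi>' (monom_fun l' k) g)"
    by (rule matrix_coeff_sum[OF assms(1)], simp add: monom_Sym, rule matrix_coeff_sum[OF assms(2)], simp add: monom_Sym)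
  have "l2_inner \<mu> (\<lambda>g. \<Sum>k\<le>2 * l. a k * matrix_coeff \<phi> (monom_fun l k) g)
        (\<lambda>g. \<Sum>k\<le>2 * l'. a' k * matrix_coeff \<phi>' (monom_fun l' k) g)
      = (\<Sum>k\<le>2 * l. a k * l2_inner \<mu> (matrix_coeff \<phi> (monom_fun l k))
        (\<lambda>g. \<Sum>k\<le>2 * l'. a' k * matrix_coeff \<phi>' (monom_fun l' k) g))"
    using L by (intro l2_inner_sum_left L2_sum L2_scale) auto
  also have "\<dots> = (\<Sum>k\<le>2 * l. a k * (\<Sum>k'\<le>2 * l'. cnj (a' k')
        * l2_inner \<mu> (matrix_coeff \<phi> (monom_fun l k)) (matrix_coeff \<phi>' (monom_fun l' k'))))"
    using L by (intro sum.cong refl arg_cong2[of _ _ _ _ "(*)"] l2_inner_sum_right) auto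
  finally show ?thesis unfolding e by (simp add: sum_distrib_left mult.assoc)
qed

text \<open>The diagonal torus acts on the monomials by characters, with weights \<open>2 (k - l)\<close>.\<close>

lemma monom_weight:
  assumes \<phi>: "\<phi> \<in> sym_dual l" "\<phi>' \<in> sym_dual l'" and k: "k \<le> 2 * l" "k' \<le> 2 * l'" and ne: "k + l' \<noteq> k' + l"
  shows "l2_inner \<mu> (matrix_coeff \<phi> (monom_fun l k)) (matrix_coeff \<phi>' (monom_fun l' k')) = 0"
    (is "?b = 0")
proof -
  \<comment> \<open>The difference of the two weights.\<close>
  define m where "m = 2 * (real k + real l' - real k' - real l)"
  have m: "m \<noteq> 0"
    using ne unfolding m_def by (metis add_diff_eq diff_diff_eq2 eq_iff_diff_eq_0 diff_add_eq
        mult_eq_0_iff of_nat_add of_nat_eq_iff zero_neq_numeral diff_diff_eq)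
  \<comment> \<open>Chosen so that the torus element multiplies the pairing by
    \<open>cis pi = -1\<close>, which forces it to vanish.\<close>
  define \<eta> where "\<eta> = cis (pi / m)"
  have \<eta>: "cmod \<eta> = 1" by (simp add: \<eta>_def)
  define R where "R = rot_z (Re (\<eta>\<^sup>2)) (Im (\<eta>\<^sup>2))"
  have cov: "covers (torus_SU2 \<eta>) R" unfolding R_def by (rule covers_rot_z[OF \<eta>])
  have "(Re (\<eta>\<^sup>2))\<^sup>2 + (Im (\<eta>\<^sup>2))\<^sup>2 = (cmod (\<eta>\<^sup>2))\<^sup>2" by (simp only: cmod_power2)
  then have R: "R \<in> SO3" unfolding R_def by (intro rot_SO3) (simp add: norm_power \<eta>)
  define wt where "wt = (\<lambda>l k. cnj \<eta> ^ (2 * l - k) * \<eta> ^ k)"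
  have act: "rot_act R (monom_fun l k) = (\<lambda>z. wt l k * monom_fun l k z)" if "k \<le> 2 * l" for l k
    unfolding rot_act_eq[OF cov monom_Sym(1)[OF that]]
    by (rule ext) (simp add: monom_fun_def wt_def matrix_vector_mult_2 torus_SU2_def power_mult_distrib)
  have "?b = l2_inner \<mu> (matrix_coeff \<phi> (rot_act R (monom_fun l k))) (matrix_coeff \<phi>' (rot_act R (monom_fun l' k')))"
    by (rule matrix_coeff_invariant[OF R \<phi>(1) monom_Sym(1) \<phi>(2) monom_Sym(1), symmetric]) (rule k)+
  also have "\<dots> = wt l k * cnj (wt l' k') * ?b"
    using k \<phi> by (simp add: act matrix_coeff_scale monom_Sym l2_inner_scale_left l2_inner_scale_right
        matrix_coeff_L2 L2_scale)
  also have "wt l k * cnj (wt l' k') = cis (pi / m * (real k + real (2 * l' - k') - real (2 * l - k) - real k'))"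
    unfolding wt_def \<eta>_def complex_cnj_mult complex_cnj_power complex_cnj_cnj cis_cnj
      Complex.DeMoivre cis_mult
    by (rule arg_cong[where f=cis]) (simp add: algebra_simps)
  also have "real k + real (2 * l' - k') - real (2 * l - k) - real k' = m"
    using k by (simp add: m_def of_nat_diff)
  also have "pi / m * m = pi" using m by simp
  finally show ?thesis by (simp add: equation_minus_iff)
qed

text \<open>
  A real rotation takes \<open>z\<^sub>0\<^bsup>2\<ell>\<^esup>\<close> to \<open>(c z\<^sub>0 + s z\<^sub>1)\<^bsup>2\<ell>\<^esup>\<close>; the invariance is written in terms of \<open>t = s / c\<close>.
\<close>

lemma monom_rotation:
  assumes \<phi>: "\<phi> \<in> sym_dual l" "\<phi>' \<in> sym_dual l'"
  shows "(\<Sum>k\<le>2 * l. \<Sum>k'\<le>2 * l'. of_nat ((2 * l) choose k) * of_nat ((2 * l') choose k') * of_real t ^ (k + k')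
      * l2_inner \<mu> (matrix_coeff \<phi> (monom_fun l k)) (matrix_coeff \<phi>' (monom_fun l' k')))
    = of_real ((1 + t\<^sup>2) ^ (l + l'))
      * l2_inner \<mu> (matrix_coeff \<phi> (monom_fun l 0)) (matrix_coeff \<phi>' (monom_fun l' 0))"
    (is "?S = _")
proof -
  let ?b = "\<lambda>k k'. l2_inner \<mu> (matrix_coeff \<phi> (monom_fun l k)) (matrix_coeff \<phi>' (monom_fun l' k'))"
  \<comment> \<open>The length of \<open>(1, t)\<close>, so that \<open>(c, s)\<close> is the unit
    vector of slope \<open>t\<close>.\<close>
  define r where "r = sqrt (1 + t\<^sup>2)"
  have r: "r > 0" "r\<^sup>2 = 1 + t\<^sup>2" unfolding r_def by (simp_all add: add_pos_nonneg)
  define c s where "c = 1 / r" and "s = t / r"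
  have "c\<^sup>2 + s\<^sup>2 = (1 + t\<^sup>2) / r\<^sup>2"
    by (simp add: c_def s_def power_divide add_divide_distrib)
  also have "\<dots> = 1" unfolding r(2)[symmetric] using r(1) by simp
  finally have cs: "c\<^sup>2 + s\<^sup>2 = 1" .
  define b where "b = (vector [of_real c, of_real s] :: complex^2)"
  have b: "b $ 1 = of_real (1 / r)" "b $ 2 = of_real (t / r)" by (simp_all add: b_def c_def s_def)
  define R where "R = rot_y (c\<^sup>2 - s\<^sup>2) (2 * c * s)"
  have cov: "covers (real_SU2 c s) R" unfolding R_def by (rule covers_rot_y[OF cs])
  have "(c\<^sup>2 - s\<^sup>2)\<^sup>2 + (2 * c * s)\<^sup>2 = (c\<^sup>2 + s\<^sup>2)\<^sup>2" by algebra
  then have R: "R \<in> SO3" unfolding R_def by (intro rot_SO3) (simp add: cs)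
  \<comment> \<open>The rotated monomial is a coherent vector, so its coefficients are
    binomial.\<close>
  have act: "rot_act R (monom_fun l 0) = coherent l b" for l
    unfolding rot_act_eq[OF cov monom_Sym(1)[OF le0]]
    by (rule ext) (simp add: monom_fun_def coherent_def b_def matrix_vector_mult_2 real_SU2_def)
  have mb: "monom_fun l k b = of_real (t ^ k / r ^ (2 * l))" if "k \<le> 2 * l" for l k
  proof -
    have "r ^ (2 * l) = r ^ (2 * l - k) * r ^ k" using that by (simp add: power_add[symmetric])
    then show ?thesis by (simp add: monom_fun_def b power_divide)
  qed
  have "?b 0 0 = l2_inner \<mu> (matrix_coeff \<phi> (coherent l b)) (matrix_coeff \<phi>' (coherent l' b))"
    using matrix_coeff_invariant[OF R \<phi>(1) monom_Sym(1)[OF le0] \<phi>(2) monom_Sym(1)[OF le0]]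
    by (simp add: act)
  also have "\<dots> = (\<Sum>k\<le>2 * l. \<Sum>k'\<le>2 * l'. (of_nat ((2 * l) choose k) * monom_fun l k b)
      * cnj (of_nat ((2 * l') choose k') * monom_fun l' k' b) * ?b k k')"
    unfolding coherent_expand by (rule matrix_coeff_expand[OF \<phi>])
  also have "\<dots> = (\<Sum>k\<le>2 * l. \<Sum>k'\<le>2 * l'. of_nat ((2 * l) choose k) * of_nat ((2 * l') choose k')
      * of_real t ^ (k + k') * ?b k k' / of_real (r ^ (2 * l + 2 * l')))"
    by (intro sum.cong refl) (simp add: mb power_add mult_ac)
  also have "\<dots> = ?S / of_real (r ^ (2 * l + 2 * l'))"
    by (simp only: sum_divide_distrib)
  also have "r ^ (2 * l + 2 * l') = (1 + t\<^sup>2) ^ (l + l')"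
    by (simp add: r(2)[symmetric] power_mult[symmetric] distrib_left)
  finally have "?b 0 0 = ?S / of_real ((1 + t\<^sup>2) ^ (l + l'))" .
  moreover have "(1 + t\<^sup>2) ^ (l + l') \<noteq> 0"
    by (metis add_pos_nonneg less_numeral_extra(1,3) power_eq_0_iff zero_le_power2)
  ultimately show ?thesis by (simp add: field_simps del: of_real_power)
qed

text \<open>Weights leave only the pairs with \<open>k' = k + d\<close>. For these the rotation
  identity, divided by \<open>t ^ d\<close>, is one between polynomials in \<open>x = t^2\<close>
  with right side \<open>(1 + x) ^ (l + l')\<close> times the pair at \<open>0\<close>. That pair
  vanishes by weights if the levels differ; otherwise the coefficients of
  \<open>(1 + x) ^ (2 * l)\<close> are compared. The order \<open>l \<le> l'\<close> makes the shift
  \<open>d\<close> a natural number.\<close>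

lemma schur_monom:
  assumes \<phi>: "\<phi> \<in> sym_dual l" "\<phi>' \<in> sym_dual l'" and ll': "l \<le> l'" and k: "k \<le> 2 * l" "k' \<le> 2 * l'"
  shows "l2_inner \<mu> (matrix_coeff \<phi> (monom_fun l k)) (matrix_coeff \<phi>' (monom_fun l' k'))
    = (if l = l' \<and> k = k' then
         l2_inner \<mu> (matrix_coeff \<phi> (monom_fun l 0)) (matrix_coeff \<phi>' (monom_fun l' 0))
           / of_nat ((2 * l) choose k) else 0)"
proof -
  let ?b = "\<lambda>k k'. l2_inner \<mu> (matrix_coeff \<phi> (monom_fun l k)) (matrix_coeff \<phi>' (monom_fun l' k'))"
  define d where "d = l' - l"
  have 00: "?b 0 0 = 0" if "l \<noteq> l'"
    using monom_weight[OF \<phi>, of 0 0] that by auto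
  have diag: "of_nat ((2 * l) choose k) * of_nat ((2 * l') choose (k + d)) * ?b k (k + d)
      = (if l = l' then of_nat ((2 * l) choose k) * ?b 0 0 else 0)"
  proof (rule complex_polynomial_unique[OF _ k(1)])
    fix x :: real assume x: "x > 0"
    define t where "t = sqrt x"
    have t: "t > 0" "t\<^sup>2 = x" using x by (simp_all add: t_def)
    have "(\<Sum>k\<le>2 * l. \<Sum>k'\<le>2 * l'. of_nat ((2 * l) choose k) * of_nat ((2 * l') choose k') * of_real t ^ (k + k') * ?b k k')
      = (\<Sum>k\<le>2 * l. \<Sum>k'\<le>2 * l'. if k' = k + d then of_real t ^ d *
          (of_nat ((2 * l) choose k) * of_nat ((2 * l') choose (k + d)) * ?b k (k + d) * of_real x ^ k) else 0)"
    proof (intro sum.cong refl)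
      fix k k' assume kk: "k \<in> {..2 * l}" "k' \<in> {..2 * l'}"
      have "of_real t ^ (k + (k + d)) = (of_real t ^ d * of_real x ^ k :: complex)"
        unfolding t(2)[symmetric] of_real_power power_mult[symmetric] power_add[symmetric]
        by (simp add: mult_2 add.commute add.left_commute)
      then show "of_nat ((2 * l) choose k) * of_nat ((2 * l') choose k') * of_real t ^ (k + k') * ?b k k'
        = (if k' = k + d then of_real t ^ d *
          (of_nat ((2 * l) choose k) * of_nat ((2 * l') choose (k + d)) * ?b k (k + d) * of_real x ^ k) else 0)"
        using kk ll' monom_weight[OF \<phi>, of k k'] by (auto simp: d_def)
    qed
    also have "\<dots> = (\<Sum>k\<le>2 * l. of_real t ^ d *
          (of_nat ((2 * l) choose k) * of_nat ((2 * l') choose (k + d)) * ?b k (k + d) * of_real x ^ k))"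
      using ll' by (intro sum.cong refl) (simp add: d_def)
    also have "\<dots> = of_real t ^ d * (\<Sum>k\<le>2 * l.
          of_nat ((2 * l) choose k) * of_nat ((2 * l') choose (k + d)) * ?b k (k + d) * of_real x ^ k)"
      by (simp only: sum_distrib_left)
    finally have *: "of_real t ^ d * (\<Sum>k\<le>2 * l.
          of_nat ((2 * l) choose k) * of_nat ((2 * l') choose (k + d)) * ?b k (k + d) * of_real x ^ k)
        = of_real ((1 + x) ^ (l + l')) * ?b 0 0"
      using monom_rotation[OF \<phi>, of t] t by simp
    show "(\<Sum>k\<le>2 * l. of_nat ((2 * l) choose k) * of_nat ((2 * l') choose (k + d)) * ?b k (k + d) * of_real x ^ k)
        = (\<Sum>k\<le>2 * l. (if l = l' then of_nat ((2 * l) choose k) * ?b 0 0 else 0) * of_real x ^ k)"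
    proof (cases "l = l'")
      case True
      have "(1 + complex_of_real x) ^ (2 * l) = (\<Sum>k\<le>2 * l. of_nat ((2 * l) choose k) * of_real x ^ k)"
        by (subst add.commute, subst binomial_ring) simp
      then show ?thesis using * True
        by (simp add: d_def mult_2[symmetric] sum_distrib_left sum_distrib_right mult_ac)
    next
      case False
      then show ?thesis using * t(1) 00 by simp
    qed
  qed
  show ?thesis
  proof (cases "k' = k + d")
    case True
    have c: "of_nat ((2 * l) choose k) \<noteq> (0::complex)" "of_nat ((2 * l') choose k') \<noteq> (0::complex)"
      using k by simp_all
    show ?thesis
    proof (cases "l = l'")
      case eq: True
      then show ?thesis using diag c True by (simp add: d_def field_simps)
    next
      case False
      then show ?thesis using diag c True by simp
    qed
  next
    case False
    then show ?thesis using monom_weight[OF \<phi> k] ll' by (auto simp: d_def)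
  qed
qed

text \<open>The inverse binomials found for monomials are their squared norms, so the sesquilinear
  extension is a multiple of \<open>sym_inner\<close>.\<close>

lemma schur_le:
  assumes \<phi>: "\<phi> \<in> sym_dual l" "\<phi>' \<in> sym_dual l'" and ll': "l \<le> l'" and v: "v \<in> Sym l" "v' \<in> Sym l'"
  shows "l2_inner \<mu> (matrix_coeff \<phi> v) (matrix_coeff \<phi>' v')
    = (if l = l' then
         l2_inner \<mu> (matrix_coeff \<phi> (monom_fun l 0)) (matrix_coeff \<phi>' (monom_fun l' 0)) * sym_inner l v v'
       else 0)"
proof -
  let ?b = "\<lambda>k k'. l2_inner \<mu> (matrix_coeff \<phi> (monom_fun l k)) (matrix_coeff \<phi>' (monom_fun l' k'))"
  have "l2_inner \<mu> (matrix_coeff \<phi> v) (matrix_coeff \<phi>' v')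
      = (\<Sum>k\<le>2 * l. \<Sum>k'\<le>2 * l'. sym_coeff l v k * cnj (sym_coeff l' v' k') * ?b k k')"
    by (subst Sym_expand[OF v(1)], subst Sym_expand[OF v(2)], rule matrix_coeff_expand[OF \<phi>])
  also have "\<dots> = (\<Sum>k\<le>2 * l. \<Sum>k'\<le>2 * l'. if k = k' then
      (if l = l' then sym_coeff l v k * cnj (sym_coeff l v' k) * (?b 0 0 / of_nat ((2 * l) choose k)) else 0) else 0)"
    by (intro sum.cong refl) (auto simp: schur_monom[OF \<phi> ll'])
  also have "\<dots> = (\<Sum>k\<le>2 * l. if l = l' then sym_coeff l v k * cnj (sym_coeff l v' k) * (?b 0 0 / of_nat ((2 * l) choose k)) else 0)"
    using ll' by (intro sum.cong refl) auto
  also have "\<dots> = (if l = l' then ?b 0 0 * sym_inner l v v' else 0)"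
    by (auto simp: sym_inner_def sum_distrib_left mult_ac)
  finally show ?thesis .
qed

lemma schur_orthogonal:
  assumes "\<phi> \<in> sym_dual l" "\<phi>' \<in> sym_dual l'" "v \<in> Sym l" "v' \<in> Sym l'" "l \<noteq> l'"
  shows "l2_inner \<mu> (matrix_coeff \<phi> v) (matrix_coeff \<phi>' v') = 0"
proof (cases "l \<le> l'")
  case True
  then show ?thesis using schur_le assms by simp
next
  case False
  then have "l2_inner \<mu> (matrix_coeff \<phi>' v') (matrix_coeff \<phi> v) = 0"
    using schur_le[OF assms(2,1) _ assms(4,3)] assms(5) by simp
  then show ?thesis using l2_inner_commute[of \<mu> "matrix_coeff \<phi> v"] by simp
qed

end

section \<open>The dual representation and the Schur constant\<close>

lemma dual_identificationD:
  assumes "dual_identification l D"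
  shows "p \<in> Sym l \<Longrightarrow> D p \<in> sym_dual l"
    and "p \<in> Sym l \<Longrightarrow> v \<in> Sym l \<Longrightarrow> D (\<lambda>z. a * p z) v = a * D p v"
    and "p \<in> Sym l \<Longrightarrow> q \<in> Sym l \<Longrightarrow> dual_inner l (D p) (D q) = sym_inner l p q"
    and "R \<in> SO3 \<Longrightarrow> p \<in> Sym l \<Longrightarrow> v \<in> Sym l \<Longrightarrow> D (rot_act R p) v = D p (rot_act (matrix_inv R) v)"
proof -
  show "p \<in> Sym l \<Longrightarrow> D p \<in> sym_dual l"
    and "p \<in> Sym l \<Longrightarrow> q \<in> Sym l \<Longrightarrow> dual_inner l (D p) (D q) = sym_inner l p q"
    and "R \<in> SO3 \<Longrightarrow> p \<in> Sym l \<Longrightarrow> v \<in> Sym l \<Longrightarrow> D (rot_act R p) v = D p (rot_act (matrix_inv R) v)"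
    using assms unfolding dual_identification_def by blast+
  have "\<forall>p\<in>Sym l. \<forall>q\<in>Sym l. \<forall>a b. \<forall>v\<in>Sym l. D (\<lambda>z. a * p z + b * q z) v = a * D p v + b * D q v"
    using assms unfolding dual_identification_def by blast
  then have "p \<in> Sym l \<Longrightarrow> v \<in> Sym l \<Longrightarrow> D (\<lambda>z. a * p z + 0 * p z) v = a * D p v + 0 * D p v"
    by blast
  then show "p \<in> Sym l \<Longrightarrow> v \<in> Sym l \<Longrightarrow> D (\<lambda>z. a * p z) v = a * D p v" by simp
qed

definition unit_monom :: "nat \<Rightarrow> nat \<Rightarrow> complex^2 \<Rightarrow> complex" where
  "unit_monom l k = sym_normalize l (monom_fun l k)"

lemma unit_monom_Sym: "k \<le> 2 * l \<Longrightarrow> unit_monom l k \<in> Sym l"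
  unfolding unit_monom_def by (intro sym_normalize_Sym monom_Sym)

lemma sym_norm_monom_pos:
  assumes "k \<le> 2 * l"
  shows "0 < sym_norm l (monom_fun l k)"
proof -
  have "0 < (sym_norm l (monom_fun l k))\<^sup>2" unfolding sym_norm_monom[OF assms] using assms by simp
  then show ?thesis using sym_norm_nonneg[of l "monom_fun l k"] by (simp add: order_less_le)
qed

lemma sym_inner_normalize_self:
  assumes "p \<in> Sym l" "sym_norm l p \<noteq> 0"
  shows "sym_inner l (sym_normalize l p) (sym_normalize l p) = 1"
  using assms(2)
  by (subst sym_inner_normalize[OF assms(1,1)], subst sym_norm_power2) (simp add: power2_eq_square)

lemma unit_monom_inner:
  assumes "k \<le> 2 * l" "k' \<le> 2 * l"
  shows "sym_inner l (unit_monom l k) (unit_monom l k') = (if k = k' then 1 else 0)"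
proof (cases "k = k'")
  case True
  then show ?thesis
    using assms sym_norm_monom_pos[of k' l]
    by (simp add: unit_monom_def sym_inner_normalize_self monom_Sym)
next
  case False
  have "sym_inner l (monom_fun l k) (monom_fun l k') = 0"
    using False assms by (simp add: sym_inner_monom_right monom_Sym)
  then show ?thesis using False assms by (simp add: unit_monom_def sym_inner_normalize monom_Sym)
qed

lemma Sym_unit_monom_expand:
  assumes "p \<in> Sym l"
  obtains b where "p = (\<lambda>z. \<Sum>k\<le>2 * l. b k * unit_monom l k z)"
proof
  show "p = (\<lambda>z. \<Sum>k\<le>2 * l. (sym_coeff l p k * of_real (sym_norm l (monom_fun l k))) * unit_monom l k z)"
    by (subst Sym_expand[OF assms])
      (auto simp: unit_monom_def sym_normalize_def fun_eq_iff less_imp_neq[OF sym_norm_monom_pos, symmetric]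
        intro!: sum.cong)
qed

context haar_SO3
begin

text \<open>Unitarity at each single \<open>g\<close>: equivariance of \<open>D\<close> transfers
  \<open>g\<close> to \<open>p\<close> and \<open>p'\<close>, and \<open>dual_inner\<close> is by
  definition the sum over the unit monomials. It yields both the Schur constant and the sup
  bound.\<close>

lemma schur_dual_inner:
  assumes D: "dual_identification l D" and p: "p \<in> Sym l" "p' \<in> Sym l" and g: "g \<in> SO3"
  shows "(\<Sum>k\<le>2 * l. matrix_coeff (D p) (unit_monom l k) g * cnj (matrix_coeff (D p') (unit_monom l k) g))
    = sym_inner l p p'"
proof -
  have "(\<Sum>k\<le>2 * l. matrix_coeff (D p) (unit_monom l k) g * cnj (matrix_coeff (D p') (unit_monom l k) g))
      = dual_inner l (D (rot_act g p)) (D (rot_act g p'))"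
    unfolding dual_inner_def unit_monom_def[symmetric]
    using dual_identificationD(4)[OF D g] p
    by (intro sum.cong refl) (simp add: matrix_coeff_def unit_monom_Sym)
  also have "\<dots> = sym_inner l p p'"
    using p g by (simp add: dual_identificationD(3)[OF D] rot_act_Sym sym_inner_rot_act)
  finally show ?thesis .
qed

text \<open>The constant in Schur's lemma is found by summing over an orthonormal basis of \<open>V\<^sub>\<ell>\<close>.\<close>

lemma schur:
  assumes D: "dual_identification l D" and p: "p \<in> Sym l" "p' \<in> Sym l" and v: "v \<in> Sym l" "v' \<in> Sym l"
  shows "l2_inner \<mu> (matrix_coeff (D p) v) (matrix_coeff (D p') v')
    = sym_inner l v v' * sym_inner l p p' / of_nat (2 * l + 1)"
proof -
  define C where "C = l2_inner \<mu> (matrix_coeff (D p) (monom_fun l 0)) (matrix_coeff (D p') (monom_fun l 0))"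
  note d = dual_identificationD(1)[OF D p(1)] dual_identificationD(1)[OF D p(2)]
  have B: "l2_inner \<mu> (matrix_coeff (D p) v) (matrix_coeff (D p') v') = C * sym_inner l v v'"
    if "v \<in> Sym l" "v' \<in> Sym l" for v v'
    unfolding C_def using schur_le[OF d order_refl that] by simp
  have "of_nat (2 * l + 1) * C = (\<Sum>k\<le>2 * l. C * sym_inner l (unit_monom l k) (unit_monom l k))"
    by (simp add: unit_monom_inner)
  also have "\<dots> = (\<Sum>k\<le>2 * l. l2_inner \<mu> (matrix_coeff (D p) (unit_monom l k)) (matrix_coeff (D p') (unit_monom l k)))"
    by (simp add: B unit_monom_Sym)
  also have "\<dots> = (LINT g|\<mu>. (\<Sum>k\<le>2 * l. matrix_coeff (D p) (unit_monom l k) g * cnj (matrix_coeff (D p') (unit_monom l k) g)))"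
    unfolding l2_inner_def
    by (rule Bochner_Integration.integral_sum[symmetric])
      (auto intro!: L2_mult_integrable matrix_coeff_L2[OF d(1)] matrix_coeff_L2[OF d(2)] unit_monom_Sym)
  also have "\<dots> = (LINT g|\<mu>. sym_inner l p p')"
    by (rule Bochner_Integration.integral_cong) (simp_all add: schur_dual_inner[OF D p] space_haar)
  also have "\<dots> = sym_inner l p p'" by (simp add: prob_space)
  finally have "C = sym_inner l p p' / of_nat (2 * l + 1)"
    by (metis nonzero_mult_div_cancel_left of_nat_eq_0_iff add_is_0 zero_neq_one)
  then show ?thesis by (simp add: B v)
qed

text \<open>One summand of a sum of squares equal to \<open>1\<close>. After scaling this supplies
  the sup bound required by \<open>ortho_blocks\<close>.\<close>

lemma matrix_coeff_bound:
  assumes D: "dual_identification l D" and p: "p \<in> Sym l" "sym_inner l p p = 1" and g: "g \<in> SO3" and k: "k \<le> 2 * l"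
  shows "cmod (matrix_coeff (D p) (unit_monom l k) g) \<le> 1"
proof -
  let ?m = "\<lambda>k. matrix_coeff (D p) (unit_monom l k) g"
  have "of_real (\<Sum>k\<le>2 * l. (cmod (?m k))\<^sup>2) = (1::complex)"
    using schur_dual_inner[OF D p(1) p(1) g] p(2)
    by (simp add: complex_norm_square del: of_real_power)
  then have "(\<Sum>k\<le>2 * l. (cmod (?m k))\<^sup>2) = 1" by (simp only: of_real_eq_1_iff)
  moreover have "(cmod (?m k))\<^sup>2 \<le> (\<Sum>k\<le>2 * l. (cmod (?m k))\<^sup>2)"
    using k by (intro member_le_sum) auto
  ultimately have "(cmod (?m k))\<^sup>2 \<le> 1\<^sup>2" by simp
  then show ?thesis by (rule power2_le_imp_le) simp
qed

end

lemma peter_weyl_matrix_coeff: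
  "peter_weyl l v \<phi> = (\<lambda>g. of_real (sqrt (real (2 * l + 1))) * matrix_coeff \<phi> v g)"
  by (simp add: peter_weyl_def matrix_coeff_def)

section \<open>Orthonormal bases of the Hardy spaces\<close>

locale haar_SO3_dual = haar_SO3 +
  fixes D :: "nat \<Rightarrow> (complex^2 \<Rightarrow> complex) \<Rightarrow> ((complex^2 \<Rightarrow> complex) \<Rightarrow> complex)"
  assumes D: "dual_identification l (D l)"
begin

text \<open>The two factors \<open>sqrt (2 l + 1)\<close> cancel the Schur constant
  \<open>1 / (2 l + 1)\<close>.\<close>

lemma peter_weyl_inner:
  assumes "p \<in> Sym l" "p' \<in> Sym l'" "v \<in> Sym l" "v' \<in> Sym l'"
  shows "l2_inner \<mu> (peter_weyl l v (D l p)) (peter_weyl l' v' (D l' p'))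
    = (if l = l' then sym_inner l v v' * sym_inner l p p' else 0)"
proof -
  have L: "matrix_coeff (D l p) v \<in> L2 \<mu>" "matrix_coeff (D l' p') v' \<in> L2 \<mu>"
    using matrix_coeff_L2[OF dual_identificationD(1)[OF D]] assms by auto
  have s: "complex_of_real (sqrt x) * complex_of_real (sqrt x) = of_real x" if "x \<ge> 0" for x
    using that by (simp add: of_real_mult[symmetric] del: of_real_mult)
  have "l2_inner \<mu> (peter_weyl l v (D l p)) (peter_weyl l' v' (D l' p'))
      = of_real (sqrt (real (2 * l + 1))) * (of_real (sqrt (real (2 * l' + 1)))
        * l2_inner \<mu> (matrix_coeff (D l p) v) (matrix_coeff (D l' p') v'))"
    unfolding peter_weyl_matrix_coeff using L
    by (simp only: l2_inner_scale_left l2_inner_scale_right L2_scale complex_cnj_complex_of_real)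
  also have "\<dots> = (if l = l' then sym_inner l v v' * sym_inner l p p' else 0)"
  proof (cases "l = l'")
    case True
    have "l2_inner \<mu> (matrix_coeff (D l p) v) (matrix_coeff (D l' p') v')
        = sym_inner l v v' * sym_inner l p p' / of_nat (2 * l + 1)"
      using schur[OF D, of p l p' v v'] assms True by simp
    then have "of_real (sqrt (real (2 * l + 1))) * (of_real (sqrt (real (2 * l' + 1)))
        * l2_inner \<mu> (matrix_coeff (D l p) v) (matrix_coeff (D l' p') v'))
      = of_real (real (2 * l + 1)) * (sym_inner l v v' * sym_inner l p p' / of_nat (2 * l + 1))"
      using True s[OF of_nat_0_le_iff[of "2 * l + 1"]] by (simp only: mult.assoc[symmetric])
    also have "of_real (real (2 * l + 1)) = (of_nat (2 * l + 1) :: complex)" by (rule of_real_of_nat_eq)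
    also have "of_nat (2 * l + 1) * (sym_inner l v v' * sym_inner l p p' / of_nat (2 * l + 1))
        = sym_inner l v v' * sym_inner l p p'"
    proof -
      have "of_nat (2 * l + 1) \<noteq> (0::complex)" by (simp only: of_nat_eq_0_iff)
      then show ?thesis unfolding times_divide_eq_right by (rule nonzero_mult_div_cancel_left)
    qed
    finally show ?thesis using True by simp
  next
    case False
    then show ?thesis
      using schur_orthogonal[OF dual_identificationD(1)[OF D assms(1)] dual_identificationD(1)[OF D assms(2)] assms(3,4)]
      by simp
  qed
  finally show ?thesis .
qed

definition pw_basis :: "(nat \<Rightarrow> complex^2 \<Rightarrow> complex) \<Rightarrow> nat \<Rightarrow> nat \<Rightarrow> real^3^3 \<Rightarrow> complex" where
  "pw_basis q l k = peter_weyl l (unit_monom l k) (D l (q l))"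

text \<open>Serves twice: with \<open>q' = q\<close> for orthonormality of one basis, and with the
  vectors of both Hardy spaces for the cross products.\<close>

lemma pw_basis_inner:
  assumes "\<And>l. q l \<in> Sym l" "\<And>l. q' l \<in> Sym l" "k < 2 * l + 1" "k' < 2 * l' + 1"
  shows "l2_inner \<mu> (pw_basis q l k) (pw_basis q' l' k')
    = (if l = l' \<and> k = k' then sym_inner l (q l) (q' l) else 0)"
  unfolding pw_basis_def using assms
  by (subst peter_weyl_inner) (auto simp: unit_monom_Sym unit_monom_inner)

lemma ortho_blocks_pw_basis:
  assumes q: "\<And>l. q l \<in> Sym l" "\<And>l. sym_inner l (q l) (q l) = 1"
  shows "ortho_blocks \<mu> (\<lambda>l. 2 * l + 1) (\<lambda>l. sqrt (real (2 * l + 1))) (pw_basis q)"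
proof unfold_locales
  fix l k :: nat assume k: "k < 2 * l + 1"
  show "pw_basis q l k \<in> borel_measurable \<mu>"
    unfolding pw_basis_def peter_weyl_matrix_coeff using k q(1)
    by (intro L2_measurable L2_scale matrix_coeff_L2[OF dual_identificationD(1)[OF D]] unit_monom_Sym) auto
  show "cmod (pw_basis q l k x) \<le> sqrt (real (2 * l + 1))" if "x \<in> space \<mu>" for x
  proof -
    have "cmod (matrix_coeff (D l (q l)) (unit_monom l k) x) \<le> 1"
      using matrix_coeff_bound[OF D q] that k by (simp add: space_haar)
    then show ?thesis
      unfolding pw_basis_def peter_weyl_matrix_coeff norm_mult norm_of_real
      by (simp add: mult_left_le)
  qed
  show "l2_inner \<mu> (pw_basis q l k) (pw_basis q l' k') = (if l = l' \<and> k = k' then 1 else 0)"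
    if "k' < 2 * l' + 1" for k' l'
    using k that by (simp add: pw_basis_inner q)
qed

text \<open>The Hardy spaces are defined with \<open>u_vec\<close> and \<open>w_vec\<close>, the
  bases with unit vectors. A non-zero scalar does not change the line and is absorbed into the first
  tensor factor.\<close>

lemma pw_block_eq:
  assumes q: "\<And>l. q l \<in> Sym l" and a: "a \<noteq> 0" and p: "p = (\<lambda>z. a * q l z)"
  shows "pw_block D l p = {\<lambda>x. \<Sum>k<2 * l + 1. b k * pw_basis q l k x | b. True}"
proof -
  have d: "D l (q l) \<in> sym_dual l" by (rule dual_identificationD(1)[OF D q])
  have pw: "peter_weyl l (\<lambda>z. \<Sum>k\<le>2 * l. b k * unit_monom l k z) (D l (\<lambda>z. c * p z))
      = (\<lambda>g. \<Sum>k<2 * l + 1. (c * a * b k) * pw_basis q l k g)" for b c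
  proof -
    have "matrix_coeff (D l (\<lambda>z. c * p z)) v = (\<lambda>g. (c * a) * matrix_coeff (D l (q l)) v g)" if "v \<in> Sym l" for v
      unfolding matrix_coeff_def p
      using dual_identificationD(2)[OF D q rot_act_Sym[OF that], of "c * a"] by (simp add: mult.assoc)
    moreover have "(\<lambda>z. \<Sum>k\<le>2 * l. b k * unit_monom l k z) \<in> Sym l"
      by (intro Sym_sum unit_monom_Sym) simp
    ultimately have "matrix_coeff (D l (\<lambda>z. c * p z)) (\<lambda>z. \<Sum>k\<le>2 * l. b k * unit_monom l k z)
        = (\<lambda>g. (c * a) * (\<Sum>k\<le>2 * l. b k * matrix_coeff (D l (q l)) (unit_monom l k) g))"
      using matrix_coeff_sum[OF d, of "{..2 * l}" "unit_monom l" b] by (simp add: unit_monom_Sym)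
    then show ?thesis
      unfolding peter_weyl_matrix_coeff pw_basis_def
      by (simp add: lessThan_Suc_atMost sum_distrib_left mult_ac)
  qed
  show ?thesis
  proof (intro equalityI subsetI)
    fix f assume "f \<in> pw_block D l p"
    then obtain v c where "v \<in> Sym l" and f: "f = peter_weyl l v (D l (\<lambda>z. c * p z))"
      by (auto simp: pw_block_def)
    obtain b where "v = (\<lambda>z. \<Sum>k\<le>2 * l. b k * unit_monom l k z)"
      by (rule Sym_unit_monom_expand[OF \<open>v \<in> Sym l\<close>])
    then show "f \<in> {\<lambda>x. \<Sum>k<2 * l + 1. b k * pw_basis q l k x | b. True}"
      unfolding f using pw by auto
  next
    fix f assume "f \<in> {\<lambda>x. \<Sum>k<2 * l + 1. b k * pw_basis q l k x | b. True}"
    then obtain b where "f = (\<lambda>x. \<Sum>k<2 * l + 1. b k * pw_basis q l k x)" by auto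
    then have "f = peter_weyl l (\<lambda>z. \<Sum>k\<le>2 * l. (b k / a) * unit_monom l k z) (D l (\<lambda>z. 1 * p z))"
      unfolding pw using a by simp
    moreover have "(\<lambda>z. \<Sum>k\<le>2 * l. (b k / a) * unit_monom l k z) \<in> Sym l"
      by (intro Sym_sum unit_monom_Sym) simp
    ultimately show "f \<in> pw_block D l p" unfolding pw_block_def by blast
  qed
qed

text \<open>Translation moves only the vector in the first tensor factor, so it preserves each
  block, and it preserves the norms of the remainders.\<close>

lemma left_regular_hilbert_sum:
  assumes h: "h \<in> SO3" and p: "\<And>l. p l \<in> Sym l" and f: "f \<in> hilbert_sum \<mu> (\<lambda>l. pw_block D l (p l))"
  shows "left_regular h f \<in> hilbert_sum \<mu> (\<lambda>l. pw_block D l (p l))"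
proof -
  have fL: "f \<in> L2 \<mu>" using f by (simp add: hilbert_sum_def)
  obtain b where b: "\<And>l. b l \<in> pw_block D l (p l)"
      "(\<lambda>n. l2_norm \<mu> (\<lambda>x. f x - (\<Sum>l<n. b l x))) \<longlonglongrightarrow> 0"
    using f by (auto simp: hilbert_sum_def)
  have "\<forall>l. \<exists>v c. v \<in> Sym l \<and> b l = peter_weyl l v (D l (\<lambda>z. c * p l z))"
    using b(1) unfolding pw_block_def by blast
  then obtain v c where v: "\<And>l. v l \<in> Sym l" and bv: "\<And>l. b l = peter_weyl l (v l) (D l (\<lambda>z. c l * p l z))"
    by metis
  define b' where "b' = (\<lambda>l. peter_weyl l (rot_act h (v l)) (D l (\<lambda>z. c l * p l z)))"
  have bL: "b l \<in> L2 \<mu>" for l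
    unfolding bv peter_weyl_matrix_coeff
    by (intro L2_scale matrix_coeff_L2[OF dual_identificationD(1)[OF D]] Sym_scale p v)
  have "l2_norm \<mu> (\<lambda>x. left_regular h f x - (\<Sum>l<n. b' l x)) = l2_norm \<mu> (\<lambda>x. f x - (\<Sum>l<n. b l x))" for n
  proof -
    let ?r = "\<lambda>x. f x - (\<Sum>l<n. b l x)"
    have r: "?r \<in> L2 \<mu>" by (intro L2_diff L2_sum fL bL)
    have "l2_norm \<mu> (\<lambda>x. left_regular h f x - (\<Sum>l<n. b' l x)) = l2_norm \<mu> (left_regular h ?r)"
      by (rule l2_norm_cong_space)
        (simp add: left_regular_def b'_def bv peter_weyl_matrix_coeff space_haar matrix_coeff_rot_act[OF h _ v])
    also have "\<dots> = l2_norm \<mu> ?r"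
    proof -
      have "(l2_norm \<mu> (left_regular h ?r))\<^sup>2 = (l2_norm \<mu> ?r)\<^sup>2"
        unfolding l2_norm_power2_eq left_regular_inner[OF h r r] ..
      then show ?thesis by (simp add: power2_eq_iff_nonneg)
    qed
    finally show ?thesis .
  qed
  moreover have "b' l \<in> pw_block D l (p l)" for l
    unfolding b'_def pw_block_def using rot_act_Sym[OF v] by blast
  ultimately show ?thesis
    using b(2) left_regular_L2[OF h fL] unfolding hilbert_sum_def
    by (intro CollectI conjI exI[of _ b']) auto
qed

end

section \<open>The norms of the vectors \<open>w\<^sub>\<ell>(\<tau>)\<close>\<close>

text \<open>The coefficients of \<open>(1 + 2 c x + x^2)^l\<close>, which are those of
  \<open>w_vec\<close> for \<open>c = coth \<tau>\<close>. Multiplying in one factor at a time makes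
  positivity and the growth of the norms visible in each step.\<close>

primrec w_coeff :: "real \<Rightarrow> nat \<Rightarrow> nat \<Rightarrow> real" where
  "w_coeff c 0 = (\<lambda>k. if k = 0 then 1 else 0)"
| "w_coeff c (Suc l) = (\<lambda>k. w_coeff c l k + 2 * c * (case k of 0 \<Rightarrow> 0 | Suc j \<Rightarrow> w_coeff c l j)
      + (case k of 0 \<Rightarrow> 0 | Suc i \<Rightarrow> (case i of 0 \<Rightarrow> 0 | Suc j \<Rightarrow> w_coeff c l j)))"

lemma w_coeff_eq_0: "k > 2 * l \<Longrightarrow> w_coeff c l k = 0"
proof (induction l arbitrary: k)
  case (Suc l)
  then obtain j where k: "k = Suc (Suc j)" "j > 2 * l"
    by (metis Suc_lessE add_2_eq_Suc less_Suc_eq_0_disj mult_Suc_right Suc_less_SucD)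
  then show ?case using Suc.IH by simp
qed simp

lemma w_coeff_nonneg: "c \<ge> 0 \<Longrightarrow> w_coeff c l k \<ge> 0"
  by (induction l arbitrary: k) (auto split: nat.split)

lemma w_coeff_0 [simp]: "w_coeff c l 0 = 1"
  by (induction l) auto

text \<open>Multiplication by \<open>1 + m x + x^2\<close>, moved from the coefficients
  \<open>a\<close> to the weights \<open>X\<close>. The weights are general because monomials, the
  constant \<open>1\<close> and inverse binomials all occur.\<close>

lemma sum_three_shifts:
  fixes a X :: "nat \<Rightarrow> 'a::comm_ring_1"
  assumes "\<And>k. k > n \<Longrightarrow> a k = 0"
  shows "(\<Sum>k\<le>n + 2. (a k + m * (case k of 0 \<Rightarrow> 0 | Suc j \<Rightarrow> a j)
      + (case k of 0 \<Rightarrow> 0 | Suc i \<Rightarrow> (case i of 0 \<Rightarrow> 0 | Suc j \<Rightarrow> a j))) * X k)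
    = (\<Sum>k\<le>n. a k * (X k + m * X (k + 1) + X (k + 2)))"
proof -
  have "(\<Sum>k\<le>n + 2. a k * X k) = (\<Sum>k\<le>n. a k * X k)"
    using assms by (simp add: numeral_2_eq_2)
  moreover have "(\<Sum>k\<le>n + 2. (case k of 0 \<Rightarrow> 0 | Suc j \<Rightarrow> a j) * X k) = (\<Sum>k\<le>n. a k * X (k + 1))"
    unfolding numeral_2_eq_2 add_Suc_right by (subst sum.atMost_Suc_shift) (simp add: assms)
  moreover have "(\<Sum>k\<le>n + 2. (case k of 0 \<Rightarrow> 0 | Suc i \<Rightarrow> (case i of 0 \<Rightarrow> 0 | Suc j \<Rightarrow> a j)) * X k)
      = (\<Sum>k\<le>n. a k * X (k + 2))"
    unfolding numeral_2_eq_2 add_Suc_right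
    by (subst sum.atMost_Suc_shift, subst sum.atMost_Suc_shift) simp
  ultimately show ?thesis
    by (simp add: ring_distribs sum.distrib mult.assoc mult.left_commute sum_distrib_left[symmetric] del: sum.atMost_Suc)
qed

lemma w_vec_expand:
  "w_vec \<tau> l = (\<lambda>z. \<Sum>k\<le>2 * l. of_real (w_coeff (cosh \<tau> / sinh \<tau>) l k) * monom_fun l k z)"
proof
  fix z
  let ?c = "cosh \<tau> / sinh \<tau>"
  show "w_vec \<tau> l z = (\<Sum>k\<le>2 * l. of_real (w_coeff ?c l k) * monom_fun l k z)"
  proof (induction l)
    case 0
    show ?case by (simp add: w_vec_def monom_fun_def)
  next
    case (Suc l)
    have "(\<Sum>k\<le>2 * Suc l. of_real (w_coeff ?c (Suc l) k) * monom_fun (Suc l) k z)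
      = (\<Sum>k\<le>2 * l + 2. (of_real (w_coeff ?c l k) + of_real (2 * ?c) * (case k of 0 \<Rightarrow> 0 | Suc j \<Rightarrow> of_real (w_coeff ?c l j))
      + (case k of 0 \<Rightarrow> 0 | Suc i \<Rightarrow> (case i of 0 \<Rightarrow> 0 | Suc j \<Rightarrow> of_real (w_coeff ?c l j)))) * monom_fun (Suc l) k z)"
      by (rule sum.cong) (auto split: nat.split)
    also have "\<dots> = (\<Sum>k\<le>2 * l. of_real (w_coeff ?c l k) * (monom_fun (Suc l) k z
        + of_real (2 * ?c) * monom_fun (Suc l) (k + 1) z + monom_fun (Suc l) (k + 2) z))"
      by (rule sum_three_shifts) (simp add: w_coeff_eq_0)
    also have "\<dots> = (\<Sum>k\<le>2 * l. of_real (w_coeff ?c l k) * monom_fun l k z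
        * ((z $ 1)\<^sup>2 + (z $ 2)\<^sup>2 + 2 * of_real ?c * (z $ 1) * (z $ 2)))"
    proof (intro sum.cong refl)
      fix k assume "k \<in> {..2 * l}"
      then obtain j where j: "2 * l = k + j" using le_Suc_ex[of k "2 * l"] by auto
      then have "2 * Suc l = k + j + 2" by simp
      then show "of_real (w_coeff ?c l k) * (monom_fun (Suc l) k z
          + of_real (2 * ?c) * monom_fun (Suc l) (k + 1) z + monom_fun (Suc l) (k + 2) z)
        = of_real (w_coeff ?c l k) * monom_fun l k z
          * ((z $ 1)\<^sup>2 + (z $ 2)\<^sup>2 + 2 * of_real ?c * (z $ 1) * (z $ 2))"
        using j by (simp add: monom_fun_def power2_eq_square ring_distribs mult_ac)
    qed
    also have "\<dots> = w_vec \<tau> (Suc l) z"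
      using Suc by (simp add: sum_distrib_right[symmetric] w_vec_def mult.commute)
    finally show ?case by simp
  qed
qed

lemma w_vec_Sym: "w_vec \<tau> l \<in> Sym l"
  by (rule SymI[OF w_vec_expand])

lemma u_vec_monom: "u_vec l = monom_fun l 0"
  by (simp add: u_vec_def monom_fun_def)

definition w_norm2 :: "real \<Rightarrow> nat \<Rightarrow> real" where
  "w_norm2 c l = (\<Sum>k\<le>2 * l. (w_coeff c l k)\<^sup>2 / real ((2 * l) choose k))"

lemma sym_norm_w_vec: "(sym_norm l (w_vec \<tau> l))\<^sup>2 = w_norm2 (cosh \<tau> / sinh \<tau>) l"
  unfolding sym_norm_power2_eq w_norm2_def
  by (subst w_vec_expand, subst sym_coeff_eq) (auto intro!: sum.cong)

text \<open>
  Only the squares of the three terms of the recursion are kept; the cross terms are non-negative.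
\<close>

lemma w_norm2_less_Suc:
  assumes c: "c \<ge> 1"
  shows "w_norm2 c l < w_norm2 c (Suc l)"
proof -
  define n where "n = 2 * l"
  define X where "X = (\<lambda>k. 1 / real ((n + 2) choose k))"
  let ?a = "w_coeff c l"
  \<comment> \<open>Estimate for one monomial: the left side is its squared norm in degree
    \<open>n\<close>, the right side adds the squared norms in degree \<open>n + 2\<close> of the
    three terms that the factor \<open>1 + 2 c x + x^2\<close> makes of it.\<close>
  have bin: "1 / real (n choose k) < X k + 4 * c\<^sup>2 * X (k + 1) + X (k + 2)" if k: "k \<le> n" for k
  proof -
    obtain j where j: "n = k + j" using le_Suc_ex[OF k] by blast
    have b: "real (m choose i) = fact m / (fact i * fact (m - i))" if "i \<le> m" for m i
      using that by (simp add: binomial_fact)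
    have f2: "fact (m + 2) = (real m + 2) * (real m + 1) * fact m" for m
      by (simp add: fact_reduce[of "m + 2"] fact_reduce[of "m + 1"]) (simp add: algebra_simps)
    have f1: "fact (m + 1) = (real m + 1) * fact m" for m
      by (simp add: algebra_simps)
    \<comment> \<open>The common factor. With \<open>j = n - k\<close> there remains an inequality
      between quadratic polynomials, in which the excess \<open>2 k j - 2\<close> of the left side
      is beaten by \<open>4 (k + 1) (j + 1)\<close>.\<close>
    define F where "F = (fact k * fact j / fact (k + j + 2) :: real)"
    have F: "F > 0" by (simp add: F_def)
    have "1 / real (n choose k) = F * ((real k + real j + 2) * (real k + real j + 1))"
    proof -
      have f: "fact (k + j + 2) = (real k + real j + 2) * (real k + real j + 1) * fact (k + j)"
        using f2[of "k + j"] by simp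
      have "(real k + real j + 2) * (real k + real j + 1) \<noteq> 0" by (simp add: add_nonneg_eq_0_iff)
      then show ?thesis unfolding F_def f j by (simp add: b)
    qed
    also have "\<dots> < F * ((real j + 2) * (real j + 1) + 4 * c\<^sup>2 * ((real k + 1) * (real j + 1)) + (real k + 2) * (real k + 1))"
    proof (rule mult_strict_left_mono[OF _ F])
      have "1 \<le> c\<^sup>2" using c by simp
      then have "4 * 1 * ((real k + 1) * (real j + 1)) \<le> 4 * c\<^sup>2 * ((real k + 1) * (real j + 1))"
        by (intro mult_right_mono) auto
      moreover have "4 * 1 * ((real k + 1) * (real j + 1)) = 4 * (real k * real j) + 4 * real k + 4 * real j + 4"
        and "(real k + real j + 2) * (real k + real j + 1)
          = (real j + 2) * (real j + 1) + (real k + 2) * (real k + 1) + 2 * (real k * real j) - 2"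
        by (simp_all add: algebra_simps)
      moreover have "0 \<le> real k * real j" "0 \<le> real k" "0 \<le> real j" by simp_all
      ultimately show "(real k + real j + 2) * (real k + real j + 1)
          < (real j + 2) * (real j + 1) + 4 * c\<^sup>2 * ((real k + 1) * (real j + 1)) + (real k + 2) * (real k + 1)"
        by linarith
    qed
    also have "\<dots> = X k + 4 * c\<^sup>2 * X (k + 1) + X (k + 2)"
    proof -
      have "X k = F * ((real j + 2) * (real j + 1))" "X (k + 1) = F * ((real k + 1) * (real j + 1))"
        "X (k + 2) = F * ((real k + 2) * (real k + 1))"
        unfolding X_def F_def j f1[symmetric] f2[symmetric] mult.assoc[symmetric]
        using b[of k "k + j + 2"] b[of "k + 1" "k + j + 2"] b[of "k + 2" "k + j + 2"]
          f1[of k] f1[of j] f2[of k] f2[of j]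
        by (simp_all add: mult_ac add_ac)
      then show ?thesis by (simp add: algebra_simps)
    qed
    finally show ?thesis .
  qed
  have "w_norm2 c l = (\<Sum>k\<le>n. (?a k)\<^sup>2 * (1 / real (n choose k)))"
    by (simp add: w_norm2_def n_def)
  also have "\<dots> < (\<Sum>k\<le>n. (?a k)\<^sup>2 * (X k + 4 * c\<^sup>2 * X (k + 1) + X (k + 2)))"
  proof (rule sum_strict_mono_ex1)
    show "\<forall>k\<in>{..n}. (?a k)\<^sup>2 * (1 / real (n choose k)) \<le> (?a k)\<^sup>2 * (X k + 4 * c\<^sup>2 * X (k + 1) + X (k + 2))"
      by (intro ballI mult_left_mono less_imp_le[OF bin]) auto
    \<comment> \<open>Strictness comes from index \<open>0\<close>, where the coefficient is
      \<open>1\<close>.\<close>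
    show "\<exists>k\<in>{..n}. (?a k)\<^sup>2 * (1 / real (n choose k)) < (?a k)\<^sup>2 * (X k + 4 * c\<^sup>2 * X (k + 1) + X (k + 2))"
      using bin[of 0] by (intro bexI[of _ 0]) auto
  qed simp
  \<comment> \<open>The shift identity for the squared coefficients, with
    \<open>m = 4 c^2\<close>.\<close>
  also have "\<dots> = (\<Sum>k\<le>n + 2. ((?a k)\<^sup>2 + 4 * c\<^sup>2 * (case k of 0 \<Rightarrow> 0 | Suc j \<Rightarrow> (?a j)\<^sup>2)
      + (case k of 0 \<Rightarrow> 0 | Suc i \<Rightarrow> (case i of 0 \<Rightarrow> 0 | Suc j \<Rightarrow> (?a j)\<^sup>2))) * X k)"
    by (rule sum_three_shifts[symmetric]) (simp add: w_coeff_eq_0 n_def)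
  also have "\<dots> \<le> (\<Sum>k\<le>n + 2. (w_coeff c (Suc l) k)\<^sup>2 * X k)"
  proof (intro sum_mono mult_right_mono)
    fix k
    define x where "x = (case k of 0 \<Rightarrow> 0 | Suc j \<Rightarrow> ?a j)"
    define y where "y = (case k of 0 \<Rightarrow> 0 | Suc i \<Rightarrow> (case i of 0 \<Rightarrow> 0 | Suc j \<Rightarrow> ?a j))"
    have nn: "0 \<le> ?a k" "0 \<le> x" "0 \<le> y" "0 \<le> c"
      using c by (auto simp: x_def y_def w_coeff_nonneg split: nat.split)
    have "(?a k)\<^sup>2 + 4 * c\<^sup>2 * x\<^sup>2 + y\<^sup>2 \<le> (?a k + 2 * c * x + y)\<^sup>2"
    proof -
      have "0 \<le> 2 * (?a k * (2 * c * x)) + 2 * (?a k * y) + 2 * (2 * c * x * y)"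
        using nn by (intro add_nonneg_nonneg mult_nonneg_nonneg) auto
      then show ?thesis by (simp add: power2_eq_square algebra_simps)
    qed
    then show "(?a k)\<^sup>2 + 4 * c\<^sup>2 * (case k of 0 \<Rightarrow> 0 | Suc j \<Rightarrow> (?a j)\<^sup>2)
      + (case k of 0 \<Rightarrow> 0 | Suc i \<Rightarrow> (case i of 0 \<Rightarrow> 0 | Suc j \<Rightarrow> (?a j)\<^sup>2)) \<le> (w_coeff c (Suc l) k)\<^sup>2"
      by (simp add: x_def y_def split: nat.splits)
  qed (simp add: X_def)
  also have "\<dots> = w_norm2 c (Suc l)"
    by (simp add: w_norm2_def n_def X_def del: sum.atMost_Suc)
  finally show ?thesis .
qed

lemma w_coeff_sum: "(\<Sum>k\<le>2 * l. w_coeff c l k) = (2 + 2 * c) ^ l"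
proof (induction l)
  case (Suc l)
  have "(\<Sum>k\<le>2 * l + 2. w_coeff c (Suc l) k * 1) = (\<Sum>k\<le>2 * l. w_coeff c l k * (1 + (2 * c) * 1 + 1))"
    unfolding w_coeff.simps by (rule sum_three_shifts) (simp add: w_coeff_eq_0)
  also have "\<dots> = (\<Sum>k\<le>2 * l. w_coeff c l k) * (1 + (2 * c) * 1 + 1)"
    by (simp only: sum_distrib_right)
  finally show ?case using Suc by (simp del: w_coeff.simps sum.atMost_Suc)
qed simp

text \<open>Evaluation at \<open>(1, 1)\<close> and Cauchy-Schwarz.\<close>

lemma w_norm2_ge:
  assumes c: "c \<ge> 1"
  shows "4 ^ l \<le> w_norm2 c l"
proof -
  let ?C = "\<lambda>k. real ((2 * l) choose k)"
  \<comment> \<open>One factor \<open>4 ^ l\<close> will cancel against the sum of the binomials;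
    \<open>c \<ge> 1\<close> makes the value \<open>(2 + 2 c) ^ l\<close> at \<open>(1, 1)\<close>
    at least \<open>4 ^ l\<close>.\<close>
  have "(4::real) ^ l * 4 ^ l = (4 ^ l)\<^sup>2" by (simp add: power2_eq_square)
  also have "\<dots> \<le> ((2 + 2 * c) ^ l)\<^sup>2" using c by (intro power_mono) auto
  also have "\<dots> = (\<Sum>k\<le>2 * l. (w_coeff c l k / sqrt (?C k)) * sqrt (?C k))\<^sup>2"
    unfolding w_coeff_sum[symmetric] by (intro arg_cong[where f="\<lambda>x. x\<^sup>2"] sum.cong) auto
  also have "\<dots> \<le> (\<Sum>k\<le>2 * l. (w_coeff c l k / sqrt (?C k))\<^sup>2) * (\<Sum>k\<le>2 * l. (sqrt (?C k))\<^sup>2)"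
    by (rule Cauchy_Schwarz_ineq_sum)
  also have "(\<Sum>k\<le>2 * l. (sqrt (?C k))\<^sup>2) = real (\<Sum>k\<le>2 * l. (2 * l) choose k)" by simp
  also have "\<dots> = 4 ^ l" unfolding choose_row_sum by (simp add: power_mult)
  also have "(\<Sum>k\<le>2 * l. (w_coeff c l k / sqrt (?C k))\<^sup>2) = w_norm2 c l"
    by (simp add: w_norm2_def power_divide)
  finally show ?thesis by simp
qed

lemma coth_ge_1: "\<tau> > 0 \<Longrightarrow> cosh \<tau> / sinh \<tau> \<ge> (1::real)"
  using sinh_less_cosh_real[of \<tau>] by (simp add: less_imp_le)

lemma sym_inner_w_u:
  assumes "\<tau> > 0"
  shows "cmod (sym_inner l (sym_normalize l (w_vec \<tau> l)) (sym_normalize l (u_vec l)))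
    = 1 / sqrt (w_norm2 (cosh \<tau> / sinh \<tau>) l)"
proof -
  have u: "sym_norm l (u_vec l) = 1"
    using sym_norm_monom[of 0 l] sym_norm_nonneg[of l "u_vec l"] by (simp add: u_vec_monom power2_eq_1_iff)
  have "sym_inner l (w_vec \<tau> l) (u_vec l) = 1"
    unfolding u_vec_monom by (subst sym_inner_monom_right, simp) (subst w_vec_expand, subst sym_coeff_eq, simp)
  moreover have "sym_norm l (w_vec \<tau> l) = sqrt (w_norm2 (cosh \<tau> / sinh \<tau>) l)"
    using sym_norm_w_vec[of l \<tau>] sym_norm_nonneg[of l "w_vec \<tau> l"] real_sqrt_unique by metis
  ultimately show ?thesis
    by (simp add: sym_inner_normalize w_vec_Sym u_vec_monom[symmetric] u monom_Sym[of 0 l, folded u_vec_monom] norm_divide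
        sym_norm_nonneg) (simp add: w_norm2_def sum_nonneg)
qed

text \<open>A majorant for both series of the final proof. In the one for \<open>summable_c\<close>,
  one power of \<open>2 l + 1\<close> is the dimension, the other bounds the sup norm
  \<open>sqrt (2 l + 1)\<close>, and \<open>(1 / 2) ^ l\<close> bounds the overlap. The ratio of
  consecutive terms tends to \<open>1/2\<close> and is at most \<open>3/4\<close> from
  \<open>5\<close> on.\<close>

lemma summable_odd_square: "summable (\<lambda>l. (real (2 * l + 1))\<^sup>2 * (1 / 2) ^ l)"
proof (rule summable_ratio_test[of "3 / 4" 5])
  fix n :: nat assume "5 \<le> n"
  then have n: "5 * real n \<le> real n * real n" "5 \<le> real n" by (auto intro: mult_right_mono)
  have "2 * (real (2 * Suc n + 1))\<^sup>2 \<le> 3 * (real (2 * n + 1))\<^sup>2"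
  proof -
    have "2 * (real (2 * Suc n + 1))\<^sup>2 = 8 * (real n * real n) + 24 * real n + 18"
      "3 * (real (2 * n + 1))\<^sup>2 = 12 * (real n * real n) + 12 * real n + 3"
      by (simp_all add: power2_eq_square algebra_simps)
    then show ?thesis using n by linarith
  qed
  then show "norm ((real (2 * Suc n + 1))\<^sup>2 * (1 / 2) ^ Suc n) \<le> 3 / 4 * norm ((real (2 * n + 1))\<^sup>2 * (1 / 2) ^ n)"
    by (simp add: field_simps)
qed simp

section \<open>The Toeplitz operator\<close>

theorem proposition8p2:
  fixes \<mu> :: "(real^3^3) measure"
    and D :: "nat \<Rightarrow> (complex^2 \<Rightarrow> complex) \<Rightarrow> ((complex^2 \<Rightarrow> complex) \<Rightarrow> complex)"
    and \<tau> :: real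
  assumes "haar_prob_SO3 \<mu>"
    and "\<forall>l. dual_identification l (D l)"
    and "\<tau> > 0"
  shows "positive_op_on \<mu> (hardy_Y \<mu> D) (toeplitz \<mu> D \<tau>) \<and>
         trace_class_on \<mu> (hardy_Y \<mu> D) (toeplitz \<mu> D \<tau>) \<and>
         equivariant_on \<mu> (hardy_Y \<mu> D) (toeplitz \<mu> D \<tau>) \<and>
         (\<forall>l. pw_block D l (sym_normalize l (u_vec l)) \<subseteq> hardy_Y \<mu> D \<and>
              (\<forall>f\<in>pw_block D l (sym_normalize l (u_vec l)).
                 l2_eq \<mu> (toeplitz \<mu> D \<tau> f) (\<lambda>g. of_real (s_val l \<tau>) * f g)) \<and>
              l2_has_dim \<mu> (pw_block D l (sym_normalize l (u_vec l))) (2 * l + 1) \<and>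
              l2_has_dim \<mu> {f \<in> hardy_Y \<mu> D. l2_eq \<mu> (toeplitz \<mu> D \<tau> f)
                                               (\<lambda>g. of_real (s_val l \<tau>) * f g)} (2 * l + 1))"
proof -
  interpret haar_SO3_dual \<mu> D
    by unfold_locales (use assms in auto)
  define u where "u = (\<lambda>l. sym_normalize l (u_vec l))"
  define w where "w = (\<lambda>l. sym_normalize l (w_vec \<tau> l))"
  define nw where "nw = w_norm2 (cosh \<tau> / sinh \<tau>)"
  define c where "c = (\<lambda>l. sym_inner l (w l) (u l))"
  note coth = coth_ge_1[OF assms(3)]
  have nw_ge: "4 ^ l \<le> nw l" for l unfolding nw_def by (rule w_norm2_ge[OF coth])
  have nw_pos: "0 < nw l" for l by (rule less_le_trans[OF _ nw_ge]) simp
  have uS: "u_vec l \<in> Sym l" for l by (simp add: u_vec_monom monom_Sym)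
  have un: "sym_norm l (u_vec l) \<noteq> 0" for l using sym_norm_monom_pos[of 0 l] by (simp add: u_vec_monom)
  have wn: "sym_norm l (w_vec \<tau> l) \<noteq> 0" for l
    using sym_norm_w_vec[of l \<tau>] nw_pos[of l] unfolding nw_def by auto
  have u: "u l \<in> Sym l" "sym_inner l (u l) (u l) = 1" and w: "w l \<in> Sym l" "sym_inner l (w l) (w l) = 1" for l
    unfolding u_def w_def
    by (simp_all add: sym_normalize_Sym uS w_vec_Sym sym_inner_normalize_self un wn)
  have c: "cmod (c l) = 1 / sqrt (nw l)" for l
    unfolding c_def u_def w_def nw_def by (rule sym_inner_w_u[OF assms(3)])
  have c2: "(cmod (c l))\<^sup>2 = 1 / nw l" for l
    using nw_pos[of l] by (simp add: c power_divide)
  have s_val: "s_val l \<tau> = (cmod (c l))\<^sup>2" for l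
    by (simp add: s_val_def c_def u_def w_def)
  have c_le: "cmod (c l) \<le> (1 / 2) ^ l" for l
  proof -
    have "2 ^ l = sqrt (4 ^ l)" by (simp add: real_sqrt_power)
    also have "\<dots> \<le> sqrt (nw l)" using nw_ge by simp
    finally show ?thesis unfolding c by (simp add: power_one_over frac_le)
  qed
  have c_le1: "cmod (c l) \<le> 1" for l
    by (rule order_trans[OF c_le]) (simp add: power_le_one)
  have sq: "real (2 * l + 1) \<le> (real (2 * l + 1))\<^sup>2" "sqrt (real (2 * l + 1)) \<le> real (2 * l + 1)" for l
  proof -
    show "real (2 * l + 1) \<le> (real (2 * l + 1))\<^sup>2" by (simp add: power2_eq_square)
    then show "sqrt (real (2 * l + 1)) \<le> real (2 * l + 1)" by (intro real_le_lsqrt) auto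
  qed
  have summ1: "summable (\<lambda>l. real (2 * l + 1) * cmod (c l) * sqrt (real (2 * l + 1)))"
  proof (rule summable_comparison_test'[OF summable_odd_square, of 0])
    fix l
    have "real (2 * l + 1) * cmod (c l) * sqrt (real (2 * l + 1))
        \<le> real (2 * l + 1) * (1 / 2) ^ l * real (2 * l + 1)"
      by (intro mult_mono c_le sq order_refl) auto
    then show "norm (real (2 * l + 1) * cmod (c l) * sqrt (real (2 * l + 1)))
        \<le> (real (2 * l + 1))\<^sup>2 * (1 / 2) ^ l"
      by (simp add: power2_eq_square mult_ac abs_mult)
  qed
  have summ2: "summable (\<lambda>l. real (2 * l + 1) * (cmod (c l))\<^sup>2)"
  proof (rule summable_comparison_test'[OF summable_odd_square, of 0])
    fix l
    have "(cmod (c l))\<^sup>2 \<le> (1 / 2) ^ l"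
      using mult_mono[OF c_le1 c_le, of l l] by (simp add: power2_eq_square)
    then show "norm (real (2 * l + 1) * (cmod (c l))\<^sup>2) \<le> (real (2 * l + 1))\<^sup>2 * (1 / 2) ^ l"
      using mult_mono[OF sq(1)[of l], of "(cmod (c l))\<^sup>2" "(1 / 2) ^ l"] by (simp add: abs_mult)
  qed
  have nw_mono: "strict_mono nw"
    unfolding nw_def by (intro strict_monoI_Suc w_norm2_less_Suc[OF coth])
  have inj: "inj (\<lambda>l. (cmod (c l))\<^sup>2)"
    unfolding c2 using strict_mono_eq[OF nw_mono] nw_pos by (auto intro!: injI simp: less_imp_neq)
  \<comment> \<open>\<open>E\<close> is the Hardy space of the circle bundle, \<open>F\<close> that
    of the tube.\<close>
  interpret X: crossed_blocks \<mu> "\<lambda>l. 2 * l + 1" "\<lambda>l. sqrt (real (2 * l + 1))" "pw_basis u" "pw_basis w" c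
  proof (intro crossed_blocks.intro crossed_blocks_axioms.intro ortho_blocks_pw_basis u w summ1)
    show "l2_inner \<mu> (pw_basis w l k) (pw_basis u l' k') = (if l = l' \<and> k = k' then c l else 0)"
      if "k < 2 * l + 1" "k' < 2 * l' + 1" for k l k' l'
      unfolding c_def using that by (intro pw_basis_inner u w)
  qed
  \<comment> \<open>The vectors that define the Hardy spaces are non-zero multiples of the unit
    vectors, so both span the same blocks.\<close>
  have uw: "u_vec l = (\<lambda>z. of_real (sym_norm l (u_vec l)) * u l z)"
    "w_vec \<tau> l = (\<lambda>z. of_real (sym_norm l (w_vec \<tau> l)) * w l z)" for l
    unfolding u_def w_def sym_normalize_def using un[of l] wn[of l] by (simp_all add: fun_eq_iff)
  have blocks: "pw_block D l (u_vec l) = X.E.block l" "pw_block D l (w_vec \<tau> l) = X.F.block l" for l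
    unfolding X.E.block_def X.F.block_def
    by (rule pw_block_eq[of u, OF u(1) _ uw(1)], simp add: un,
        rule pw_block_eq[of w, OF w(1) _ uw(2)], simp add: wn)
  have ublock: "pw_block D l (sym_normalize l (u_vec l)) = X.E.block l" for l
    unfolding X.E.block_def using u by (intro pw_block_eq[of u 1]) (auto simp: u_def)
  have Y: "hardy_Y \<mu> D = X.E.hsum" and tube: "hardy_tube \<mu> D \<tau> = X.F.hsum"
    unfolding hardy_Y_def hardy_tube_def X.E.hsum_def X.F.hsum_def blocks by simp_all
  have T: "toeplitz \<mu> D \<tau> = X.T"
    by (rule ext) (simp only: toeplitz_def X.T_def Y tube)
  have reg: "left_regular h f \<in> X.E.hsum" if "h \<in> SO3" "f \<in> X.E.hsum" for h f
    using left_regular_hilbert_sum[OF that(1) uS, where f=f] that(2) unfolding Y[symmetric] hardy_Y_def .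
  have reg': "left_regular h f \<in> X.F.hsum" if "h \<in> SO3" "f \<in> X.F.hsum" for h f
    using left_regular_hilbert_sum[OF that(1) w_vec_Sym, where f=f] that(2) unfolding tube[symmetric] hardy_tube_def .
  have cancel: "left_regular h (left_regular (matrix_inv h) f) = f" if "h \<in> SO3" for h f
    using that by (simp add: left_regular_def SO3_inv_inv SO3_cancel matrix_mul_assoc)
  have equi: "equivariant_on \<mu> X.E.hsum X.T"
    unfolding equivariant_on_def
  proof (intro ballI conjI reg)
    fix h f assume h: "h \<in> SO3" and f: "f \<in> X.E.hsum"
    show "l2_eq \<mu> (X.T (left_regular h f)) (left_regular h (X.T f))"
    \<comment> \<open>Surjectivity of a translation on each Hardy space comes from the inverse
      translation, which preserves that space too.\<close>
    proof (rule X.T_commute[OF left_regular_L2[OF h] left_regular_inner[OF h] _ reg[OF h] _ reg'[OF h] _ f])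
      show "\<exists>k\<in>X.E.hsum. left_regular h k = g" if "g \<in> X.E.hsum" for g
        using cancel[OF h] reg[OF SO3_inv[OF h] that] by blast
      show "\<exists>k\<in>X.F.hsum. left_regular h k = g" if "g \<in> X.F.hsum" for g
        using cancel[OF h] reg'[OF SO3_inv[OF h] that] by blast
    qed (simp_all add: left_regular_def)
  qed
  show ?thesis
    unfolding Y T ublock s_val
  proof (intro conjI allI ballI equi X.T_positive X.T_trace_class[OF summ2] X.E.block_subset_hsum X.T_block)
    fix l
    show "l2_has_dim \<mu> (X.E.block l) (2 * l + 1)"
      unfolding l2_has_dim_def using X.E.orthonormal_basis_block[of l] X.E.card_block[of l] by blast
    show "l2_has_dim \<mu> {f \<in> X.E.hsum. l2_eq \<mu> (X.T f) (\<lambda>g. of_real ((cmod (c l))\<^sup>2) * f g)} (2 * l + 1)"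
      unfolding l2_has_dim_def using X.T_eigenspace[OF inj, of l] X.E.card_block[of l] by blast
  qed
qed

end
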